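(* Let $M=(M,\eta,\mu)$ be an exact monad on an abelian category $\mathcal{A}$ (i.e. a monad whose underlying endofunctor is exact), and let $\mathcal{N}\subseteq\mathcal{A}$ be a Serre subcategory satisfying $M(\mathcal{N})\subseteq\mathcal{N}$. Let $q\colon\mathcal{A}\to\mathcal{A}/\mathcal{N}$ be the quotient functor and $\bar M$ the induced monad on $\mathcal{A}/\mathcal{N}$. Then the functor $$\bar\Phi\colon M\text{-}\mathrm{Mod}_{\mathcal{A}}\,/\,M\text{-}\mathrm{Mod}_{\mathcal{N}}\longrightarrow\bar M\text{-}\mathrm{Mod}_{\mathcal{A}/\mathcal{N}}$$ induced by the exact functor $\Phi\colon M\text{-}\mathrm{Mod}_{\mathcal{A}}\to\bar M\text{-}\mathrm{Mod}_{\mathcal{A}/\mathcal{N}}$, $(X,\lambda)\mapsto(X,q(\lambda))$, $\theta\mapsto q(\theta)$, is an equivalence of categories.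
   Context: For a monad $(M,\eta,\mu)$ on a category $\mathcal{C}$, an $M$-module is a pair $(X,\lambda)$ with $X\in\mathcal{C}$ and $\lambda\colon M(X)\to X$ satisfying $\lambda\circ M(\lambda)=\lambda\circ\mu_X$ and $\lambda\circ\eta_X=\mathrm{Id}_X$; a morphism $(X,\lambda)\to(X',\lambda')$ is a morphism $f\colon X\to X'$ with $f\circ\lambda=\lambda'\circ M(f)$. These form $M\text{-}\mathrm{Mod}_{\mathcal{C}}$. For an exact monad on an abelian category $\mathcal{A}$, $M\text{-}\mathrm{Mod}_{\mathcal{A}}$ is abelian, with exactness detected on underlying objects. A Serre subcategory is a full subcategory closed under subobjects, quotient objects and extensions; $\mathcal{A}/\mathcal{N}$ denotes the (Gabriel) quotient abelian category, which has the same objects as $\mathcal{A}$. Since $M$ is exact and $M(\mathcal{N})\subseteq\mathcal{N}$, $M$ induces an endofunctor $\bar M$ of $\mathcal{A}/\mathcal{N}$, and $\eta,\mu$ induce natural transformations $\bar\eta,\bar\mu$; the induced monad is $(\bar M,\bar\eta,\bar\mu)$. $M\text{-}\mathrm{Mod}_{\mathcal{N}}$ is identified with the full subcategory of $M\text{-}\mathrm{Mod}_{\mathcal{A}}$ of modules whose underlying object lies in $\mathcal{N}$; it is a Serre subcategory. The functor $\Phi$ is exact and vanishes on $M\text{-}\mathrm{Mod}_{\mathcal{N}}$, hence induces $\bar\Phi$. *)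

theory Defs
  imports Main "HOL-Algebra.Group"
begin

section \<open>Categories and functors\<close>

text \<open>
  A category has explicit carriers of objects and arrows, and arrows know their domain and
  codomain. Composition is total as a HOL function and is only meaningful on composable arrows;
  \<open>g \<cdot> f\<close> means first \<open>f\<close>, then \<open>g\<close>.
\<close>

record ('o, 'a) cat =
  Obj :: "'o set"
  Arr :: "'a set"
  Dom :: "'a \<Rightarrow> 'o"
  Cod :: "'a \<Rightarrow> 'o"
  Idn :: "'o \<Rightarrow> 'a"
  Comp :: "'a \<Rightarrow> 'a \<Rightarrow> 'a"  (infixl \<open>\<cdot>\<index>\<close> 70)

definition Hom :: "('o, 'a) cat \<Rightarrow> 'o \<Rightarrow> 'o \<Rightarrow> 'a set" where
  "Hom C X Y = {f \<in> Arr C. Dom C f = X \<and> Cod C f = Y}"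

locale category =
  fixes C :: "('o, 'a) cat" (structure)
  assumes Dom_in_Obj: "f \<in> Arr C \<Longrightarrow> Dom C f \<in> Obj C"
    and Cod_in_Obj: "f \<in> Arr C \<Longrightarrow> Cod C f \<in> Obj C"
    and Idn_in_Hom: "X \<in> Obj C \<Longrightarrow> Idn C X \<in> Hom C X X"
    and Comp_in_Hom: "f \<in> Hom C X Y \<Longrightarrow> g \<in> Hom C Y Z \<Longrightarrow> g \<cdot> f \<in> Hom C X Z"
    and Comp_Idn: "f \<in> Hom C X Y \<Longrightarrow> f \<cdot> Idn C X = f"
    and Idn_Comp: "f \<in> Hom C X Y \<Longrightarrow> Idn C Y \<cdot> f = f"
    and Comp_assoc: "f \<in> Hom C W X \<Longrightarrow> g \<in> Hom C X Y \<Longrightarrow> h \<in> Hom C Y Z \<Longrightarrow>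
      h \<cdot> (g \<cdot> f) = (h \<cdot> g) \<cdot> f"

definition is_iso :: "('o, 'a) cat \<Rightarrow> 'a \<Rightarrow> bool" where
  "is_iso C f \<longleftrightarrow> f \<in> Arr C \<and>
    (\<exists>g \<in> Hom C (Cod C f) (Dom C f).
      g \<cdot>\<^bsub>C\<^esub> f = Idn C (Dom C f) \<and> f \<cdot>\<^bsub>C\<^esub> g = Idn C (Cod C f))"

definition is_mono :: "('o, 'a) cat \<Rightarrow> 'a \<Rightarrow> bool" where
  "is_mono C f \<longleftrightarrow> f \<in> Arr C \<and>
    (\<forall>W. \<forall>g \<in> Hom C W (Dom C f). \<forall>h \<in> Hom C W (Dom C f). f \<cdot>\<^bsub>C\<^esub> g = f \<cdot>\<^bsub>C\<^esub> h \<longrightarrow> g = h)"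

definition is_epi :: "('o, 'a) cat \<Rightarrow> 'a \<Rightarrow> bool" where
  "is_epi C f \<longleftrightarrow> f \<in> Arr C \<and>
    (\<forall>Z. \<forall>g \<in> Hom C (Cod C f) Z. \<forall>h \<in> Hom C (Cod C f) Z. g \<cdot>\<^bsub>C\<^esub> f = h \<cdot>\<^bsub>C\<^esub> f \<longrightarrow> g = h)"

record ('o, 'a, 'p, 'b) fctr =
  OMap :: "'o \<Rightarrow> 'p"
  AMap :: "'a \<Rightarrow> 'b"

definition is_functor ::
    "('o, 'a) cat \<Rightarrow> ('p, 'b) cat \<Rightarrow> ('o, 'a, 'p, 'b) fctr \<Rightarrow> bool" where
  "is_functor C D F \<longleftrightarrow> category C \<and> category D \<and>
    (\<forall>X \<in> Obj C. OMap F X \<in> Obj D) \<and>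
    (\<forall>f \<in> Arr C. AMap F f \<in> Hom D (OMap F (Dom C f)) (OMap F (Cod C f))) \<and>
    (\<forall>X \<in> Obj C. AMap F (Idn C X) = Idn D (OMap F X)) \<and>
    (\<forall>X Y Z. \<forall>f \<in> Hom C X Y. \<forall>g \<in> Hom C Y Z.
      AMap F (g \<cdot>\<^bsub>C\<^esub> f) = AMap F g \<cdot>\<^bsub>D\<^esub> AMap F f)"

definition id_functor :: "('o, 'a, 'o, 'a) fctr" where
  "id_functor = \<lparr>OMap = (\<lambda>X. X), AMap = (\<lambda>f. f)\<rparr>"

definition comp_functor ::
    "('p, 'b, 'q, 'c) fctr \<Rightarrow> ('o, 'a, 'p, 'b) fctr \<Rightarrow> ('o, 'a, 'q, 'c) fctr" where
  "comp_functor G F = \<lparr>OMap = (\<lambda>X. OMap G (OMap F X)), AMap = (\<lambda>f. AMap G (AMap F f))\<rparr>"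

definition nat_trans :: "('o, 'a) cat \<Rightarrow> ('p, 'b) cat \<Rightarrow> ('o, 'a, 'p, 'b) fctr \<Rightarrow>
    ('o, 'a, 'p, 'b) fctr \<Rightarrow> ('o \<Rightarrow> 'b) \<Rightarrow> bool" where
  "nat_trans C D F G \<alpha> \<longleftrightarrow> is_functor C D F \<and> is_functor C D G \<and>
    (\<forall>X \<in> Obj C. \<alpha> X \<in> Hom D (OMap F X) (OMap G X)) \<and>
    (\<forall>X Y. \<forall>f \<in> Hom C X Y. AMap G f \<cdot>\<^bsub>D\<^esub> \<alpha> X = \<alpha> Y \<cdot>\<^bsub>D\<^esub> AMap F f)"

definition nat_iso :: "('o, 'a) cat \<Rightarrow> ('p, 'b) cat \<Rightarrow> ('o, 'a, 'p, 'b) fctr \<Rightarrow>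
    ('o, 'a, 'p, 'b) fctr \<Rightarrow> ('o \<Rightarrow> 'b) \<Rightarrow> bool" where
  "nat_iso C D F G \<alpha> \<longleftrightarrow> nat_trans C D F G \<alpha> \<and> (\<forall>X \<in> Obj C. is_iso D (\<alpha> X))"

definition is_equivalence ::
    "('o, 'a) cat \<Rightarrow> ('p, 'b) cat \<Rightarrow> ('o, 'a, 'p, 'b) fctr \<Rightarrow> bool" where
  "is_equivalence C D F \<longleftrightarrow> is_functor C D F \<and>
    (\<exists>G \<alpha> \<beta>. is_functor D C G \<and>
      nat_iso C C id_functor (comp_functor G F) \<alpha> \<and>
      nat_iso D D (comp_functor F G) id_functor \<beta>)"


section \<open>Abelian categories and exact functors\<close>

definition zero_object :: "('o, 'a) cat \<Rightarrow> 'o \<Rightarrow> bool" where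
  "zero_object C Z \<longleftrightarrow> Z \<in> Obj C \<and>
    (\<forall>X \<in> Obj C. (\<exists>!f. f \<in> Hom C X Z) \<and> (\<exists>!f. f \<in> Hom C Z X))"

definition zero_arrow :: "('o, 'a) cat \<Rightarrow> 'a \<Rightarrow> bool" where
  "zero_arrow C f \<longleftrightarrow>
    (\<exists>Z. zero_object C Z \<and> (\<exists>g h. g \<in> Hom C (Dom C f) Z \<and> h \<in> Hom C Z (Cod C f) \<and>
      f = h \<cdot>\<^bsub>C\<^esub> g))"

definition is_kernel :: "('o, 'a) cat \<Rightarrow> 'a \<Rightarrow> 'a \<Rightarrow> bool" where
  "is_kernel C k f \<longleftrightarrow> f \<in> Arr C \<and> k \<in> Arr C \<and> Cod C k = Dom C f \<and> zero_arrow C (f \<cdot>\<^bsub>C\<^esub> k) \<and>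
    (\<forall>W. \<forall>h \<in> Hom C W (Dom C f). zero_arrow C (f \<cdot>\<^bsub>C\<^esub> h) \<longrightarrow>
      (\<exists>!u. u \<in> Hom C W (Dom C k) \<and> k \<cdot>\<^bsub>C\<^esub> u = h))"

definition is_cokernel :: "('o, 'a) cat \<Rightarrow> 'a \<Rightarrow> 'a \<Rightarrow> bool" where
  "is_cokernel C c f \<longleftrightarrow> f \<in> Arr C \<and> c \<in> Arr C \<and> Dom C c = Cod C f \<and> zero_arrow C (c \<cdot>\<^bsub>C\<^esub> f) \<and>
    (\<forall>W. \<forall>h \<in> Hom C (Cod C f) W. zero_arrow C (h \<cdot>\<^bsub>C\<^esub> f) \<longrightarrow>
      (\<exists>!u. u \<in> Hom C (Cod C c) W \<and> u \<cdot>\<^bsub>C\<^esub> c = h))"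

definition preadditive ::
    "('o, 'a) cat \<Rightarrow> ('a \<Rightarrow> 'a \<Rightarrow> 'a) \<Rightarrow> ('o \<Rightarrow> 'o \<Rightarrow> 'a) \<Rightarrow> bool" where
  "preadditive C add zero \<longleftrightarrow> category C \<and>
    (\<forall>X \<in> Obj C. \<forall>Y \<in> Obj C.
      comm_group \<lparr>carrier = Hom C X Y, mult = add, one = zero X Y\<rparr>) \<and>
    (\<forall>X Y Z. \<forall>f \<in> Hom C X Y. \<forall>f' \<in> Hom C X Y. \<forall>g \<in> Hom C Y Z. \<forall>g' \<in> Hom C Y Z.
      g \<cdot>\<^bsub>C\<^esub> add f f' = add (g \<cdot>\<^bsub>C\<^esub> f) (g \<cdot>\<^bsub>C\<^esub> f') \<and>
      add g g' \<cdot>\<^bsub>C\<^esub> f = add (g \<cdot>\<^bsub>C\<^esub> f) (g' \<cdot>\<^bsub>C\<^esub> f))"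

definition is_biproduct :: "('o, 'a) cat \<Rightarrow> ('a \<Rightarrow> 'a \<Rightarrow> 'a) \<Rightarrow> ('o \<Rightarrow> 'o \<Rightarrow> 'a) \<Rightarrow>
    'o \<Rightarrow> 'o \<Rightarrow> 'o \<Rightarrow> 'a \<Rightarrow> 'a \<Rightarrow> 'a \<Rightarrow> 'a \<Rightarrow> bool" where
  "is_biproduct C add zero X Y B i j p r \<longleftrightarrow>
    i \<in> Hom C X B \<and> j \<in> Hom C Y B \<and> p \<in> Hom C B X \<and> r \<in> Hom C B Y \<and>
    p \<cdot>\<^bsub>C\<^esub> i = Idn C X \<and> r \<cdot>\<^bsub>C\<^esub> j = Idn C Y \<and>
    p \<cdot>\<^bsub>C\<^esub> j = zero Y X \<and> r \<cdot>\<^bsub>C\<^esub> i = zero X Y \<and>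
    add (i \<cdot>\<^bsub>C\<^esub> p) (j \<cdot>\<^bsub>C\<^esub> r) = Idn C B"

text \<open>
  Being abelian is a property of a category: the group structure on the Hom sets is
  uniquely determined, so it is quantified existentially rather than kept as data.
\<close>

definition abelian_category :: "('o, 'a) cat \<Rightarrow> bool" where
  "abelian_category C \<longleftrightarrow>
    (\<exists>add zero. preadditive C add zero \<and>
      (\<exists>Z. zero_object C Z) \<and>
      (\<forall>X \<in> Obj C. \<forall>Y \<in> Obj C. \<exists>B i j p r. is_biproduct C add zero X Y B i j p r)) \<and>
    (\<forall>f \<in> Arr C. (\<exists>k. is_kernel C k f) \<and> (\<exists>c. is_cokernel C c f)) \<and>
    (\<forall>f. is_mono C f \<longrightarrow> (\<exists>g. is_kernel C f g)) \<and>
    (\<forall>f. is_epi C f \<longrightarrow> (\<exists>g. is_cokernel C f g))"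

definition short_exact :: "('o, 'a) cat \<Rightarrow> 'a \<Rightarrow> 'a \<Rightarrow> bool" where
  "short_exact C i p \<longleftrightarrow> is_kernel C i p \<and> is_cokernel C p i"

text \<open>
  Between abelian categories a functor preserving short exact sequences preserves
  split ones and hence biproducts, so additivity need not be required separately.
\<close>

definition exact_functor ::
    "('o, 'a) cat \<Rightarrow> ('p, 'b) cat \<Rightarrow> ('o, 'a, 'p, 'b) fctr \<Rightarrow> bool" where
  "exact_functor C D F \<longleftrightarrow> is_functor C D F \<and>
    (\<forall>i p. short_exact C i p \<longrightarrow> short_exact D (AMap F i) (AMap F p))"


section \<open>Serre subcategories and quotient categories\<close>

text \<open>
  A full subcategory is given by its set of objects. A Serre subcategory is nonempty (so
  it contains the zero objects) and closed under subobjects, quotients and extensions.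
\<close>

definition serre_subcategory :: "('o, 'a) cat \<Rightarrow> 'o set \<Rightarrow> bool" where
  "serre_subcategory C N \<longleftrightarrow> N \<subseteq> Obj C \<and> N \<noteq> {} \<and>
    (\<forall>m. is_mono C m \<and> Cod C m \<in> N \<longrightarrow> Dom C m \<in> N) \<and>
    (\<forall>e. is_epi C e \<and> Dom C e \<in> N \<longrightarrow> Cod C e \<in> N) \<and>
    (\<forall>i p. short_exact C i p \<and> Dom C i \<in> N \<and> Cod C p \<in> N \<longrightarrow> Cod C i \<in> N)"

text \<open>
  The quotient category is the localization at the arrows whose kernel and cokernel
  lie in \<open>N\<close>. These admit a calculus of fractions, so an arrow \<open>X \<rightarrow> Y\<close> is an
  equivalence class of roofs \<open>X \<leftarrow>s\<midarrow> W \<midarrow>f\<rightarrow> Y\<close>, written \<open>(s, f)\<close> and read as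
  \<open>f s\<^sup>-\<^sup>1\<close>, with \<open>s\<close> such an arrow. Classes are tagged with \<open>X\<close> and \<open>Y\<close>.
\<close>

definition N_iso :: "('o, 'a) cat \<Rightarrow> 'o set \<Rightarrow> 'a set" where
  "N_iso C N = {s \<in> Arr C.
    (\<exists>k. is_kernel C k s \<and> Dom C k \<in> N) \<and> (\<exists>c. is_cokernel C c s \<and> Cod C c \<in> N)}"

definition roofs :: "('o, 'a) cat \<Rightarrow> 'o set \<Rightarrow> 'o \<Rightarrow> 'o \<Rightarrow> ('a \<times> 'a) set" where
  "roofs C N X Y = {(s, f). s \<in> N_iso C N \<and> f \<in> Arr C \<and>
    Dom C s = Dom C f \<and> Cod C s = X \<and> Cod C f = Y}"

definition roof_eq :: "('o, 'a) cat \<Rightarrow> 'o set \<Rightarrow> 'a \<times> 'a \<Rightarrow> 'a \<times> 'a \<Rightarrow> bool" where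
  "roof_eq C N = (\<lambda>(s, f) (s', f'). \<exists>W. \<exists>u \<in> Hom C W (Dom C s). \<exists>u' \<in> Hom C W (Dom C s').
    s \<cdot>\<^bsub>C\<^esub> u = s' \<cdot>\<^bsub>C\<^esub> u' \<and> s \<cdot>\<^bsub>C\<^esub> u \<in> N_iso C N \<and> f \<cdot>\<^bsub>C\<^esub> u = f' \<cdot>\<^bsub>C\<^esub> u')"

type_synonym ('o, 'a) qarr = "'o \<times> 'o \<times> ('a \<times> 'a) set"

definition roof_class :: "('o, 'a) cat \<Rightarrow> 'o set \<Rightarrow> 'a \<times> 'a \<Rightarrow> ('o, 'a) qarr" where
  "roof_class C N = (\<lambda>(s, f). (Cod C s, Cod C f,
    {r \<in> roofs C N (Cod C s) (Cod C f). roof_eq C N (s, f) r}))"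

text \<open>
  Roofs \<open>(s, f)\<close> from \<open>X\<close> to \<open>Y\<close> and \<open>(t, g)\<close> from \<open>Y\<close> to \<open>Z\<close> are composed by
  completing \<open>f\<close> and \<open>t\<close> to a square \<open>f u = t v\<close> with \<open>u\<close> inverted, which gives
  \<open>(s u, g v)\<close>. The definition collects the results over all choices; they form one class.
\<close>

definition qcomp ::
    "('o, 'a) cat \<Rightarrow> 'o set \<Rightarrow> ('o, 'a) qarr \<Rightarrow> ('o, 'a) qarr \<Rightarrow> ('o, 'a) qarr" where
  "qcomp C N = (\<lambda>(Y', Z, S) (X, Y, R). (X, Z,
    {r \<in> roofs C N X Z. \<exists>(s, f) \<in> R. \<exists>(t, g) \<in> S. \<exists>W u v.
      u \<in> Hom C W (Dom C f) \<and> u \<in> N_iso C N \<and> v \<in> Hom C W (Dom C t) \<and>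
      f \<cdot>\<^bsub>C\<^esub> u = t \<cdot>\<^bsub>C\<^esub> v \<and> roof_eq C N (s \<cdot>\<^bsub>C\<^esub> u, g \<cdot>\<^bsub>C\<^esub> v) r}))"

definition quotient_cat :: "('o, 'a) cat \<Rightarrow> 'o set \<Rightarrow> ('o, ('o, 'a) qarr) cat" where
  "quotient_cat C N = \<lparr>
    Obj = Obj C,
    Arr = {roof_class C N r | r X Y. r \<in> roofs C N X Y},
    Dom = (\<lambda>(X, Y, R). X),
    Cod = (\<lambda>(X, Y, R). Y),
    Idn = (\<lambda>X. roof_class C N (Idn C X, Idn C X)),
    Comp = qcomp C N\<rparr>"

definition quotient_functor ::
    "('o, 'a) cat \<Rightarrow> 'o set \<Rightarrow> ('o, 'a, 'o, ('o, 'a) qarr) fctr" where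
  "quotient_functor C N = \<lparr>
    OMap = (\<lambda>X. X),
    AMap = (\<lambda>f. roof_class C N (Idn C (Dom C f), f))\<rparr>"

text \<open>
  The functor on the quotient induced by a functor \<open>F\<close> that inverts the arrows in
  \<open>N_iso C N\<close>: the class of \<open>(s, f)\<close> goes to \<open>F f (F s)\<^sup>-\<^sup>1\<close>, the unique \<open>h\<close> with
  \<open>h (F s) = F f\<close>. Every exact functor vanishing on \<open>N\<close> is of this kind.
\<close>

definition induced_functor :: "('o, 'a) cat \<Rightarrow> 'o set \<Rightarrow> ('p, 'b) cat \<Rightarrow>
    ('o, 'a, 'p, 'b) fctr \<Rightarrow> ('o, ('o, 'a) qarr, 'p, 'b) fctr" where
  "induced_functor C N D F = \<lparr>
    OMap = OMap F,
    AMap = (\<lambda>(X, Y, R). THE h. h \<in> Hom D (OMap F X) (OMap F Y) \<and>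
      (\<forall>(s, f) \<in> R. h \<cdot>\<^bsub>D\<^esub> AMap F s = AMap F f))\<rparr>"

text \<open>The induced functor indeed restricts to \<open>F\<close> along the quotient functor.\<close>

lemma induced_functor_quotient_functor:
  assumes F: "is_functor C D F"
    and inv: "\<And>s. s \<in> N_iso C N \<Longrightarrow> is_iso D (AMap F s)"
    and N: "\<And>X. X \<in> Obj C \<Longrightarrow> Idn C X \<in> N_iso C N"
    and f: "f \<in> Arr C"
  shows "AMap (induced_functor C N D F) (AMap (quotient_functor C N) f) = AMap F f"
proof -
  interpret C: category C using F by (simp add: is_functor_def)
  interpret D: category D using F by (simp add: is_functor_def)
  note Fa = F[unfolded is_functor_def, THEN conjunct2, THEN conjunct2]
  define X where "X = Dom C f"
  define Y where "Y = Cod C f"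
  have fXY: "f \<in> Hom C X Y" and XO: "X \<in> Obj C"
    using f C.Dom_in_Obj by (auto simp: X_def Y_def Hom_def)
  have hom: "AMap F g \<in> Hom D (OMap F A) (OMap F B)" if "g \<in> Hom C A B" for g A B
    using Fa that by (auto simp: Hom_def)
  have cmp: "AMap F (h \<cdot>\<^bsub>C\<^esub> g) = AMap F h \<cdot>\<^bsub>D\<^esub> AMap F g"
    if "g \<in> Hom C A B" "h \<in> Hom C B E" for g h A B E
    using Fa that by blast
  have idn: "AMap F (Idn C X) = Idn D (OMap F X)" using Fa XO by blast
  have idX: "Idn C X \<in> Hom C X X" using C.Idn_in_Hom XO .
  let ?R = "{r \<in> roofs C N X Y. roof_eq C N (Idn C X, f) r}"
  have cls: "AMap (quotient_functor C N) f = (X, Y, ?R)"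
    using idX by (simp add: quotient_functor_def roof_class_def X_def Y_def Hom_def)
  have idR: "(Idn C X, f) \<in> ?R"
  proof -
    have "(Idn C X, f) \<in> roofs C N X Y"
      using N[OF XO] fXY idX by (auto simp: roofs_def Hom_def)
    moreover have "roof_eq C N (Idn C X, f) (Idn C X, f)"
      unfolding roof_eq_def prod.case using idX N[OF XO] C.Comp_Idn[OF idX]
      by (intro exI[of _ X] bexI[of _ "Idn C X"]) (auto simp: Hom_def)
    ultimately show ?thesis by simp
  qed
  have all: "AMap F f \<cdot>\<^bsub>D\<^esub> AMap F s = AMap F g" if "(s, g) \<in> ?R" for s g
  proof -
    from that have s: "s \<in> N_iso C N" and sg: "s \<in> Hom C (Dom C s) X" "g \<in> Hom C (Dom C s) Y"
      by (auto simp: roofs_def Hom_def N_iso_def)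
    from that obtain W u u' where
      u: "u \<in> Hom C W X" and u': "u' \<in> Hom C W (Dom C s)" and
      e1: "Idn C X \<cdot>\<^bsub>C\<^esub> u = s \<cdot>\<^bsub>C\<^esub> u'" and e1': "Idn C X \<cdot>\<^bsub>C\<^esub> u \<in> N_iso C N"
      and e2: "f \<cdot>\<^bsub>C\<^esub> u = g \<cdot>\<^bsub>C\<^esub> u'"
      using idX by (auto simp: roof_eq_def Hom_def)
    have uu: "u = s \<cdot>\<^bsub>C\<^esub> u'" using e1 C.Idn_Comp[OF u] by simp
    have uN: "u \<in> N_iso C N" using e1' C.Idn_Comp[OF u] by simp
    obtain a where a: "a \<in> Hom D (OMap F X) (OMap F (Dom C s))"
      "a \<cdot>\<^bsub>D\<^esub> AMap F s = Idn D (OMap F (Dom C s))"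
      using inv[OF s] hom[OF sg(1)] by (auto simp: is_iso_def Hom_def)
    obtain b where b: "b \<in> Hom D (OMap F X) (OMap F W)"
      "AMap F u \<cdot>\<^bsub>D\<^esub> b = Idn D (OMap F X)"
      using inv[OF uN] hom[OF u] by (auto simp: is_iso_def Hom_def)
    let ?s = "AMap F s" and ?u = "AMap F u'" and ?f = "AMap F f" and ?g = "AMap F g"
    note h = hom[OF sg(1)] hom[OF sg(2)] hom[OF u'] hom[OF fXY] hom[OF u]
    have *: "AMap F u = ?s \<cdot>\<^bsub>D\<^esub> ?u" unfolding uu by (rule cmp[OF u' sg(1)])
    have ub: "?u \<cdot>\<^bsub>D\<^esub> b \<in> Hom D (OMap F X) (OMap F (Dom C s))"
      using D.Comp_in_Hom[OF b(1) h(3)] .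
    have sub: "?s \<cdot>\<^bsub>D\<^esub> (?u \<cdot>\<^bsub>D\<^esub> b) = Idn D (OMap F X)"
      using D.Comp_assoc[OF b(1) h(3) h(1)] * b(2) by simp
    have "?u \<cdot>\<^bsub>D\<^esub> b = (a \<cdot>\<^bsub>D\<^esub> ?s) \<cdot>\<^bsub>D\<^esub> (?u \<cdot>\<^bsub>D\<^esub> b)" using a(2) D.Idn_Comp[OF ub] by simp
    also have "\<dots> = a" using D.Comp_assoc[OF ub h(1) a(1)] sub D.Comp_Idn[OF a(1)] by simp
    finally have uba: "?u \<cdot>\<^bsub>D\<^esub> b = a" .
    have "?f \<cdot>\<^bsub>D\<^esub> AMap F u = ?g \<cdot>\<^bsub>D\<^esub> ?u"
      using cmp[OF u fXY] cmp[OF u' sg(2)] e2 by simp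
    then have "?f \<cdot>\<^bsub>D\<^esub> (AMap F u \<cdot>\<^bsub>D\<^esub> b) = ?g \<cdot>\<^bsub>D\<^esub> (?u \<cdot>\<^bsub>D\<^esub> b)"
      using D.Comp_assoc[OF b(1) h(5) h(4)] D.Comp_assoc[OF b(1) h(3) h(2)] by simp
    then have "?f = ?g \<cdot>\<^bsub>D\<^esub> a" using b(2) uba D.Comp_Idn[OF h(4)] by simp
    then show ?thesis
      using D.Comp_assoc[OF h(1) a(1) h(2)] a(2) D.Comp_Idn[OF h(2)] by simp
  qed
  have "(THE h. h \<in> Hom D (OMap F X) (OMap F Y) \<and>
      (\<forall>(s, g) \<in> ?R. h \<cdot>\<^bsub>D\<^esub> AMap F s = AMap F g)) = AMap F f"
  proof (rule the_equality)
    show "AMap F f \<in> Hom D (OMap F X) (OMap F Y) \<and>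
      (\<forall>(s, g) \<in> ?R. AMap F f \<cdot>\<^bsub>D\<^esub> AMap F s = AMap F g)"
      using hom[OF fXY] all by blast
    fix h assume h: "h \<in> Hom D (OMap F X) (OMap F Y) \<and>
      (\<forall>(s, g) \<in> ?R. h \<cdot>\<^bsub>D\<^esub> AMap F s = AMap F g)"
    then have "h \<cdot>\<^bsub>D\<^esub> AMap F (Idn C X) = AMap F f" using idR by blast
    then show "h = AMap F f" using idn h D.Comp_Idn by metis
  qed
  then show ?thesis by (simp add: induced_functor_def cls)
qed


section \<open>Monads and their modules\<close>

record ('o, 'a) monad =
  Endo :: "('o, 'a, 'o, 'a) fctr"
  Eta :: "'o \<Rightarrow> 'a"
  Mu :: "'o \<Rightarrow> 'a"

definition is_monad :: "('o, 'a) cat \<Rightarrow> ('o, 'a) monad \<Rightarrow> bool" where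
  "is_monad C M \<longleftrightarrow>
    nat_trans C C id_functor (Endo M) (Eta M) \<and>
    nat_trans C C (comp_functor (Endo M) (Endo M)) (Endo M) (Mu M) \<and>
    (\<forall>X \<in> Obj C.
      Mu M X \<cdot>\<^bsub>C\<^esub> AMap (Endo M) (Mu M X) = Mu M X \<cdot>\<^bsub>C\<^esub> Mu M (OMap (Endo M) X) \<and>
      Mu M X \<cdot>\<^bsub>C\<^esub> AMap (Endo M) (Eta M X) = Idn C (OMap (Endo M) X) \<and>
      Mu M X \<cdot>\<^bsub>C\<^esub> Eta M (OMap (Endo M) X) = Idn C (OMap (Endo M) X))"

definition exact_monad :: "('o, 'a) cat \<Rightarrow> ('o, 'a) monad \<Rightarrow> bool" where
  "exact_monad C M \<longleftrightarrow> is_monad C M \<and> exact_functor C C (Endo M)"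

type_synonym ('o, 'a) marr = "('o \<times> 'a) \<times> ('o \<times> 'a) \<times> 'a"

definition modules :: "('o, 'a) cat \<Rightarrow> ('o, 'a) monad \<Rightarrow> ('o \<times> 'a) set" where
  "modules C M = {(X, l). X \<in> Obj C \<and> l \<in> Hom C (OMap (Endo M) X) X \<and>
    l \<cdot>\<^bsub>C\<^esub> AMap (Endo M) l = l \<cdot>\<^bsub>C\<^esub> Mu M X \<and> l \<cdot>\<^bsub>C\<^esub> Eta M X = Idn C X}"

definition module_cat :: "('o, 'a) cat \<Rightarrow> ('o, 'a) monad \<Rightarrow> ('o \<times> 'a, ('o, 'a) marr) cat" where
  "module_cat C M = \<lparr>
    Obj = modules C M,
    Arr = {((X, l), (X', l'), f). (X, l) \<in> modules C M \<and> (X', l') \<in> modules C M \<and>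
      f \<in> Hom C X X' \<and> f \<cdot>\<^bsub>C\<^esub> l = l' \<cdot>\<^bsub>C\<^esub> AMap (Endo M) f},
    Dom = (\<lambda>(P, P', f). P),
    Cod = (\<lambda>(P, P', f). P'),
    Idn = (\<lambda>(X, l). ((X, l), (X, l), Idn C X)),
    Comp = (\<lambda>(Q, Q', g) (P, P', f). (P, Q', g \<cdot>\<^bsub>C\<^esub> f))\<rparr>"

definition modules_in :: "('o, 'a) cat \<Rightarrow> ('o, 'a) monad \<Rightarrow> 'o set \<Rightarrow> ('o \<times> 'a) set" where
  "modules_in C M N = {(X, l) \<in> modules C M. X \<in> N}"

text \<open>The endofunctor of the induced monad is the one induced by \<open>q \<circ> M\<close>.\<close>

definition induced_monad ::
    "('o, 'a) cat \<Rightarrow> 'o set \<Rightarrow> ('o, 'a) monad \<Rightarrow> ('o, ('o, 'a) qarr) monad" where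
  "induced_monad C N M = \<lparr>
    Endo = induced_functor C N (quotient_cat C N)
      (comp_functor (quotient_functor C N) (Endo M)),
    Eta = (\<lambda>X. AMap (quotient_functor C N) (Eta M X)),
    Mu = (\<lambda>X. AMap (quotient_functor C N) (Mu M X))\<rparr>"

definition Phi :: "('o, 'a) cat \<Rightarrow> 'o set \<Rightarrow>
    ('o \<times> 'a, ('o, 'a) marr, 'o \<times> ('o, 'a) qarr, ('o, ('o, 'a) qarr) marr) fctr" where
  "Phi C N = (let q = AMap (quotient_functor C N) in \<lparr>
    OMap = (\<lambda>(X, l). (X, q l)),
    AMap = (\<lambda>((X, l), (X', l'), f). ((X, q l), (X', q l'), q f))\<rparr>)"

definition Phi_bar :: "('o, 'a) cat \<Rightarrow> 'o set \<Rightarrow> ('o, 'a) monad \<Rightarrow>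
    ('o \<times> 'a, ('o \<times> 'a, ('o, 'a) marr) qarr,
     'o \<times> ('o, 'a) qarr, ('o, ('o, 'a) qarr) marr) fctr" where
  "Phi_bar C N M = induced_functor (module_cat C M) (modules_in C M N)
    (module_cat (quotient_cat C N) (induced_monad C N M)) (Phi C N)"

end

theory Submission
  imports Defs
begin

text \<open>
  The arrows inverted in \<open>A/N\<close> admit both a left and a right calculus of fractions, and an
  arrow of modules is inverted in the quotient of modules exactly when its underlying arrow is;
  pullbacks, kernels and cokernels of modules are computed in \<open>A\<close>.

  Faithfulness: if \<open>q f = q g\<close>, the equaliser of the module arrows \<open>f\<close> and \<open>g\<close> is inverted.
  Fullness: an arrow of \<open>A/N\<close> between modules is extended from a free module, where it becomes an
  honest module arrow up to a submodule in \<open>N\<close>. Essential surjectivity: a module over the induced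
  monad is a coequaliser of arrows between free modules, and these arrows can be lifted to \<open>A\<close>.
\<close>


section \<open>Categories\<close>

text \<open>A denominator in \<open>A/N\<close> has no module structure on its source, even when its
  target is a module, so kernels and pullbacks formed from it live only in \<open>C\<close>. Two
  devices get around this. An equation between module arrows that holds after an inverted arrow of
  \<open>C\<close> also holds after the kernel of their difference, and that kernel is a module. And
  a fraction \<open>f s^-1\<close> is extended to a free module through \<open>M f\<close> and
  \<open>M s\<close>, followed by actions where needed, so that numerator and denominator become
  module arrows.

  Duality halves the work in \<open>C\<close>, but the opposite of modules over a monad is comodules
  over a comonad; kernels and cokernels of modules are therefore treated separately, the latter
  using that \<open>M\<close> preserves epis. Exactness is given on short exact sequences, so
  additivity of \<open>M\<close> and its effect on cokernels of arbitrary arrows have to be derived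
  before differences and quotients of module arrows can be formed. The quotient construction is
  stated for a set of objects subject to axioms of right fractions, so that it serves both for
  \<open>N\<close> and for the modules in \<open>N\<close>.\<close>

context category
begin

lemma Comp_simps [simp]:
  assumes "f \<in> Arr C" and "g \<in> Arr C" and "Cod C f = Dom C g"
  shows "g \<cdot> f \<in> Arr C" and "Dom C (g \<cdot> f) = Dom C f" and "Cod C (g \<cdot> f) = Cod C g"
  using Comp_in_Hom[of f "Dom C f" "Cod C f" g "Cod C g"] assms by (auto simp: Hom_def)

lemma Idn_simps [simp]:
  assumes "X \<in> Obj C"
  shows "Idn C X \<in> Arr C" and "Dom C (Idn C X) = X" and "Cod C (Idn C X) = X"
  using Idn_in_Hom[OF assms] by (auto simp: Hom_def)

lemma Comp_Idn_Arr [simp]: "f \<in> Arr C \<Longrightarrow> Dom C f = X \<Longrightarrow> f \<cdot> Idn C X = f"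
  using Comp_Idn[of f X "Cod C f"] by (simp add: Hom_def)

lemma Idn_Comp_Arr [simp]: "f \<in> Arr C \<Longrightarrow> Cod C f = X \<Longrightarrow> Idn C X \<cdot> f = f"
  using Idn_Comp[of f "Dom C f" X] by (simp add: Hom_def)

lemma Comp_assoc_Arr [simp]:
  "f \<in> Arr C \<Longrightarrow> g \<in> Arr C \<Longrightarrow> h \<in> Arr C \<Longrightarrow> Cod C f = Dom C g \<Longrightarrow> Cod C g = Dom C h \<Longrightarrow>
    (h \<cdot> g) \<cdot> f = h \<cdot> (g \<cdot> f)"
  using Comp_assoc[of f "Dom C f" "Cod C f" g "Cod C g" h "Cod C h"] by (simp add: Hom_def)

lemma Hom_Obj: "f \<in> Hom C X Y \<Longrightarrow> X \<in> Obj C" "f \<in> Hom C X Y \<Longrightarrow> Y \<in> Obj C"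
  using Dom_in_Obj Cod_in_Obj by (auto simp: Hom_def)

text \<open>Associativity is oriented to nest to the right, so a known product
  \<open>g \<cdot> f\<close> is hidden inside \<open>g \<cdot> (f \<cdot> x)\<close>; this applies
  it there.\<close>

lemma Comp_extend:
  assumes "g \<cdot> f = k" and "f \<in> Hom C X Y" and "g \<in> Hom C Y Z" and "x \<in> Hom C W X"
  shows "g \<cdot> (f \<cdot> x) = k \<cdot> x"
  using Comp_assoc[OF assms(4,2,3)] assms(1) by simp

lemma isoI:
  assumes "f \<in> Hom C X Y" and "g \<in> Hom C Y X" and "g \<cdot> f = Idn C X" and "f \<cdot> g = Idn C Y"
  shows "is_iso C f"
  using assms unfolding is_iso_def Hom_def by auto

lemma isoE:
  assumes "is_iso C f" and "f \<in> Hom C X Y"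
  obtains g where "g \<in> Hom C Y X" and "g \<cdot> f = Idn C X" and "f \<cdot> g = Idn C Y"
  using assms unfolding is_iso_def Hom_def by auto

lemma iso_cancel_right:
  assumes "is_iso C e" and "e \<in> Hom C W X" and "g \<in> Hom C X Y" and "h \<in> Hom C X Y"
    and "g \<cdot> e = h \<cdot> e"
  shows "g = h"
proof -
  obtain i where i: "i \<in> Hom C X W" "e \<cdot> i = Idn C X" using isoE[OF assms(1,2)] by metis
  have "g = g \<cdot> (e \<cdot> i)" using i(2) Comp_Idn[OF assms(3)] by simp
  also have "\<dots> = h \<cdot> (e \<cdot> i)"
    using Comp_assoc[OF i(1) assms(2,3)] Comp_assoc[OF i(1) assms(2,4)] assms(5) by simp
  also have "\<dots> = h" using i(2) Comp_Idn[OF assms(4)] by simp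
  finally show ?thesis .
qed

lemma monoD:
  "is_mono C m \<Longrightarrow> m \<in> Hom C X Y \<Longrightarrow> g \<in> Hom C W X \<Longrightarrow> h \<in> Hom C W X \<Longrightarrow> m \<cdot> g = m \<cdot> h \<Longrightarrow> g = h"
  by (auto simp: is_mono_def Hom_def)

lemma epiD:
  "is_epi C e \<Longrightarrow> e \<in> Hom C X Y \<Longrightarrow> g \<in> Hom C Y Z \<Longrightarrow> h \<in> Hom C Y Z \<Longrightarrow> g \<cdot> e = h \<cdot> e \<Longrightarrow> g = h"
  by (auto simp: is_epi_def Hom_def)

end


section \<open>Opposite categories\<close>

text \<open>Reversal leaves \<open>Obj\<close>, \<open>Arr\<close> and also \<open>N_iso\<close>
  unchanged and exchanges kernels with cokernels. Most statements on epis and cokernels below are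
  those on monos and kernels, instantiated here.\<close>

definition op_cat :: "('o, 'a) cat \<Rightarrow> ('o, 'a) cat" where
  "op_cat C = \<lparr>Obj = Obj C, Arr = Arr C, Dom = Cod C, Cod = Dom C, Idn = Idn C,
    Comp = (\<lambda>g f. f \<cdot>\<^bsub>C\<^esub> g)\<rparr>"

lemma op_cat_simps [simp]:
  "Obj (op_cat C) = Obj C" "Arr (op_cat C) = Arr C" "Dom (op_cat C) = Cod C"
  "Cod (op_cat C) = Dom C" "Idn (op_cat C) = Idn C" "g \<cdot>\<^bsub>op_cat C\<^esub> f = f \<cdot>\<^bsub>C\<^esub> g"
  by (simp_all add: op_cat_def)

lemma Hom_op_cat [simp]: "Hom (op_cat C) X Y = Hom C Y X"
  by (auto simp: Hom_def)

lemma category_op_cat: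
  assumes "category C"
  shows "category (op_cat C)"
proof -
  interpret category C by fact
  show ?thesis
    by unfold_locales
      (simp_all add: Dom_in_Obj Cod_in_Obj Idn_in_Hom Comp_in_Hom Comp_Idn Idn_Comp Comp_assoc)
qed

lemma is_iso_op_cat [simp]: "is_iso (op_cat C) f = is_iso C f"
  by (auto simp: is_iso_def)

lemma (in category) iso_cancel_left:
  assumes "is_iso C e" and "e \<in> Hom C Y Z" and "g \<in> Hom C X Y" and "h \<in> Hom C X Y"
    and "e \<cdot> g = e \<cdot> h"
  shows "g = h"
  using category.iso_cancel_right[OF category_op_cat[OF category_axioms], of e Z Y g X h] assms by simp

lemma is_mono_op_cat [simp]: "is_mono (op_cat C) f = is_epi C f"
  by (simp add: is_mono_def is_epi_def)

lemma is_epi_op_cat [simp]: "is_epi (op_cat C) f = is_mono C f"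
  by (simp add: is_mono_def is_epi_def)

lemma zero_object_op_cat [simp]: "zero_object (op_cat C) = zero_object C"
  by (auto simp: zero_object_def fun_eq_iff)

lemma zero_arrow_op_cat [simp]: "zero_arrow (op_cat C) = zero_arrow C"
  by (auto simp: zero_arrow_def fun_eq_iff)

lemma is_kernel_op_cat [simp]: "is_kernel (op_cat C) k f = is_cokernel C k f"
  by (simp add: is_kernel_def is_cokernel_def)

lemma is_cokernel_op_cat [simp]: "is_cokernel (op_cat C) k f = is_kernel C k f"
  by (simp add: is_kernel_def is_cokernel_def)

lemma short_exact_op_cat [simp]: "short_exact (op_cat C) i p = short_exact C p i"
  by (auto simp: short_exact_def)

lemma N_iso_op_cat [simp]: "N_iso (op_cat C) N = N_iso C N"
  by (auto simp: N_iso_def)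

lemma serre_subcategory_op_cat: "serre_subcategory C N \<Longrightarrow> serre_subcategory (op_cat C) N"
proof -
  assume N: "serre_subcategory C N"
  \<comment> \<open>In the opposite category the middle object of the sequence is read off as
    \<open>Dom C i\<close>; exactness identifies it with \<open>Cod C p\<close>, which the extension
    clause in \<open>C\<close> speaks of.\<close>
  have "Dom C i \<in> N" if "short_exact C p i" "Cod C i \<in> N" "Dom C p \<in> N" for i p
  proof -
    have "Cod C p = Dom C i" using that(1) by (simp add: short_exact_def is_kernel_def)
    moreover have "Cod C p \<in> N"
      using N[unfolded serre_subcategory_def, THEN conjunct2, THEN conjunct2, THEN conjunct2,
          THEN conjunct2, rule_format, of p i] that by simp
    ultimately show ?thesis by simp
  qed
  with N show ?thesis
    unfolding serre_subcategory_def op_cat_simps is_mono_op_cat is_epi_op_cat short_exact_op_cat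
    by (elim conjE) (intro conjI; blast)
qed


section \<open>Functors and equivalences\<close>

lemma functor_category:
  assumes "is_functor C D F"
  shows "category C" and "category D"
  using assms by (auto simp: is_functor_def)

lemma functor_Obj: "is_functor C D F \<Longrightarrow> X \<in> Obj C \<Longrightarrow> OMap F X \<in> Obj D"
  by (auto simp: is_functor_def)

lemma functor_Hom:
  "is_functor C D F \<Longrightarrow> f \<in> Hom C X Y \<Longrightarrow> AMap F f \<in> Hom D (OMap F X) (OMap F Y)"
  by (auto simp: is_functor_def Hom_def)

lemma functor_Idn: "is_functor C D F \<Longrightarrow> X \<in> Obj C \<Longrightarrow> AMap F (Idn C X) = Idn D (OMap F X)"
  by (auto simp: is_functor_def)

lemma functor_Comp:
  "is_functor C D F \<Longrightarrow> f \<in> Hom C X Y \<Longrightarrow> g \<in> Hom C Y Z \<Longrightarrow>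
    AMap F (g \<cdot>\<^bsub>C\<^esub> f) = AMap F g \<cdot>\<^bsub>D\<^esub> AMap F f"
  unfolding is_functor_def by blast

lemma functorI:
  assumes "category C" and "category D"
    and "\<And>X. X \<in> Obj C \<Longrightarrow> OMap F X \<in> Obj D"
    and "\<And>f X Y. f \<in> Hom C X Y \<Longrightarrow> AMap F f \<in> Hom D (OMap F X) (OMap F Y)"
    and "\<And>X. X \<in> Obj C \<Longrightarrow> AMap F (Idn C X) = Idn D (OMap F X)"
    and "\<And>f g X Y Z. f \<in> Hom C X Y \<Longrightarrow> g \<in> Hom C Y Z \<Longrightarrow>
      AMap F (g \<cdot>\<^bsub>C\<^esub> f) = AMap F g \<cdot>\<^bsub>D\<^esub> AMap F f"
  shows "is_functor C D F"
  using assms unfolding is_functor_def by (auto simp: Hom_def)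

lemma id_is_functor: "category C \<Longrightarrow> is_functor C C id_functor"
  by (rule functorI) (auto simp: id_functor_def category.Idn_in_Hom)

lemma comp_is_functor:
  assumes F: "is_functor C D F" and G: "is_functor D E G"
  shows "is_functor C E (comp_functor G F)"
proof (rule functorI)
  show "category C" "category E" using functor_category[OF F] functor_category[OF G] by auto
qed (auto simp: comp_functor_def functor_Obj[OF F] functor_Obj[OF G] functor_Idn[OF F]
    functor_Idn[OF G] functor_Comp[OF F] functor_Comp[OF G functor_Hom[OF F] functor_Hom[OF F]]
    intro: functor_Hom[OF F] functor_Hom[OF G])

text \<open>The quasi-inverse is built by choice: an object \<open>G Y\<close> with an isomorphism
  \<open>\<psi> Y\<close> onto \<open>Y\<close>, and a preimage under \<open>F\<close> for every
  arrow. Chosen preimages satisfy no equations by construction; faithfulness supplies them, as each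
  equation is checked after applying \<open>F\<close>.\<close>

lemma equivalenceI:
  assumes F: "is_functor C D F"
    and faithful: "\<And>X Y f g. f \<in> Hom C X Y \<Longrightarrow> g \<in> Hom C X Y \<Longrightarrow> AMap F f = AMap F g \<Longrightarrow> f = g"
    and full: "\<And>X Y h. X \<in> Obj C \<Longrightarrow> Y \<in> Obj C \<Longrightarrow> h \<in> Hom D (OMap F X) (OMap F Y) \<Longrightarrow>
      \<exists>f \<in> Hom C X Y. AMap F f = h"
    and surj: "\<And>Y. Y \<in> Obj D \<Longrightarrow> \<exists>X \<in> Obj C. \<exists>\<psi> \<in> Hom D (OMap F X) Y. is_iso D \<psi>"
  shows "is_equivalence C D F"
proof -
  interpret C: category C using functor_category[OF F] by simp
  interpret D: category D using functor_category[OF F] by simp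
  have "\<forall>Y. Y \<in> Obj D \<longrightarrow> (\<exists>X \<psi> \<phi>. X \<in> Obj C \<and> \<psi> \<in> Hom D (OMap F X) Y \<and>
      \<phi> \<in> Hom D Y (OMap F X) \<and> \<phi> \<cdot>\<^bsub>D\<^esub> \<psi> = Idn D (OMap F X) \<and> \<psi> \<cdot>\<^bsub>D\<^esub> \<phi> = Idn D Y)"
    using surj D.isoE by metis
  then obtain G \<psi> \<phi> where
    G: "\<And>Y. Y \<in> Obj D \<Longrightarrow> G Y \<in> Obj C" and
    \<psi>: "\<And>Y. Y \<in> Obj D \<Longrightarrow> \<psi> Y \<in> Hom D (OMap F (G Y)) Y" and
    \<phi>: "\<And>Y. Y \<in> Obj D \<Longrightarrow> \<phi> Y \<in> Hom D Y (OMap F (G Y))" and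
    \<phi>\<psi>: "\<And>Y. Y \<in> Obj D \<Longrightarrow> \<phi> Y \<cdot>\<^bsub>D\<^esub> \<psi> Y = Idn D (OMap F (G Y))" and
    \<psi>\<phi>: "\<And>Y. Y \<in> Obj D \<Longrightarrow> \<psi> Y \<cdot>\<^bsub>D\<^esub> \<phi> Y = Idn D Y"
    by metis
  define lift where "lift X Y h = (SOME f. f \<in> Hom C X Y \<and> AMap F f = h)" for X Y h
  have lift: "lift X Y h \<in> Hom C X Y" "AMap F (lift X Y h) = h"
    if "X \<in> Obj C" "Y \<in> Obj C" "h \<in> Hom D (OMap F X) (OMap F Y)" for X Y h
    using someI_ex[of "\<lambda>f. f \<in> Hom C X Y \<and> AMap F f = h"] full[OF that]
    unfolding lift_def by blast+
  \<comment> \<open>Conjugation by the chosen isomorphisms, the only value of \<open>F (G h)\<close>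
    for which \<open>\<psi>\<close> is natural.\<close>
  define mid where "mid h = \<phi> (Cod D h) \<cdot>\<^bsub>D\<^esub> (h \<cdot>\<^bsub>D\<^esub> \<psi> (Dom D h))" for h
  define GG where
    "GG = \<lparr>OMap = G, AMap = (\<lambda>h. lift (G (Dom D h)) (G (Cod D h)) (mid h))\<rparr>"
  have mid: "mid h \<in> Hom D (OMap F (G X)) (OMap F (G Y))"
    "mid h = \<phi> Y \<cdot>\<^bsub>D\<^esub> (h \<cdot>\<^bsub>D\<^esub> \<psi> X)" if "h \<in> Hom D X Y" for h X Y
    using that \<phi>[of Y] \<psi>[of X] D.Hom_Obj[OF that] unfolding mid_def by (auto simp: Hom_def)
  have GG: "AMap GG h \<in> Hom C (G X) (G Y)" "AMap F (AMap GG h) = mid h"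
    if "h \<in> Hom D X Y" for h X Y
    using lift[OF G G mid(1)[OF that]] D.Hom_Obj[OF that] that by (auto simp: GG_def Hom_def)
  have OG: "OMap GG = G" by (simp add: GG_def)
  have functor_GG: "is_functor D C GG"
  proof (rule functorI)
    show "category C" "category D" by unfold_locales
    show "OMap GG Y \<in> Obj C" if "Y \<in> Obj D" for Y using G[OF that] OG by simp
    show "AMap GG h \<in> Hom C (OMap GG X) (OMap GG Y)" if "h \<in> Hom D X Y" for h X Y
      using GG[OF that] OG by simp
    show "AMap GG (Idn D X) = Idn C (OMap GG X)" if X: "X \<in> Obj D" for X
    proof (rule faithful)
      show "AMap GG (Idn D X) \<in> Hom C (G X) (G X)" using GG[OF D.Idn_in_Hom[OF X]] by simp
      show "Idn C (OMap GG X) \<in> Hom C (G X) (G X)" using C.Idn_in_Hom G X OG by simp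
      show "AMap F (AMap GG (Idn D X)) = AMap F (Idn C (OMap GG X))"
        using GG(2)[OF D.Idn_in_Hom[OF X]] mid(2)[OF D.Idn_in_Hom[OF X]]
          D.Idn_Comp[OF \<psi>[OF X]] \<phi>\<psi>[OF X] functor_Idn[OF F G[OF X]] OG by simp
    qed
    show "AMap GG (g \<cdot>\<^bsub>D\<^esub> f) = AMap GG g \<cdot>\<^bsub>C\<^esub> AMap GG f"
      if f: "f \<in> Hom D X Y" and g: "g \<in> Hom D Y Z" for f g X Y Z
    proof (rule faithful)
      have O: "X \<in> Obj D" "Y \<in> Obj D" "Z \<in> Obj D" using f g D.Hom_Obj by auto
      note gf = D.Comp_in_Hom[OF f g]
      show "AMap GG (g \<cdot>\<^bsub>D\<^esub> f) \<in> Hom C (G X) (G Z)" using GG[OF gf] by simp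
      show "AMap GG g \<cdot>\<^bsub>C\<^esub> AMap GG f \<in> Hom C (G X) (G Z)"
        using C.Comp_in_Hom GG(1)[OF f] GG(1)[OF g] by blast
      have "mid g \<cdot>\<^bsub>D\<^esub> mid f = mid (g \<cdot>\<^bsub>D\<^esub> f)"
        using f g \<phi>[OF O(2)] \<psi>[OF O(2)] \<phi>[OF O(3)] \<psi>[OF O(1)]
          D.Comp_extend[OF \<psi>\<phi>[OF O(2)] \<phi>[OF O(2)] \<psi>[OF O(2)] D.Comp_in_Hom[OF \<psi>[OF O(1)] f]]
        unfolding mid(2)[OF f] mid(2)[OF g] mid(2)[OF gf] by (simp add: Hom_def)
      then show "AMap F (AMap GG (g \<cdot>\<^bsub>D\<^esub> f)) = AMap F (AMap GG g \<cdot>\<^bsub>C\<^esub> AMap GG f)"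
        using functor_Comp[OF F GG(1)[OF f] GG(1)[OF g]] GG(2)[OF gf] GG(2)[OF f] GG(2)[OF g]
        by simp
    qed
  qed
  \<comment> \<open>The unit and its inverse are lifts of \<open>\<phi>\<close> and
    \<open>\<psi>\<close> at \<open>F X\<close>; since \<open>F\<close> is faithful, the inverse
    laws of the latter carry over to the lifts.\<close>
  define \<alpha> where "\<alpha> X = lift X (G (OMap F X)) (\<phi> (OMap F X))" for X
  define \<alpha>' where "\<alpha>' X = lift (G (OMap F X)) X (\<psi> (OMap F X))" for X
  have FO: "OMap F X \<in> Obj D" if "X \<in> Obj C" for X using functor_Obj[OF F that] .
  have \<alpha>: "\<alpha> X \<in> Hom C X (G (OMap F X))" "AMap F (\<alpha> X) = \<phi> (OMap F X)" if "X \<in> Obj C" for X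
    using lift[OF that G[OF FO[OF that]] \<phi>[OF FO[OF that]]] by (auto simp: \<alpha>_def)
  have \<alpha>': "\<alpha>' X \<in> Hom C (G (OMap F X)) X" "AMap F (\<alpha>' X) = \<psi> (OMap F X)" if "X \<in> Obj C" for X
    using lift[OF G[OF FO[OF that]] that \<psi>[OF FO[OF that]]] by (auto simp: \<alpha>'_def)
  have \<alpha>_iso: "is_iso C (\<alpha> X)" if X: "X \<in> Obj C" for X
  proof (rule C.isoI[OF \<alpha>(1)[OF X] \<alpha>'(1)[OF X]])
    show "\<alpha>' X \<cdot>\<^bsub>C\<^esub> \<alpha> X = Idn C X"
      by (rule faithful[OF C.Comp_in_Hom[OF \<alpha>(1)[OF X] \<alpha>'(1)[OF X]] C.Idn_in_Hom[OF X]])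
        (simp add: functor_Comp[OF F \<alpha>(1)[OF X] \<alpha>'(1)[OF X]] \<alpha>(2)[OF X] \<alpha>'(2)[OF X]
          \<psi>\<phi>[OF FO[OF X]] functor_Idn[OF F X])
    show "\<alpha> X \<cdot>\<^bsub>C\<^esub> \<alpha>' X = Idn C (G (OMap F X))"
      by (rule faithful[OF C.Comp_in_Hom[OF \<alpha>'(1)[OF X] \<alpha>(1)[OF X]] C.Idn_in_Hom[OF G[OF FO[OF X]]]])
        (simp add: functor_Comp[OF F \<alpha>'(1)[OF X] \<alpha>(1)[OF X]] \<alpha>(2)[OF X] \<alpha>'(2)[OF X]
          \<phi>\<psi>[OF FO[OF X]] functor_Idn[OF F G[OF FO[OF X]]])
  qed
  have \<alpha>_nat: "AMap GG (AMap F f) \<cdot>\<^bsub>C\<^esub> \<alpha> X = \<alpha> Y \<cdot>\<^bsub>C\<^esub> f" if f: "f \<in> Hom C X Y" for f X Y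
  proof -
    have X: "X \<in> Obj C" and Y: "Y \<in> Obj C" using C.Hom_Obj[OF f] by auto
    note Ff = functor_Hom[OF F f]
    show ?thesis
    proof (rule faithful[OF C.Comp_in_Hom[OF \<alpha>(1)[OF X] GG(1)[OF Ff]] C.Comp_in_Hom[OF f \<alpha>(1)[OF Y]]])
      show "AMap F (AMap GG (AMap F f) \<cdot>\<^bsub>C\<^esub> \<alpha> X) = AMap F (\<alpha> Y \<cdot>\<^bsub>C\<^esub> f)"
        using Ff \<phi>[OF FO[OF X]] \<psi>[OF FO[OF X]] \<phi>[OF FO[OF Y]] \<psi>\<phi>[OF FO[OF X]]
        unfolding functor_Comp[OF F \<alpha>(1)[OF X] GG(1)[OF Ff]] functor_Comp[OF F f \<alpha>(1)[OF Y]]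
          GG(2)[OF Ff] \<alpha>(2)[OF X] \<alpha>(2)[OF Y] mid(2)[OF Ff]
        by (simp add: Hom_def)
    qed
  qed
  have \<beta>_nat: "h \<cdot>\<^bsub>D\<^esub> \<psi> X = \<psi> Y \<cdot>\<^bsub>D\<^esub> AMap F (AMap GG h)" if h: "h \<in> Hom D X Y" for h X Y
  proof -
    have X: "X \<in> Obj D" and Y: "Y \<in> Obj D" using D.Hom_Obj[OF h] by auto
    show ?thesis
      unfolding GG(2)[OF h] mid(2)[OF h]
      using h \<psi>[OF X] D.Comp_extend[OF \<psi>\<phi>[OF Y] \<phi>[OF Y] \<psi>[OF Y] D.Comp_in_Hom[OF \<psi>[OF X] h]]
      by (simp add: Hom_def)
  qed
  have "nat_iso C C id_functor (comp_functor GG F) \<alpha>"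
    unfolding nat_iso_def nat_trans_def
    using id_is_functor[of C] comp_is_functor[OF F functor_GG] C.category_axioms \<alpha>(1) \<alpha>_iso \<alpha>_nat
    by (simp add: id_functor_def comp_functor_def OG)
  moreover have "nat_iso D D (comp_functor F GG) id_functor \<psi>"
    unfolding nat_iso_def nat_trans_def
    using id_is_functor[of D] comp_is_functor[OF functor_GG F] D.category_axioms \<psi> \<beta>_nat
      D.isoI[OF \<psi> \<phi> \<phi>\<psi> \<psi>\<phi>]
    by (simp add: id_functor_def comp_functor_def OG)
  ultimately show ?thesis unfolding is_equivalence_def using F functor_GG by blast
qed


section \<open>Quotient categories by a calculus of fractions\<close>

lemma N_iso_Arr: "s \<in> N_iso C N \<Longrightarrow> s \<in> Arr C"
  by (simp add: N_iso_def)

text \<open>Stated for an arbitrary set \<open>N\<close>, so that it serves for \<open>N\<close> in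
  \<open>C\<close> and for the modules in \<open>N\<close> alike. \<open>ore\<close> turns a left
  denominator into a right one, and \<open>cancel\<close> turns equality after an inverted arrow
  into equality before one.\<close>

locale fractions = category C for C :: "('o, 'a) cat" (structure) +
  fixes N :: "'o set"
  assumes Idn_N_iso: "X \<in> Obj C \<Longrightarrow> Idn C X \<in> N_iso C N"
    and Comp_N_iso: "s \<in> N_iso C N \<Longrightarrow> t \<in> N_iso C N \<Longrightarrow> Cod C s = Dom C t \<Longrightarrow> t \<cdot> s \<in> N_iso C N"
    and ore: "f \<in> Hom C X Y \<Longrightarrow> t \<in> Hom C Z Y \<Longrightarrow> t \<in> N_iso C N \<Longrightarrow>
      \<exists>W. \<exists>u \<in> Hom C W X. \<exists>v \<in> Hom C W Z. u \<in> N_iso C N \<and> f \<cdot> u = t \<cdot> v"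
    and cancel: "f \<in> Hom C X Y \<Longrightarrow> g \<in> Hom C X Y \<Longrightarrow> t \<in> Hom C Y Z \<Longrightarrow> t \<in> N_iso C N \<Longrightarrow>
      t \<cdot> f = t \<cdot> g \<Longrightarrow> \<exists>W. \<exists>u \<in> Hom C W X. u \<in> N_iso C N \<and> f \<cdot> u = g \<cdot> u"
begin

abbreviation "S \<equiv> N_iso C N"
abbreviation "Roofs \<equiv> roofs C N"
abbreviation "req \<equiv> roof_eq C N"
abbreviation "cls \<equiv> roof_class C N"

section \<open>Equivalence of roofs\<close>

lemma roofs_iff: "(s, f) \<in> Roofs X Y \<longleftrightarrow> s \<in> S \<and> s \<in> Hom C (Dom C s) X \<and> f \<in> Hom C (Dom C s) Y"
  by (auto simp: roofs_def Hom_def N_iso_Arr)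

lemma roof_eqI:
  assumes "u \<in> Hom C W (Dom C s)" and "u' \<in> Hom C W (Dom C s')"
    and "s \<cdot> u = s' \<cdot> u'" and "s \<cdot> u \<in> S" and "f \<cdot> u = f' \<cdot> u'"
  shows "req (s, f) (s', f')"
  using assms unfolding roof_eq_def prod.case by blast

lemma roof_eqE:
  assumes "req (s, f) (s', f')"
  obtains W u u' where "u \<in> Hom C W (Dom C s)" and "u' \<in> Hom C W (Dom C s')"
    and "s \<cdot> u = s' \<cdot> u'" and "s \<cdot> u \<in> S" and "f \<cdot> u = f' \<cdot> u'"
  using assms unfolding roof_eq_def by auto

text \<open>An equivalence of roofs comes with its own completing pair \<open>w\<close>,
  \<open>w'\<close>. This transfers it to a prescribed pair \<open>p\<close>, \<open>p'\<close>, at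
  the cost of a further inverted arrow; transitivity and composition need it because there the pair
  is dictated by another roof.\<close>

lemma roof_align:
  assumes r: "(s, f) \<in> Roofs X Y" and r': "(s', f') \<in> Roofs X Y"
    and eq: "req (s, f) (s', f')"
    and p: "p \<in> Hom C W (Dom C s)" and p': "p' \<in> Hom C W (Dom C s')"
    and sp: "s \<cdot> p = s' \<cdot> p'"
  obtains V e where "e \<in> Hom C V W" and "e \<in> S" and "f \<cdot> (p \<cdot> e) = f' \<cdot> (p' \<cdot> e)"
proof -
  note R = r[unfolded roofs_iff] r'[unfolded roofs_iff]
  from R have s: "s \<in> Hom C (Dom C s) X" "s \<in> S" and f: "f \<in> Hom C (Dom C s) Y"
    and s': "s' \<in> Hom C (Dom C s') X" "s' \<in> S" and f': "f' \<in> Hom C (Dom C s') Y" by auto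
  obtain W' w w' where w: "w \<in> Hom C W' (Dom C s)" and w': "w' \<in> Hom C W' (Dom C s')"
    and sw: "s \<cdot> w = s' \<cdot> w'" "s \<cdot> w \<in> S" and fw: "f \<cdot> w = f' \<cdot> w'"
    using roof_eqE[OF eq] .
  have "s \<cdot> p \<in> Hom C W X" "s \<cdot> w \<in> Hom C W' X" using Comp_in_Hom p w s(1) by auto
  \<comment> \<open>Taking the inverted \<open>s \<cdot> w\<close> as denominator makes the leg
    \<open>c\<close> towards the prescribed \<open>W\<close> inverted.\<close>
  then obtain V1 c d where c: "c \<in> Hom C V1 W" "c \<in> S" and d: "d \<in> Hom C V1 W'"
    and e1: "(s \<cdot> p) \<cdot> c = (s \<cdot> w) \<cdot> d"
    using ore[OF _ _ sw(2)] by metis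
  have "s \<cdot> (p \<cdot> c) = s \<cdot> (w \<cdot> d)" using e1 s p w c d by (simp add: Hom_def)
  \<comment> \<open>Cancelling \<open>s\<close> equalises \<open>p \<cdot> c\<close> and
    \<open>w \<cdot> d\<close>. The primed legs are equalised separately by cancelling
    \<open>s'\<close>, over the arrow found here.\<close>
  then obtain V2 c' where c': "c' \<in> Hom C V2 V1" "c' \<in> S" "(p \<cdot> c) \<cdot> c' = (w \<cdot> d) \<cdot> c'"
    using cancel[OF Comp_in_Hom[OF c(1) p] Comp_in_Hom[OF d w] s] by blast
  have "s' \<cdot> (p' \<cdot> c) = s' \<cdot> (w' \<cdot> d)"
    using e1 s' p' w' c d unfolding sp sw(1) by (simp add: Hom_def)
  then have "s' \<cdot> ((p' \<cdot> c) \<cdot> c') = s' \<cdot> ((w' \<cdot> d) \<cdot> c')"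
    using s' p' w' c d c' Comp_extend[OF _ Comp_in_Hom[OF c(1) p'] s'(1) c'(1)]
      Comp_extend[OF _ Comp_in_Hom[OF d w'] s'(1) c'(1)] by metis
  then obtain V c'' where c'': "c'' \<in> Hom C V V2" "c'' \<in> S"
      "((p' \<cdot> c) \<cdot> c') \<cdot> c'' = ((w' \<cdot> d) \<cdot> c') \<cdot> c''"
    using cancel[OF Comp_in_Hom[OF c'(1) Comp_in_Hom[OF c(1) p']]
        Comp_in_Hom[OF c'(1) Comp_in_Hom[OF d w']] s'] by blast
  have pw: "p \<cdot> (c \<cdot> (c' \<cdot> c'')) = w \<cdot> (d \<cdot> (c' \<cdot> c''))"
    using arg_cong[OF c'(3), of "\<lambda>x. x \<cdot> c''"] p w c d c'(1) c''(1) by (simp add: Hom_def)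
  have pw': "p' \<cdot> (c \<cdot> (c' \<cdot> c'')) = w' \<cdot> (d \<cdot> (c' \<cdot> c''))"
    using c''(3) p' w' c d c' c'' by (simp add: Hom_def)
  have "c \<cdot> (c' \<cdot> c'') \<in> Hom C V W" using c c' c'' Comp_in_Hom by blast
  moreover have "c \<cdot> (c' \<cdot> c'') \<in> S"
    using c(1) c'(1) c''(1) by (intro Comp_N_iso c(2) c'(2) c''(2)) (auto simp: Hom_def)
  moreover have "f \<cdot> (w \<cdot> (d \<cdot> (c' \<cdot> c''))) = f' \<cdot> (w' \<cdot> (d \<cdot> (c' \<cdot> c'')))"
    using arg_cong[OF fw, of "\<lambda>x. x \<cdot> (d \<cdot> (c' \<cdot> c''))"] f f' w w' d c' c'' by (simp add: Hom_def)
  ultimately show ?thesis using that pw pw' by simp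
qed

lemma roof_eq_refl: "(s, f) \<in> Roofs X Y \<Longrightarrow> req (s, f) (s, f)"
  by (rule roof_eqI[of "Idn C (Dom C s)" "Dom C s"])
    (auto simp: roofs_iff Hom_Obj(1) Idn_in_Hom Comp_Idn)

lemma roof_eq_sym: "req r r' \<Longrightarrow> req r' r"
  unfolding roof_eq_def by (auto split: prod.splits) metis

text \<open>The two equivalences are witnessed over unrelated objects. A common refinement of all
  three denominators is taken first, and \<open>roof_align\<close> carries each equivalence over to
  it.\<close>

lemma roof_eq_trans:
  assumes r: "(s, f) \<in> Roofs X Y" and r': "(s', f') \<in> Roofs X Y"
    and r'': "(s'', f'') \<in> Roofs X Y"
    and eq: "req (s, f) (s', f')" and eq': "req (s', f') (s'', f'')"
  shows "req (s, f) (s'', f'')"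
proof -
  from r r' r'' have s: "s \<in> Hom C (Dom C s) X" "s \<in> S" and f: "f \<in> Hom C (Dom C s) Y"
    and s': "s' \<in> Hom C (Dom C s') X" "s' \<in> S" and f': "f' \<in> Hom C (Dom C s') Y"
    and s'': "s'' \<in> Hom C (Dom C s'') X" "s'' \<in> S" and f'': "f'' \<in> Hom C (Dom C s'') Y"
    by (auto simp: roofs_iff)
  obtain W1 a a' where a: "a \<in> Hom C W1 (Dom C s)" "a \<in> S" and a': "a' \<in> Hom C W1 (Dom C s')"
    and sa: "s \<cdot> a = s' \<cdot> a'" using ore[OF s(1) s'] by metis
  obtain W b b'' where b: "b \<in> Hom C W W1" "b \<in> S" and b'': "b'' \<in> Hom C W (Dom C s'')"
    and sab: "(s \<cdot> a) \<cdot> b = s'' \<cdot> b''" using ore[OF Comp_in_Hom[OF a(1) s(1)] s''] by metis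
  note p = Comp_in_Hom[OF b(1) a(1)] and p' = Comp_in_Hom[OF b(1) a']
  have e1: "s \<cdot> (a \<cdot> b) = s' \<cdot> (a' \<cdot> b)"
    using arg_cong[OF sa, of "\<lambda>x. x \<cdot> b"] s s' a a' b by (simp add: Hom_def)
  have e2: "s \<cdot> (a \<cdot> b) = s'' \<cdot> b''" using sab s a b by (simp add: Hom_def)
  obtain V e where e: "e \<in> Hom C V W" "e \<in> S" "f \<cdot> ((a \<cdot> b) \<cdot> e) = f' \<cdot> ((a' \<cdot> b) \<cdot> e)"
    using roof_align[OF r r' eq p p' e1] .
  have e3: "s' \<cdot> ((a' \<cdot> b) \<cdot> e) = s'' \<cdot> (b'' \<cdot> e)"
    using arg_cong[OF e2, of "\<lambda>x. x \<cdot> e"] e1 s s' s'' a a' b b'' e by (simp add: Hom_def)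
  obtain U e' where e': "e' \<in> Hom C U V" "e' \<in> S"
    "f' \<cdot> (((a' \<cdot> b) \<cdot> e) \<cdot> e') = f'' \<cdot> ((b'' \<cdot> e) \<cdot> e')"
    using roof_align[OF r' r'' eq' Comp_in_Hom[OF e(1) p'] Comp_in_Hom[OF e(1) b''] e3] .
  show ?thesis
  proof (rule roof_eqI)
    show "((a \<cdot> b) \<cdot> e) \<cdot> e' \<in> Hom C U (Dom C s)" "(b'' \<cdot> e) \<cdot> e' \<in> Hom C U (Dom C s'')"
      using Comp_in_Hom p b'' e(1) e'(1) by blast+
    show "s \<cdot> (((a \<cdot> b) \<cdot> e) \<cdot> e') = s'' \<cdot> ((b'' \<cdot> e) \<cdot> e')"
      using arg_cong[OF e2, of "\<lambda>x. x \<cdot> (e \<cdot> e')"] s s'' a b b'' e e' by (simp add: Hom_def)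
    show "s \<cdot> (((a \<cdot> b) \<cdot> e) \<cdot> e') \<in> S"
      using s a b e e' by (simp add: Hom_def Comp_N_iso)
    show "f \<cdot> (((a \<cdot> b) \<cdot> e) \<cdot> e') = f'' \<cdot> ((b'' \<cdot> e) \<cdot> e')"
      using arg_cong[OF e(3), of "\<lambda>x. x \<cdot> e'"] e'(3) f f' f'' a a' b b'' e(1) e'(1)
      by (simp add: Hom_def)
  qed
qed

lemma roof_class_eq_iff:
  assumes "(s, f) \<in> Roofs X Y" and "(s', f') \<in> Roofs X Y"
  shows "cls (s, f) = cls (s', f') \<longleftrightarrow> req (s, f) (s', f')"
proof
  have C: "Cod C s = X" "Cod C s' = X" "Cod C f = Y" "Cod C f' = Y"
    using assms by (auto simp: roofs_iff Hom_def)
  show "req (s, f) (s', f')" if "cls (s, f) = cls (s', f')"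
    using that roof_eq_refl[OF assms(2)] assms(2) C by (auto simp: roof_class_def)
  show "cls (s, f) = cls (s', f')" if eq: "req (s, f) (s', f')"
    using roof_eq_trans[OF assms(1,2) _ eq] roof_eq_trans[OF assms(2,1) _ roof_eq_sym[OF eq]]
    by (auto simp: roof_class_def C)
qed

section \<open>The quotient category\<close>

abbreviation "Q \<equiv> quotient_cat C N"
abbreviation "q \<equiv> AMap (quotient_functor C N)"

lemma Q_Obj [simp]: "Obj Q = Obj C"
  by (simp add: quotient_cat_def)

lemma roof_class_Hom: "(s, f) \<in> Roofs X Y \<Longrightarrow> cls (s, f) \<in> Hom Q X Y"
  by (auto simp: Hom_def quotient_cat_def) (auto simp: roof_class_def roofs_iff Hom_def)

lemma Q_HomE:
  assumes "h \<in> Hom Q X Y"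
  obtains s f where "(s, f) \<in> Roofs X Y" and "h = cls (s, f)"
proof -
  obtain s f X' Y' where r: "(s, f) \<in> Roofs X' Y'" and h: "h = cls (s, f)"
    using assms unfolding Hom_def quotient_cat_def by auto
  have "X' = X" "Y' = Y"
    using roof_class_Hom[OF r] assms h unfolding Hom_def by auto
  then show ?thesis using that r h by blast
qed

lemma Comp_roof:
  assumes "(s, f) \<in> Roofs X Y" and "(t, g) \<in> Roofs Y Z"
    and "u \<in> Hom C W (Dom C s)" and "u \<in> S" and "v \<in> Hom C W (Dom C t)"
  shows "(s \<cdot> u, g \<cdot> v) \<in> Roofs X Z"
  using assms Comp_N_iso by (auto simp: roofs_iff Hom_def)

text \<open>Neither the representatives nor the completing squares affect the composite. Over a
  common refinement of \<open>s \<cdot> u\<close> and \<open>s' \<cdot> u'\<close> the first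
  equivalence makes the numerators \<open>f\<close> and \<open>f'\<close> agree. The completing
  squares turn this into agreement after \<open>t\<close> and \<open>t'\<close>, which is what
  \<open>roof_align\<close> asks for in order to use the second equivalence.\<close>

lemma Comp_roof_eq:
  assumes r: "(s, f) \<in> Roofs X Y" and r': "(s', f') \<in> Roofs X Y"
    and q: "(t, g) \<in> Roofs Y Z" and q': "(t', g') \<in> Roofs Y Z"
    and req: "req (s, f) (s', f')" and qeq: "req (t, g) (t', g')"
    and u: "u \<in> Hom C W (Dom C s)" "u \<in> S" and v: "v \<in> Hom C W (Dom C t)" and fu: "f \<cdot> u = t \<cdot> v"
    and u': "u' \<in> Hom C W' (Dom C s')" "u' \<in> S" and v': "v' \<in> Hom C W' (Dom C t')"
    and fu': "f' \<cdot> u' = t' \<cdot> v'"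
  shows "req (s \<cdot> u, g \<cdot> v) (s' \<cdot> u', g' \<cdot> v')"
proof -
  from r r' q q' have s: "s \<in> Hom C (Dom C s) X" "s \<in> S" and f: "f \<in> Hom C (Dom C s) Y"
    and s': "s' \<in> Hom C (Dom C s') X" "s' \<in> S" and f': "f' \<in> Hom C (Dom C s') Y"
    and t: "t \<in> Hom C (Dom C t) Y" "t \<in> S" and g: "g \<in> Hom C (Dom C t) Z"
    and t': "t' \<in> Hom C (Dom C t') Y" "t' \<in> S" and g': "g' \<in> Hom C (Dom C t') Z"
    by (auto simp: roofs_iff)
  have su': "s' \<cdot> u' \<in> S" using s' u' by (simp add: Hom_def Comp_N_iso)
  obtain W0 a b where a: "a \<in> Hom C W0 W" "a \<in> S" and b: "b \<in> Hom C W0 W'"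
    and ab: "(s \<cdot> u) \<cdot> a = (s' \<cdot> u') \<cdot> b"
    using ore[OF Comp_in_Hom[OF u(1) s(1)] Comp_in_Hom[OF u'(1) s'(1)] su'] by metis
  have e1: "s \<cdot> (u \<cdot> a) = s' \<cdot> (u' \<cdot> b)" using ab s s' u u' a b by (simp add: Hom_def)
  obtain V e where e: "e \<in> Hom C V W0" "e \<in> S" "f \<cdot> ((u \<cdot> a) \<cdot> e) = f' \<cdot> ((u' \<cdot> b) \<cdot> e)"
    using roof_align[OF r r' req Comp_in_Hom[OF a(1) u(1)] Comp_in_Hom[OF b u'(1)] e1] .
  have e2: "t \<cdot> (v \<cdot> (a \<cdot> e)) = t' \<cdot> (v' \<cdot> (b \<cdot> e))"
    using arg_cong[OF fu, of "\<lambda>x. x \<cdot> (a \<cdot> e)"] arg_cong[OF fu', of "\<lambda>x. x \<cdot> (b \<cdot> e)"] e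
      f f' t t' u u' v v' a b by (simp add: Hom_def)
  have x: "v \<cdot> (a \<cdot> e) \<in> Hom C V (Dom C t)" "v' \<cdot> (b \<cdot> e) \<in> Hom C V (Dom C t')"
    using Comp_in_Hom v v' a(1) b e(1) by blast+
  obtain U e' where e': "e' \<in> Hom C U V" "e' \<in> S"
    "g \<cdot> ((v \<cdot> (a \<cdot> e)) \<cdot> e') = g' \<cdot> ((v' \<cdot> (b \<cdot> e)) \<cdot> e')"
    using roof_align[OF q q' qeq x e2] .
  show ?thesis
  proof (rule roof_eqI)
    show "a \<cdot> (e \<cdot> e') \<in> Hom C U (Dom C (s \<cdot> u))" "b \<cdot> (e \<cdot> e') \<in> Hom C U (Dom C (s' \<cdot> u'))"
      using s u s' u' a b e e' by (auto simp: Hom_def)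
    show "(s \<cdot> u) \<cdot> (a \<cdot> (e \<cdot> e')) = (s' \<cdot> u') \<cdot> (b \<cdot> (e \<cdot> e'))"
      using arg_cong[OF ab, of "\<lambda>x. x \<cdot> (e \<cdot> e')"] s u s' u' a b e e' by (simp add: Hom_def)
    show "(s \<cdot> u) \<cdot> (a \<cdot> (e \<cdot> e')) \<in> S"
      using s u a e e' by (simp add: Hom_def Comp_N_iso)
    show "(g \<cdot> v) \<cdot> (a \<cdot> (e \<cdot> e')) = (g' \<cdot> v') \<cdot> (b \<cdot> (e \<cdot> e'))"
      using e'(3) g g' v v' a b e e' by (simp add: Hom_def)
  qed
qed

text \<open>The set that \<open>qcomp\<close> collects over all choices is a single class by
  \<open>Comp_roof_eq\<close>, so one completing square computes the composite.\<close>

lemma Comp_roof_class: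
  assumes r: "(s, f) \<in> Roofs X Y" and q: "(t, g) \<in> Roofs Y Z"
    and u: "u \<in> Hom C W (Dom C s)" "u \<in> S" and v: "v \<in> Hom C W (Dom C t)" and fu: "f \<cdot> u = t \<cdot> v"
  shows "cls (t, g) \<cdot>\<^bsub>Q\<^esub> cls (s, f) = cls (s \<cdot> u, g \<cdot> v)"
proof -
  note su = Comp_roof[OF r q u v]
  have C: "Cod C s = X" "Cod C f = Y" "Cod C t = Y" "Cod C g = Z" "Cod C (s \<cdot> u) = X"
    "Cod C (g \<cdot> v) = Z" "Dom C f = Dom C s"
    using r q su by (auto simp: roofs_iff Hom_def)
  have "(\<exists>(s', f') \<in> {r \<in> Roofs X Y. req (s, f) r}.
      \<exists>(t', g') \<in> {r \<in> Roofs Y Z. req (t, g) r}. \<exists>W u v.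
      u \<in> Hom C W (Dom C f') \<and> u \<in> S \<and> v \<in> Hom C W (Dom C t') \<and>
      f' \<cdot> u = t' \<cdot> v \<and> req (s' \<cdot> u, g' \<cdot> v) x) \<longleftrightarrow> req (s \<cdot> u, g \<cdot> v) x"
    (is "?L \<longleftrightarrow> ?R") if x: "x \<in> Roofs X Z" for x
  proof
    obtain x1 x2 where x12: "x = (x1, x2)" by fastforce
    assume ?L
    then obtain s' f' t' g' W' u' v' where r': "(s', f') \<in> Roofs X Y" "req (s, f) (s', f')"
      and q': "(t', g') \<in> Roofs Y Z" "req (t, g) (t', g')"
      and u': "u' \<in> Hom C W' (Dom C f')" "u' \<in> S" and v': "v' \<in> Hom C W' (Dom C t')"
      and fu': "f' \<cdot> u' = t' \<cdot> v'" and x': "req (s' \<cdot> u', g' \<cdot> v') x"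
      by blast
    have "Dom C f' = Dom C s'" using r' by (auto simp: roofs_iff Hom_def)
    with u' have u': "u' \<in> Hom C W' (Dom C s')" "u' \<in> S" by auto
    show ?R
      using roof_eq_trans[OF su Comp_roof[OF r'(1) q'(1) u' v'] x[unfolded x12]
        Comp_roof_eq[OF r r'(1) q q'(1) r'(2) q'(2) u v fu u' v' fu'] x'[unfolded x12]] x12
      by simp
  next
    assume ?R
    then have *: "\<exists>W u v. u \<in> Hom C W (Dom C f) \<and> u \<in> S \<and> v \<in> Hom C W (Dom C t) \<and>
        f \<cdot> u = t \<cdot> v \<and> req (s \<cdot> u, g \<cdot> v) x" using u v fu C(7) by auto
    show ?L
      by (rule bexI[of _ "(s, f)"], unfold prod.case, rule bexI[of _ "(t, g)"], unfold prod.case, rule *)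
        (simp_all add: r q roof_eq_refl[OF r] roof_eq_refl[OF q])
  qed
  then have "{x \<in> Roofs X Z. \<exists>(s', f') \<in> {r \<in> Roofs X Y. req (s, f) r}.
      \<exists>(t', g') \<in> {r \<in> Roofs Y Z. req (t, g) r}. \<exists>W u v.
      u \<in> Hom C W (Dom C f') \<and> u \<in> S \<and> v \<in> Hom C W (Dom C t') \<and>
      f' \<cdot> u = t' \<cdot> v \<and> req (s' \<cdot> u, g' \<cdot> v) x} =
      {x \<in> Roofs X Z. req (s \<cdot> u, g \<cdot> v) x}"
    by (intro Collect_cong conj_cong refl) blast
  then show ?thesis
    by (simp add: quotient_cat_def qcomp_def roof_class_def C)
qed

lemma Comp_roofE:
  assumes r: "(s, f) \<in> Roofs X Y" and q: "(t, g) \<in> Roofs Y Z"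
  obtains W u v where "u \<in> Hom C W (Dom C s)" and "u \<in> S" and "v \<in> Hom C W (Dom C t)"
    and "f \<cdot> u = t \<cdot> v"
  using ore[of f "Dom C s" Y t "Dom C t"] assms unfolding roofs_iff by metis

lemma Idn_roof: "X \<in> Obj C \<Longrightarrow> f \<in> Hom C X Y \<Longrightarrow> (Idn C X, f) \<in> Roofs X Y"
  by (auto simp: roofs_iff Idn_N_iso Idn_in_Hom)

lemma Q_Idn: "X \<in> Obj C \<Longrightarrow> Idn Q X = cls (Idn C X, Idn C X)"
  by (simp add: quotient_cat_def)

lemma category_Q: "category Q"
proof
  show "Dom Q f \<in> Obj Q" "Cod Q f \<in> Obj Q" if "f \<in> Arr Q" for f
  proof -
    have "f \<in> Hom Q (Dom Q f) (Cod Q f)" using that by (simp add: Hom_def)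
    then obtain s g where "(s, g) \<in> Roofs (Dom Q f) (Cod Q f)" using Q_HomE by blast
    then show "Dom Q f \<in> Obj Q" "Cod Q f \<in> Obj Q" using Hom_Obj by (auto simp: roofs_iff)
  qed
  show "Idn Q X \<in> Hom Q X X" if "X \<in> Obj Q" for X
    using that roof_class_Hom Idn_roof Idn_in_Hom by (simp add: Q_Idn)
  show "g \<cdot>\<^bsub>Q\<^esub> f \<in> Hom Q X Z" if fg: "f \<in> Hom Q X Y" "g \<in> Hom Q Y Z" for f g X Y Z
  proof -
    obtain s f0 where r: "(s, f0) \<in> Roofs X Y" and f: "f = cls (s, f0)"
      using Q_HomE fg(1) by blast
    obtain t g0 where q: "(t, g0) \<in> Roofs Y Z" and g: "g = cls (t, g0)"
      using Q_HomE fg(2) by blast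
    obtain W u v where u: "u \<in> Hom C W (Dom C s)" "u \<in> S" and v: "v \<in> Hom C W (Dom C t)"
      and fu: "f0 \<cdot> u = t \<cdot> v" using Comp_roofE[OF r q] .
    show ?thesis
      using Comp_roof_class[OF r q u v fu] roof_class_Hom[OF Comp_roof[OF r q u v]] f g by simp
  qed
  show "f \<cdot>\<^bsub>Q\<^esub> Idn Q X = f" if f: "f \<in> Hom Q X Y" for f X Y
  proof -
    obtain s f0 where r: "(s, f0) \<in> Roofs X Y" and f0: "f = cls (s, f0)"
      using Q_HomE f by blast
    have s: "s \<in> Hom C (Dom C s) X" "s \<in> S" "f0 \<in> Hom C (Dom C s) Y" using r by (auto simp: roofs_iff)
    have X: "X \<in> Obj C" "Dom C s \<in> Obj C" using Hom_Obj[OF s(1)] by auto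
    show ?thesis
      using Comp_roof_class[OF Idn_roof[OF X(1) Idn_in_Hom[OF X(1)]] r, of s "Dom C s" "Idn C (Dom C s)"]
        s X f0 by (simp add: Q_Idn Idn_in_Hom Comp_Idn Idn_Comp)
  qed
  show "Idn Q Y \<cdot>\<^bsub>Q\<^esub> f = f" if f: "f \<in> Hom Q X Y" for f X Y
  proof -
    obtain s f0 where r: "(s, f0) \<in> Roofs X Y" and f0: "f = cls (s, f0)"
      using Q_HomE f by blast
    have s: "s \<in> Hom C (Dom C s) X" "s \<in> S" "f0 \<in> Hom C (Dom C s) Y" using r by (auto simp: roofs_iff)
    have X: "Y \<in> Obj C" "Dom C s \<in> Obj C" using Hom_Obj[OF s(3)] by auto
    show ?thesis
      using Comp_roof_class[OF r Idn_roof[OF X(1) Idn_in_Hom[OF X(1)]], of "Idn C (Dom C s)" "Dom C s" f0]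
        s X f0 by (simp add: Q_Idn Idn_in_Hom Comp_Idn Idn_Comp Idn_N_iso)
  qed
  show "h \<cdot>\<^bsub>Q\<^esub> (g \<cdot>\<^bsub>Q\<^esub> f) = h \<cdot>\<^bsub>Q\<^esub> g \<cdot>\<^bsub>Q\<^esub> f"
    if fgh: "f \<in> Hom Q W X" "g \<in> Hom Q X Y" "h \<in> Hom Q Y Z" for f g h W X Y Z
  proof -
    obtain s f0 where r: "(s, f0) \<in> Roofs W X" and f: "f = cls (s, f0)"
      using Q_HomE fgh(1) by blast
    obtain t g0 where q: "(t, g0) \<in> Roofs X Y" and g: "g = cls (t, g0)"
      using Q_HomE fgh(2) by blast
    obtain r h0 where p: "(r, h0) \<in> Roofs Y Z" and h: "h = cls (r, h0)"
      using Q_HomE fgh(3) by blast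
    obtain A a b where a: "a \<in> Hom C A (Dom C t)" "a \<in> S" and b: "b \<in> Hom C A (Dom C r)"
      and ab: "g0 \<cdot> a = r \<cdot> b" using Comp_roofE[OF q p] .
    note hg = Comp_roof[OF q p a b]
    have Da: "Dom C (t \<cdot> a) = A" using hg q a by (simp add: roofs_iff Hom_def)
    \<comment> \<open>Completing \<open>f0\<close> against the denominator of the composite of
      \<open>g\<close> and \<open>h\<close> gives a square that also serves for \<open>f\<close> and
      \<open>g\<close> alone, so both bracketings are computed from the same arrows.\<close>
    obtain B c d where c: "c \<in> Hom C B (Dom C s)" "c \<in> S" and d: "d \<in> Hom C B (Dom C (t \<cdot> a))"
      and cd: "f0 \<cdot> c = (t \<cdot> a) \<cdot> d" using Comp_roofE[OF r hg] .
    note d = d[unfolded Da]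
    note ad = Comp_in_Hom[OF d a(1)] and bd = Comp_in_Hom[OF d b]
    have cd': "f0 \<cdot> c = t \<cdot> (a \<cdot> d)" using cd q a d by (simp add: roofs_iff Hom_def)
    note gf = Comp_roof[OF r q c ad]
    have Ds: "Dom C (s \<cdot> c) = B" using r c by (simp add: roofs_iff Hom_def)
    have B: "B \<in> Obj C" using Hom_Obj[OF c(1)] by simp
    have ab': "(g0 \<cdot> (a \<cdot> d)) \<cdot> Idn C B = r \<cdot> (b \<cdot> d)"
      using arg_cong[OF ab, of "\<lambda>x. x \<cdot> d"] p q a b d B by (simp add: roofs_iff Hom_def)
    have "h \<cdot>\<^bsub>Q\<^esub> g \<cdot>\<^bsub>Q\<^esub> f = cls (s \<cdot> c, (h0 \<cdot> b) \<cdot> d)"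
      unfolding f g h Comp_roof_class[OF q p a b ab]
      using Comp_roof_class[OF r hg c _ cd] d Da by simp
    moreover have "h \<cdot>\<^bsub>Q\<^esub> (g \<cdot>\<^bsub>Q\<^esub> f) = cls ((s \<cdot> c) \<cdot> Idn C B, h0 \<cdot> (b \<cdot> d))"
      unfolding f g h Comp_roof_class[OF r q c ad cd']
      using Comp_roof_class[OF gf p _ _ bd ab'] Ds B by (simp add: Idn_in_Hom Idn_N_iso)
    ultimately show ?thesis using r p c b d B by (simp add: roofs_iff Hom_def)
  qed
qed

sublocale Q: category Q by (rule category_Q)

section \<open>The quotient functor and fractions\<close>

lemma q_def: "f \<in> Hom C X Y \<Longrightarrow> q f = cls (Idn C X, f)"
  by (auto simp: quotient_functor_def Hom_def)

lemma q_Hom: "f \<in> Hom C X Y \<Longrightarrow> q f \<in> Hom Q X Y"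
  using roof_class_Hom Idn_roof Hom_Obj by (simp add: q_def)

lemma q_functor: "is_functor C Q (quotient_functor C N)"
proof (rule functorI)
  have O: "OMap (quotient_functor C N) X = X" for X by (simp add: quotient_functor_def)
  show "category C" "category Q" by unfold_locales
  show "OMap (quotient_functor C N) X \<in> Obj Q" if "X \<in> Obj C" for X using that O by simp
  show "q f \<in> Hom Q (OMap (quotient_functor C N) X) (OMap (quotient_functor C N) Y)"
    if "f \<in> Hom C X Y" for f X Y using that O q_Hom by simp
  show "q (Idn C X) = Idn Q (OMap (quotient_functor C N) X)" if "X \<in> Obj C" for X
    using that O q_def[OF Idn_in_Hom] by (simp add: Q_Idn)
  show "q (g \<cdot> f) = q g \<cdot>\<^bsub>Q\<^esub> q f" if f: "f \<in> Hom C X Y" and g: "g \<in> Hom C Y Z" for f g X Y Z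
  proof -
    have O: "X \<in> Obj C" "Y \<in> Obj C" using Hom_Obj f by auto
    show ?thesis
      unfolding q_def[OF f] q_def[OF g] q_def[OF Comp_in_Hom[OF f g]]
      using Comp_roof_class[OF Idn_roof[OF O(1) f] Idn_roof[OF O(2) g], of "Idn C X" X f] O f
      by (simp add: Idn_in_Hom Idn_N_iso Comp_Idn Idn_Comp)
  qed
qed

lemma q_Comp: "f \<in> Hom C X Y \<Longrightarrow> g \<in> Hom C Y Z \<Longrightarrow> q (g \<cdot> f) = q g \<cdot>\<^bsub>Q\<^esub> q f"
  by (rule functor_Comp[OF q_functor])

lemma q_Idn: "X \<in> Obj C \<Longrightarrow> q (Idn C X) = Idn Q X"
  using functor_Idn[OF q_functor] by (simp add: quotient_functor_def)

text \<open>This equation makes precise that the class of \<open>(s, f)\<close> is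
  \<open>f s^-1\<close>. As \<open>q s\<close> is invertible it determines the class, and from here
  on arrows of the quotient are handled through it rather than through roofs.\<close>

lemma roof_class_q:
  assumes r: "(s, f) \<in> Roofs X Y"
  shows "cls (s, f) \<cdot>\<^bsub>Q\<^esub> q s = q f"
proof -
  have s: "s \<in> Hom C (Dom C s) X" "s \<in> S" "f \<in> Hom C (Dom C s) Y" using r by (auto simp: roofs_iff)
  have O: "Dom C s \<in> Obj C" using Hom_Obj[OF s(1)] by simp
  show ?thesis
    using Comp_roof_class[OF Idn_roof[OF O s(1)] r, of "Idn C (Dom C s)" "Dom C s" "Idn C (Dom C s)"] O s
    by (simp add: q_def[OF s(1)] q_def[OF s(3)] Idn_in_Hom Idn_N_iso Comp_Idn Idn_Comp)
qed

text \<open>The inverse is the class of the roof \<open>(s, Idn C W)\<close>, with \<open>W\<close>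
  the domain of \<open>s\<close>.\<close>

lemma q_iso:
  assumes "s \<in> S"
  shows "is_iso Q (q s)"
proof -
  obtain W X where s: "s \<in> Hom C W X" using N_iso_Arr[OF assms] by (auto simp: Hom_def)
  have Ds: "Dom C s = W" using s by (simp add: Hom_def)
  have O: "W \<in> Obj C" "X \<in> Obj C" using Hom_Obj[OF s] by auto
  have r: "(s, Idn C W) \<in> Roofs X W" using s assms O Ds by (simp add: roofs_iff Idn_in_Hom)
  have rs: "(s, s) \<in> Roofs X X" using s assms Ds by (simp add: roofs_iff)
  have "q s \<cdot>\<^bsub>Q\<^esub> cls (s, Idn C W) = cls (s, s)"
    using Comp_roof_class[OF r Idn_roof[OF O(1) s], of "Idn C W" W "Idn C W"] s O Ds
    by (simp add: q_def[OF s] Idn_in_Hom Idn_N_iso Comp_Idn Idn_Comp)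
  also have "\<dots> = Idn Q X"
    using roof_class_eq_iff[OF rs Idn_roof[OF O(2) Idn_in_Hom[OF O(2)]]] O s Ds assms
      roof_eqI[of "Idn C W" W s s "Idn C X" s "Idn C X"]
    by (simp add: Q_Idn Idn_in_Hom Comp_Idn Idn_Comp)
  finally have "q s \<cdot>\<^bsub>Q\<^esub> cls (s, Idn C W) = Idn Q X" .
  moreover have "cls (s, Idn C W) \<cdot>\<^bsub>Q\<^esub> q s = Idn Q W"
    using roof_class_q[OF r] q_Idn[OF O(1)] by simp
  ultimately show ?thesis by (rule Q.isoI[OF q_Hom[OF s] roof_class_Hom[OF r], rotated])
qed

lemma Q_rep:
  assumes "h \<in> Hom Q X Y"
  obtains W s f where "s \<in> Hom C W X" and "s \<in> S" and "f \<in> Hom C W Y" and "h \<cdot>\<^bsub>Q\<^esub> q s = q f"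
  using Q_HomE[OF assms] roof_class_q roofs_iff by metis

text \<open>Two denominators are merged by \<open>ore\<close>: the diagonal of the completed square
  is inverted and is a denominator for both arrows.\<close>

lemma common_denominator:
  assumes g: "g \<in> Hom Q X Y" and h: "h \<in> Hom Q X Y"
  obtains W s a b where "s \<in> Hom C W X" and "s \<in> S" and "a \<in> Hom C W Y" and "b \<in> Hom C W Y"
    and "g \<cdot>\<^bsub>Q\<^esub> q s = q a" and "h \<cdot>\<^bsub>Q\<^esub> q s = q b"
proof -
  obtain V s a where s: "s \<in> Hom C V X" "s \<in> S" and a: "a \<in> Hom C V Y" and gs: "g \<cdot>\<^bsub>Q\<^esub> q s = q a"
    using Q_rep[OF g] .
  obtain V' t b where t: "t \<in> Hom C V' X" "t \<in> S" and b: "b \<in> Hom C V' Y" and ht: "h \<cdot>\<^bsub>Q\<^esub> q t = q b"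
    using Q_rep[OF h] .
  obtain W u v where u: "u \<in> Hom C W V" "u \<in> S" and v: "v \<in> Hom C W V'" and su: "s \<cdot> u = t \<cdot> v"
    using ore[OF s(1) t] by blast
  have "s \<cdot> u \<in> Hom C W X" "s \<cdot> u \<in> S" using s u by (auto simp: Comp_N_iso Hom_def)
  moreover have "g \<cdot>\<^bsub>Q\<^esub> q (s \<cdot> u) = q (a \<cdot> u)"
    using q_Comp[OF u(1) s(1)] q_Comp[OF u(1) a] gs Q.Comp_assoc[OF q_Hom[OF u(1)] q_Hom[OF s(1)] g] by simp
  moreover have "h \<cdot>\<^bsub>Q\<^esub> q (s \<cdot> u) = q (b \<cdot> v)"
    unfolding su using q_Comp[OF v t(1)] q_Comp[OF v b] ht Q.Comp_assoc[OF q_Hom[OF v] q_Hom[OF t(1)] h] by simp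
  ultimately show ?thesis using that Comp_in_Hom[OF u(1) a] Comp_in_Hom[OF v b] by blast
qed

text \<open>Over identity denominators the two legs of an equivalence of roofs coincide.\<close>

lemma q_eqE:
  assumes f: "f \<in> Hom C X Y" and g: "g \<in> Hom C X Y" and "q f = q g"
  obtains W u where "u \<in> Hom C W X" and "u \<in> S" and "f \<cdot> u = g \<cdot> u"
proof -
  have O: "X \<in> Obj C" using Hom_Obj f by auto
  have "req (Idn C X, f) (Idn C X, g)"
    using roof_class_eq_iff[OF Idn_roof[OF O f] Idn_roof[OF O g]] assms(3)
    by (simp add: q_def[OF f] q_def[OF g])
  then obtain W u u' where "u \<in> Hom C W X" "u' \<in> Hom C W X" "Idn C X \<cdot> u = Idn C X \<cdot> u'"
    "Idn C X \<cdot> u \<in> S" "f \<cdot> u = g \<cdot> u'" using O by (auto elim: roof_eqE)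
  then show ?thesis using that by (simp add: Idn_Comp)
qed

lemma q_eqI:
  assumes "f \<in> Hom C X Y" and "g \<in> Hom C X Y" and "u \<in> Hom C W X" and "u \<in> S"
    and "f \<cdot> u = g \<cdot> u"
  shows "q f = q g"
  using Q.iso_cancel_right[OF q_iso[OF assms(4)] q_Hom[OF assms(3)] q_Hom[OF assms(1)] q_Hom[OF assms(2)]]
    q_Comp[OF assms(3,1)] q_Comp[OF assms(3,2)] assms(5) by simp

text \<open>\<open>induced_functor\<close> quantifies over the roofs contained in an arrow.
  Rewriting membership as an equation with \<open>q\<close> lets the raw triples be left
  behind.\<close>

lemma Q_arrow:
  assumes h: "h \<in> Hom Q X Y"
  obtains R where "h = (X, Y, R)"
    and "\<And>s f. (s, f) \<in> R \<longleftrightarrow> s \<in> S \<and> s \<in> Hom C (Dom C s) X \<and> f \<in> Hom C (Dom C s) Y \<and> h \<cdot>\<^bsub>Q\<^esub> q s = q f"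
proof -
  obtain s f where r: "(s, f) \<in> Roofs X Y" and hc: "h = cls (s, f)"
    using Q_HomE[OF h] .
  define R where "R = {r \<in> Roofs X Y. req (s, f) r}"
  have "h = (X, Y, R)" using r by (auto simp: hc roof_class_def R_def roofs_iff Hom_def)
  moreover have "(s', f') \<in> R \<longleftrightarrow> s' \<in> S \<and> s' \<in> Hom C (Dom C s') X \<and> f' \<in> Hom C (Dom C s') Y \<and>
      h \<cdot>\<^bsub>Q\<^esub> q s' = q f'" for s' f'
  proof -
    have "(s', f') \<in> R \<longleftrightarrow> (s', f') \<in> Roofs X Y \<and> h = cls (s', f')"
      using roof_class_eq_iff[OF r] by (auto simp: R_def hc)
    moreover have "h = cls (s', f') \<longleftrightarrow> h \<cdot>\<^bsub>Q\<^esub> q s' = q f'"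
      if r': "(s', f') \<in> Roofs X Y"
    proof -
      have s': "s' \<in> S" "s' \<in> Hom C (Dom C s') X" using r' by (auto simp: roofs_iff)
      show ?thesis
        using Q.iso_cancel_right[OF q_iso[OF s'(1)] q_Hom[OF s'(2)] h roof_class_Hom[OF r']]
          roof_class_q[OF r'] by auto
    qed
    ultimately show ?thesis by (auto simp: roofs_iff)
  qed
  ultimately show ?thesis using that by blast
qed

section \<open>Functors induced on the quotient\<close>

context
  fixes D :: "('p, 'b) cat" and F :: "('o, 'a, 'p, 'b) fctr"
  assumes F: "is_functor C D F" and inv: "\<And>s. s \<in> S \<Longrightarrow> is_iso D (AMap F s)"
begin

abbreviation "IF \<equiv> induced_functor C N D F"

text \<open>The description by \<open>THE\<close> ranges over all roofs of a class. One roof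
  determines the candidate \<open>k = F f (F s)^-1\<close>; that \<open>k\<close> fits every other
  roof is the well-definedness of the induced arrow.\<close>

lemma induced_functor_AMap:
  assumes h: "h \<in> Hom Q X Y"
  shows "AMap IF h \<in> Hom D (OMap F X) (OMap F Y)" (is ?P)
    and "s \<in> Hom C W X \<Longrightarrow> s \<in> S \<Longrightarrow> f \<in> Hom C W Y \<Longrightarrow> h \<cdot>\<^bsub>Q\<^esub> q s = q f \<Longrightarrow>
      AMap IF h \<cdot>\<^bsub>D\<^esub> AMap F s = AMap F f"
proof -
  interpret D: category D using functor_category[OF F] by simp
  obtain R where hR: "h = (X, Y, R)" and R: "\<And>s f. (s, f) \<in> R \<longleftrightarrow> s \<in> S \<and>
      s \<in> Hom C (Dom C s) X \<and> f \<in> Hom C (Dom C s) Y \<and> h \<cdot>\<^bsub>Q\<^esub> q s = q f"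
    using Q_arrow[OF h] by metis
  obtain W s f where s: "s \<in> Hom C W X" "s \<in> S" and f: "f \<in> Hom C W Y" and hs: "h \<cdot>\<^bsub>Q\<^esub> q s = q f"
    using Q_rep[OF h] .
  have sR: "(s, f) \<in> R" using s f hs by (auto simp: R Hom_def)
  obtain i where i: "i \<in> Hom D (OMap F X) (OMap F W)" "i \<cdot>\<^bsub>D\<^esub> AMap F s = Idn D (OMap F W)"
    using D.isoE[OF inv[OF s(2)] functor_Hom[OF F s(1)]] by metis
  define k where "k = AMap F f \<cdot>\<^bsub>D\<^esub> i"
  have k: "k \<in> Hom D (OMap F X) (OMap F Y)"
    unfolding k_def using D.Comp_in_Hom[OF i(1) functor_Hom[OF F f]] .
  have ks: "k \<cdot>\<^bsub>D\<^esub> AMap F s = AMap F f"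
    unfolding k_def using i functor_Hom[OF F f] functor_Hom[OF F s(1)] by (simp add: Hom_def)
  have uniq: "k' = k" if "k' \<in> Hom D (OMap F X) (OMap F Y)" "k' \<cdot>\<^bsub>D\<^esub> AMap F s = AMap F f" for k'
    using D.iso_cancel_right[OF inv[OF s(2)] functor_Hom[OF F s(1)] that(1) k] that(2) ks by simp
  have ks': "k \<cdot>\<^bsub>D\<^esub> AMap F s' = AMap F f'" if s'R: "(s', f') \<in> R" for s' f'
  proof -
    define W' where "W' = Dom C s'"
    have s': "s' \<in> Hom C W' X" "s' \<in> S" and f': "f' \<in> Hom C W' Y" and hs': "h \<cdot>\<^bsub>Q\<^esub> q s' = q f'"
      using s'R by (auto simp: R W'_def)
    obtain V a b where a: "a \<in> Hom C V W" "a \<in> S" and b: "b \<in> Hom C V W'" and ab: "s \<cdot> a = s' \<cdot> b"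
      using ore[OF s(1) s'] by metis
    \<comment> \<open>On the common denominator \<open>s \<cdot> a = s' \<cdot> b\<close> both
      numerators represent \<open>h\<close>, so they agree in the quotient, hence in
      \<open>C\<close> after some inverted \<open>e\<close>.\<close>
    have "q (f \<cdot> a) = q (f' \<cdot> b)"
      unfolding q_Comp[OF a(1) f] q_Comp[OF b f'] hs[symmetric] hs'[symmetric]
        Q.Comp_assoc[OF q_Hom[OF a(1)] q_Hom[OF s(1)] h, symmetric]
        Q.Comp_assoc[OF q_Hom[OF b] q_Hom[OF s'(1)] h, symmetric]
        q_Comp[OF a(1) s(1), symmetric] q_Comp[OF b s'(1), symmetric] ab ..
    then obtain U e where e: "e \<in> Hom C U V" "e \<in> S" "(f \<cdot> a) \<cdot> e = (f' \<cdot> b) \<cdot> e"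
      using q_eqE[OF Comp_in_Hom[OF a(1) f] Comp_in_Hom[OF b f']] by metis
    have ae: "a \<cdot> e \<in> Hom C U W" and be: "b \<cdot> e \<in> Hom C U W'" using Comp_in_Hom a b e by auto
    have sae: "s \<cdot> (a \<cdot> e) = s' \<cdot> (b \<cdot> e)"
      using arg_cong[OF ab, of "\<lambda>x. x \<cdot> e"] s s' a b e by (simp add: Hom_def)
    have fae: "f \<cdot> (a \<cdot> e) = f' \<cdot> (b \<cdot> e)" using e(3) f f' a b e by (simp add: Hom_def)
    have saeS: "s \<cdot> (a \<cdot> e) \<in> S" using s a e by (simp add: Comp_N_iso Hom_def)
    obtain i' where i': "i' \<in> Hom D (OMap F X) (OMap F W')" "i' \<cdot>\<^bsub>D\<^esub> AMap F s' = Idn D (OMap F W')"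
      using D.isoE[OF inv[OF s'(2)] functor_Hom[OF F s'(1)]] by metis
    note [simp] = functor_Comp[OF F ae s(1)] functor_Comp[OF F ae f] functor_Comp[OF F be s'(1)]
      functor_Comp[OF F be f']
    note FH = functor_Hom[OF F s(1)] functor_Hom[OF F s'(1)] functor_Hom[OF F f] functor_Hom[OF F f']
      functor_Hom[OF F ae] functor_Hom[OF F be]
    note k' = D.Comp_in_Hom[OF i'(1) FH(4)]
    have "(AMap F f' \<cdot>\<^bsub>D\<^esub> i') \<cdot>\<^bsub>D\<^esub> AMap F (s \<cdot> (a \<cdot> e)) = AMap F (f \<cdot> (a \<cdot> e))"
      unfolding sae fae using FH i' D.Comp_extend[OF i'(2) FH(2) i'(1) FH(6)] by (simp add: Hom_def)
    also have "\<dots> = k \<cdot>\<^bsub>D\<^esub> AMap F (s \<cdot> (a \<cdot> e))"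
      using FH k D.Comp_extend[OF ks FH(1) k FH(5)] by (simp add: Hom_def)
    finally have "AMap F f' \<cdot>\<^bsub>D\<^esub> i' = k"
      by (rule D.iso_cancel_right[OF inv[OF saeS] functor_Hom[OF F Comp_in_Hom[OF ae s(1)]] k' k])
    then show ?thesis using FH i' by (auto simp: Hom_def)
  qed
  have "(THE k. k \<in> Hom D (OMap F X) (OMap F Y) \<and> (\<forall>(s, f) \<in> R. k \<cdot>\<^bsub>D\<^esub> AMap F s = AMap F f)) = k"
  proof (rule the_equality)
    show "k \<in> Hom D (OMap F X) (OMap F Y) \<and> (\<forall>(s, f) \<in> R. k \<cdot>\<^bsub>D\<^esub> AMap F s = AMap F f)"
      using k ks' by blast
    show "k' = k" if "k' \<in> Hom D (OMap F X) (OMap F Y) \<and>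
        (\<forall>(s, f) \<in> R. k' \<cdot>\<^bsub>D\<^esub> AMap F s = AMap F f)" for k'
      using that sR by (intro uniq) blast+
  qed
  then have IFh: "AMap IF h = k" by (simp add: hR induced_functor_def)
  show ?P using k IFh by simp
  show "AMap IF h \<cdot>\<^bsub>D\<^esub> AMap F s = AMap F f"
    if "s \<in> Hom C W X" "s \<in> S" "f \<in> Hom C W Y" "h \<cdot>\<^bsub>Q\<^esub> q s = q f" for s f W
    using that ks'[of s f] unfolding IFh by (auto simp: R Hom_def)
qed

lemma induced_functor_q:
  assumes f: "f \<in> Hom C X Y"
  shows "AMap IF (q f) = AMap F f"
proof -
  interpret D: category D using functor_category[OF F] by simp
  have X: "X \<in> Obj C" using Hom_Obj[OF f] by simp
  have "AMap IF (q f) \<cdot>\<^bsub>D\<^esub> AMap F (Idn C X) = AMap F f"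
    using q_Hom[OF f] q_Idn[OF X]
    by (intro induced_functor_AMap(2)[OF q_Hom[OF f] Idn_in_Hom[OF X] Idn_N_iso[OF X] f])
      (auto simp: Q.Comp_Idn)
  then show ?thesis
    using induced_functor_AMap(1)[OF q_Hom[OF f]] functor_Idn[OF F X] by (simp add: D.Comp_Idn)
qed

lemma induced_functor_OMap [simp]: "OMap IF = OMap F"
  by (simp add: induced_functor_def)

text \<open>Composites are compared after the invertible \<open>F (s \<cdot> u)\<close>, where
  \<open>s \<cdot> u\<close> is the denominator of the composite fraction.\<close>

lemma induced_is_functor: "is_functor Q D IF"
proof (rule functorI)
  interpret D: category D using functor_category[OF F] by simp
  show "category Q" "category D" by unfold_locales
  show "OMap IF X \<in> Obj D" if "X \<in> Obj Q" for X using that functor_Obj[OF F] by simp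
  show "AMap IF f \<in> Hom D (OMap IF X) (OMap IF Y)" if "f \<in> Hom Q X Y" for f X Y
    using induced_functor_AMap(1)[OF that] by simp
  show "AMap IF (Idn Q X) = Idn D (OMap IF X)" if "X \<in> Obj Q" for X
    using that induced_functor_q[OF Idn_in_Hom] functor_Idn[OF F] by (simp add: q_Idn)
  show "AMap IF (g \<cdot>\<^bsub>Q\<^esub> f) = AMap IF g \<cdot>\<^bsub>D\<^esub> AMap IF f"
    if f: "f \<in> Hom Q X Y" and g: "g \<in> Hom Q Y Z" for f g X Y Z
  proof -
    obtain V s f0 where s: "s \<in> Hom C V X" "s \<in> S" and f0: "f0 \<in> Hom C V Y"
      and fs: "f \<cdot>\<^bsub>Q\<^esub> q s = q f0" using Q_rep[OF f] .
    obtain W t g0 where t: "t \<in> Hom C W Y" "t \<in> S" and g0: "g0 \<in> Hom C W Z"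
      and gt: "g \<cdot>\<^bsub>Q\<^esub> q t = q g0" using Q_rep[OF g] .
    obtain U u v where u: "u \<in> Hom C U V" "u \<in> S" and v: "v \<in> Hom C U W" and uv: "f0 \<cdot> u = t \<cdot> v"
      using ore[OF f0 t] by metis
    have su: "s \<cdot> u \<in> Hom C U X" "s \<cdot> u \<in> S" using s u by (auto simp: Comp_N_iso Hom_def)
    have gv: "g0 \<cdot> v \<in> Hom C U Z" using Comp_in_Hom[OF v g0] .
    have "(g \<cdot>\<^bsub>Q\<^esub> f) \<cdot>\<^bsub>Q\<^esub> q (s \<cdot> u) = g \<cdot>\<^bsub>Q\<^esub> ((f \<cdot>\<^bsub>Q\<^esub> q s) \<cdot>\<^bsub>Q\<^esub> q u)"
      using f g q_Hom[OF s(1)] q_Hom[OF u(1)] by (simp add: q_Comp[OF u(1) s(1)] Hom_def)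
    also have "\<dots> = g \<cdot>\<^bsub>Q\<^esub> (q t \<cdot>\<^bsub>Q\<^esub> q v)"
      unfolding fs using q_Comp[OF u(1) f0] q_Comp[OF v t(1)] uv by simp
    also have "\<dots> = q (g0 \<cdot> v)"
      using Q.Comp_assoc[OF q_Hom[OF v] q_Hom[OF t(1)] g] gt q_Comp[OF v g0] by simp
    finally have e: "(g \<cdot>\<^bsub>Q\<^esub> f) \<cdot>\<^bsub>Q\<^esub> q (s \<cdot> u) = q (g0 \<cdot> v)" .
    note gf = Q.Comp_in_Hom[OF f g]
    note I = induced_functor_AMap(1)[OF f] induced_functor_AMap(1)[OF g] induced_functor_AMap(1)[OF gf]
    note FH = functor_Hom[OF F s(1)] functor_Hom[OF F t(1)] functor_Hom[OF F u(1)] functor_Hom[OF F v]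
    have "AMap IF (g \<cdot>\<^bsub>Q\<^esub> f) \<cdot>\<^bsub>D\<^esub> AMap F (s \<cdot> u) = AMap F g0 \<cdot>\<^bsub>D\<^esub> AMap F v"
      using induced_functor_AMap(2)[OF gf su gv e] functor_Comp[OF F v g0] by simp
    also have "\<dots> = AMap IF g \<cdot>\<^bsub>D\<^esub> AMap F (t \<cdot> v)"
      unfolding induced_functor_AMap(2)[OF g t g0 gt, symmetric] functor_Comp[OF F v t(1)]
      using D.Comp_assoc[OF FH(4,2) I(2)] by simp
    also have "\<dots> = AMap IF g \<cdot>\<^bsub>D\<^esub> ((AMap IF f \<cdot>\<^bsub>D\<^esub> AMap F s) \<cdot>\<^bsub>D\<^esub> AMap F u)"
      unfolding induced_functor_AMap(2)[OF f s f0 fs] uv[symmetric] functor_Comp[OF F u(1) f0] ..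
    also have "\<dots> = (AMap IF g \<cdot>\<^bsub>D\<^esub> AMap IF f) \<cdot>\<^bsub>D\<^esub> AMap F (s \<cdot> u)"
      using I FH by (simp add: functor_Comp[OF F u(1) s(1)] Hom_def)
    finally show ?thesis
      by (rule D.iso_cancel_right[OF inv[OF su(2)] functor_Hom[OF F su(1)] I(3)
          D.Comp_in_Hom[OF I(1,2)]])
  qed
qed

end

end


section \<open>Abelian categories\<close>

text \<open>\<open>abelian_category\<close> quantifies the sum and the zeros existentially. Here
  they are parameters, so that all lemmas speak of the same ones; \<open>abelian_categoryE\<close>
  supplies them.\<close>

locale abelian = category C for C :: "('o, 'a) cat" (structure) +
  fixes add :: "'a \<Rightarrow> 'a \<Rightarrow> 'a" and zero :: "'o \<Rightarrow> 'o \<Rightarrow> 'a"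
  assumes preadditive: "preadditive C add zero"
    and zero_object_ex: "\<exists>Z. zero_object C Z"
    and biproduct_ex: "X \<in> Obj C \<Longrightarrow> Y \<in> Obj C \<Longrightarrow> \<exists>B i j p r. is_biproduct C add zero X Y B i j p r"
    and kernel_ex: "f \<in> Arr C \<Longrightarrow> \<exists>k. is_kernel C k f"
    and cokernel_ex: "f \<in> Arr C \<Longrightarrow> \<exists>c. is_cokernel C c f"
    and mono_kernel: "is_mono C f \<Longrightarrow> \<exists>g. is_kernel C f g"
    and epi_cokernel: "is_epi C f \<Longrightarrow> \<exists>g. is_cokernel C f g"

lemma abelian_categoryE:
  assumes "abelian_category C"
  obtains add zero where "abelian C add zero"
proof -
  obtain add zero where "preadditive C add zero" "\<exists>Z. zero_object C Z"
    "\<forall>X \<in> Obj C. \<forall>Y \<in> Obj C. \<exists>B i j p r. is_biproduct C add zero X Y B i j p r"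
    using assms unfolding abelian_category_def by blast
  moreover from this have "category C" by (simp add: preadditive_def)
  ultimately have "abelian C add zero"
    using assms unfolding abelian_def abelian_axioms_def abelian_category_def by simp
  then show ?thesis using that by blast
qed

context abelian
begin

lemma Hom_group:
  "X \<in> Obj C \<Longrightarrow> Y \<in> Obj C \<Longrightarrow> comm_group \<lparr>carrier = Hom C X Y, mult = add, one = zero X Y\<rparr>"
  using preadditive unfolding preadditive_def by blast

text \<open>The same sum works in the opposite category, with injections and projections of a
  biproduct exchanged; \<open>zero\<close> takes its arguments in reverse since the Hom sets are
  reversed.\<close>

lemma abelian_op: "abelian (op_cat C) add (\<lambda>X Y. zero Y X)"
proof (unfold_locales, goal_cases)
  case 8
  have "category (op_cat C)" using category_op_cat category_axioms by blast
  moreover have "h \<cdot> add f g = add (h \<cdot> f) (h \<cdot> g) \<and> add f g \<cdot> k = add (f \<cdot> k) (g \<cdot> k)"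
    if "f \<in> Hom C X Y" "g \<in> Hom C X Y" "h \<in> Hom C Y Z" "k \<in> Hom C W X" for f g h k W X Y Z
    using preadditive that unfolding preadditive_def by blast
  ultimately show ?case using preadditive Hom_group unfolding preadditive_def by auto
next
  case (10 X Y)
  then obtain B i j p r where "is_biproduct C add zero X Y B i j p r" using biproduct_ex by fastforce
  then have "is_biproduct (op_cat C) add (\<lambda>X Y. zero Y X) X Y B p r i j"
    unfolding is_biproduct_def by simp
  then show ?case by blast
qed (auto simp: Dom_in_Obj Cod_in_Obj Idn_in_Hom Comp_in_Hom Comp_Idn Idn_Comp Comp_assoc
    zero_object_ex kernel_ex cokernel_ex mono_kernel epi_cokernel)

lemma add_Hom: "f \<in> Hom C X Y \<Longrightarrow> g \<in> Hom C X Y \<Longrightarrow> add f g \<in> Hom C X Y"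
  using comm_group.axioms(2)[OF Hom_group, THEN group.axioms(1), THEN monoid.m_closed, of X Y f g] Hom_Obj
  by auto

lemma zero_Hom: "X \<in> Obj C \<Longrightarrow> Y \<in> Obj C \<Longrightarrow> zero X Y \<in> Hom C X Y"
  using comm_group.axioms(2)[OF Hom_group, THEN group.axioms(1), THEN monoid.one_closed, of X Y]
  by simp

lemma zero_simps [simp]:
  assumes "X \<in> Obj C" and "Y \<in> Obj C"
  shows "zero X Y \<in> Arr C" and "Dom C (zero X Y) = X" and "Cod C (zero X Y) = Y"
  using zero_Hom[OF assms] by (auto simp: Hom_def)

lemma add_zero: "f \<in> Hom C X Y \<Longrightarrow> add f (zero X Y) = f" "f \<in> Hom C X Y \<Longrightarrow> add (zero X Y) f = f"
  using comm_group.axioms(2)[OF Hom_group, THEN group.axioms(1), THEN monoid.r_one, of X Y f]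
    comm_group.axioms(2)[OF Hom_group, THEN group.axioms(1), THEN monoid.l_one, of X Y f] Hom_Obj
  by auto

lemma add_right_cancel:
  assumes "f \<in> Hom C X Y" and "g \<in> Hom C X Y" and "h \<in> Hom C X Y" and "add f h = add g h"
  shows "f = g"
  using group.right_cancel[OF comm_group.axioms(2)[OF Hom_group], of X Y h f g] Hom_Obj[OF assms(1)]
    assms by auto

lemma Comp_add:
  "f \<in> Hom C X Y \<Longrightarrow> g \<in> Hom C X Y \<Longrightarrow> h \<in> Hom C Y Z \<Longrightarrow> h \<cdot> add f g = add (h \<cdot> f) (h \<cdot> g)"
  using preadditive unfolding preadditive_def by blast

lemma add_Comp:
  "f \<in> Hom C Y Z \<Longrightarrow> g \<in> Hom C Y Z \<Longrightarrow> h \<in> Hom C X Y \<Longrightarrow> add f g \<cdot> h = add (f \<cdot> h) (g \<cdot> h)"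
  using preadditive unfolding preadditive_def by blast

lemma Comp_zero:
  assumes f: "f \<in> Hom C X Y" and W: "W \<in> Obj C"
  shows "f \<cdot> zero W X = zero W Y"
proof -
  have O: "X \<in> Obj C" "Y \<in> Obj C" using Hom_Obj[OF f] by auto
  note z = zero_Hom[OF W O(1)]
  note fz = Comp_in_Hom[OF z f]
  have "add (f \<cdot> zero W X) (f \<cdot> zero W X) = add (zero W Y) (f \<cdot> zero W X)"
    using Comp_add[OF z z f] by (simp add: add_zero[OF z] add_zero[OF fz])
  then show ?thesis by (rule add_right_cancel[OF fz zero_Hom[OF W O(2)] fz])
qed

lemma zero_Comp: "f \<in> Hom C X Y \<Longrightarrow> Z \<in> Obj C \<Longrightarrow> zero Y Z \<cdot> f = zero X Z"
  using abelian.Comp_zero[OF abelian_op, of f Y X Z] by simp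

lemma Comp_zero_Arr [simp]: "f \<in> Arr C \<Longrightarrow> Dom C f = X \<Longrightarrow> W \<in> Obj C \<Longrightarrow> f \<cdot> zero W X = zero W (Cod C f)"
  using Comp_zero[of f X "Cod C f"] by (simp add: Hom_def)

lemma zero_Comp_Arr [simp]: "f \<in> Arr C \<Longrightarrow> Cod C f = Y \<Longrightarrow> Z \<in> Obj C \<Longrightarrow> zero Y Z \<cdot> f = zero (Dom C f) Z"
  using zero_Comp[of f "Dom C f" Y] by (simp add: Hom_def)

lemma zero_object_Hom_unique:
  "zero_object C Z \<Longrightarrow> f \<in> Hom C X Z \<Longrightarrow> f = zero X Z"
  "zero_object C Z \<Longrightarrow> g \<in> Hom C Z X \<Longrightarrow> g = zero Z X"
  using zero_Hom[of X Z] zero_Hom[of Z X] Hom_Obj unfolding zero_object_def by metis+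

text \<open>Kernels are defined by arrows through a zero object, while calculations use the neutral
  elements of the Hom groups. This is the bridge between the two.\<close>

lemma zero_arrow_iff: 
  assumes f: "f \<in> Hom C X Y"
  shows "zero_arrow C f \<longleftrightarrow> f = zero X Y"
proof -
  have O: "X \<in> Obj C" "Y \<in> Obj C" using Hom_Obj[OF f] by auto
  have D: "Dom C f = X" "Cod C f = Y" using f by (auto simp: Hom_def)
  show ?thesis
  proof
    assume "zero_arrow C f"
    then obtain Z g h where Z: "zero_object C Z" and g: "g \<in> Hom C X Z" and h: "h \<in> Hom C Z Y"
      and "f = h \<cdot> g" unfolding zero_arrow_def D by blast
    then show "f = zero X Y" using zero_object_Hom_unique(1)[OF Z g] Comp_zero[OF h O(1)] by simp
  next
    assume f0: "f = zero X Y"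
    obtain Z where Z: "zero_object C Z" using zero_object_ex by blast
    then have ZO: "Z \<in> Obj C" by (simp add: zero_object_def)
    have "f = zero Z Y \<cdot> zero X Z" using f0 Comp_zero[OF zero_Hom[OF ZO O(2)] O(1)] by simp
    then show "zero_arrow C f"
      unfolding zero_arrow_def D using Z zero_Hom[OF ZO O(2)] zero_Hom[OF O(1) ZO] by blast
  qed
qed

text \<open>Parallel arrows are compared through a difference, so that no negation is needed.\<close>

lemma differenceE:
  assumes f: "f \<in> Hom C X Y" and g: "g \<in> Hom C X Y"
  obtains d where "d \<in> Hom C X Y" and "add d g = f"
    and "\<And>h Z. h \<in> Hom C Y Z \<Longrightarrow> h \<cdot> d = zero X Z \<longleftrightarrow> h \<cdot> f = h \<cdot> g"
    and "\<And>h W. h \<in> Hom C W X \<Longrightarrow> d \<cdot> h = zero W Y \<longleftrightarrow> f \<cdot> h = g \<cdot> h"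
proof -
  have O: "X \<in> Obj C" "Y \<in> Obj C" using Hom_Obj[OF f] by auto
  let ?G = "\<lparr>carrier = Hom C X Y, mult = add, one = zero X Y\<rparr>"
  interpret G: comm_group ?G using Hom_group[OF O] .
  define d where "d = add f (inv\<^bsub>?G\<^esub> g)"
  have g': "inv\<^bsub>?G\<^esub> g \<in> Hom C X Y" using G.inv_closed[of g] g by simp
  have d: "d \<in> Hom C X Y" unfolding d_def using add_Hom[OF f g'] .
  have df: "add d g = f"
    using G.m_assoc[of f "inv\<^bsub>?G\<^esub> g" g] f g g' G.l_inv[of g] add_zero[OF f] by (simp add: d_def)
  have "h \<cdot> d = zero X Z \<longleftrightarrow> h \<cdot> f = h \<cdot> g" if h: "h \<in> Hom C Y Z" for h Z
  proof -
    have Z: "Z \<in> Obj C" using Hom_Obj[OF h] by simp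
    note H = Comp_in_Hom[OF d h] Comp_in_Hom[OF g h] zero_Hom[OF O(1) Z]
    have "h \<cdot> f = add (h \<cdot> d) (h \<cdot> g)" using Comp_add[OF d g h] df by simp
    then show ?thesis using add_zero[OF H(2)] add_right_cancel[OF H(1,3,2)] by metis
  qed
  moreover have "d \<cdot> h = zero W Y \<longleftrightarrow> f \<cdot> h = g \<cdot> h" if h: "h \<in> Hom C W X" for h W
  proof -
    have W: "W \<in> Obj C" using Hom_Obj[OF h] by simp
    note H = Comp_in_Hom[OF h d] Comp_in_Hom[OF h g] zero_Hom[OF W O(2)]
    have "f \<cdot> h = add (d \<cdot> h) (g \<cdot> h)" using add_Comp[OF d g h] df by simp
    then show ?thesis using add_zero[OF H(2)] add_right_cancel[OF H(1,3,2)] by metis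
  qed
  ultimately show ?thesis using that d df by blast
qed

lemma monoI:
  assumes m: "m \<in> Hom C X Y" and 0: "\<And>W g. g \<in> Hom C W X \<Longrightarrow> m \<cdot> g = zero W Y \<Longrightarrow> g = zero W X"
  shows "is_mono C m"
  unfolding is_mono_def
proof (intro conjI allI ballI impI)
  show "m \<in> Arr C" using m by (simp add: Hom_def)
  fix W g h assume "g \<in> Hom C W (Dom C m)" "h \<in> Hom C W (Dom C m)" and eq: "m \<cdot> g = m \<cdot> h"
  then have g: "g \<in> Hom C W X" and h: "h \<in> Hom C W X" using m by (auto simp: Hom_def)
  obtain d where d: "d \<in> Hom C W X" "add d h = g"
    "\<And>k Z. k \<in> Hom C X Z \<Longrightarrow> k \<cdot> d = zero W Z \<longleftrightarrow> k \<cdot> g = k \<cdot> h"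
    using differenceE[OF g h] by metis
  have "d = zero W X" using 0[OF d(1)] d(3)[OF m] eq by simp
  then show "g = h" using d(2) add_zero[OF h] by simp
qed

lemma epiI:
  assumes "e \<in> Hom C X Y" and "\<And>Z g. g \<in> Hom C Y Z \<Longrightarrow> g \<cdot> e = zero X Z \<Longrightarrow> g = zero Y Z"
  shows "is_epi C e"
  using abelian.monoI[OF abelian_op, of e Y X] assms by simp

lemma mono_zeroD:
  assumes "is_mono C m" and m: "m \<in> Hom C X Y" and g: "g \<in> Hom C W X" and "m \<cdot> g = zero W Y"
  shows "g = zero W X"
  using monoD[OF assms(1) m g, of "zero W X"] Hom_Obj[OF m] Hom_Obj[OF g] Comp_zero[OF m] assms(4)
  by (simp add: zero_Hom)

lemma epi_zeroD:
  assumes "is_epi C e" and "e \<in> Hom C X Y" and "g \<in> Hom C Y Z" and "g \<cdot> e = zero X Z"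
  shows "g = zero Y Z"
  using abelian.mono_zeroD[OF abelian_op, of e Y X g Z] assms by simp

lemma Idn_mono: "X \<in> Obj C \<Longrightarrow> is_mono C (Idn C X)"
  by (auto simp: is_mono_def Idn_Comp)

lemma mono_Comp:
  assumes "is_mono C m" and m: "m \<in> Hom C X Y" and "is_mono C n" and n: "n \<in> Hom C Y Z"
  shows "is_mono C (n \<cdot> m)"
proof (rule monoI[OF Comp_in_Hom[OF m n]])
  fix W g assume g: "g \<in> Hom C W X" and "(n \<cdot> m) \<cdot> g = zero W Z"
  then have "n \<cdot> (m \<cdot> g) = zero W Z" using Comp_assoc[OF g m n] by simp
  then show "g = zero W X"
    using mono_zeroD[OF assms(3) n Comp_in_Hom[OF g m]] mono_zeroD[OF assms(1) m g] by simp
qed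

lemma epi_Comp:
  assumes "is_epi C e" and "e \<in> Hom C X Y" and "is_epi C d" and "d \<in> Hom C Y Z"
  shows "is_epi C (d \<cdot> e)"
  using abelian.mono_Comp[OF abelian_op, of d Z Y e X] assms by simp

lemma mono_of_Comp:
  assumes "is_mono C (n \<cdot> m)" and m: "m \<in> Hom C X Y" and n: "n \<in> Hom C Y Z"
  shows "is_mono C m"
proof (rule monoI[OF m])
  fix W g assume g: "g \<in> Hom C W X" and "m \<cdot> g = zero W Y"
  then have "(n \<cdot> m) \<cdot> g = zero W Z"
    using Comp_assoc[OF g m n] Comp_zero[OF n] Hom_Obj[OF g] by simp
  then show "g = zero W X" using mono_zeroD[OF assms(1) Comp_in_Hom[OF m n] g] by simp
qed

lemma epi_of_Comp:
  assumes "is_epi C (d \<cdot> e)" and "e \<in> Hom C X Y" and "d \<in> Hom C Y Z"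
  shows "is_epi C d"
  using abelian.mono_of_Comp[OF abelian_op, of e d Z Y X] assms by simp


subsection \<open>Kernels and cokernels\<close>

lemma kernelI:
  assumes k: "k \<in> Hom C K X" and f: "f \<in> Hom C X Y" and mono: "is_mono C k" and 0: "f \<cdot> k = zero K Y"
    and factor: "\<And>W h. h \<in> Hom C W X \<Longrightarrow> f \<cdot> h = zero W Y \<Longrightarrow> \<exists>u \<in> Hom C W K. k \<cdot> u = h"
  shows "is_kernel C k f"
  unfolding is_kernel_def
proof (intro conjI allI ballI impI)
  have D: "Dom C f = X" "Cod C f = Y" "Dom C k = K" using f k by (auto simp: Hom_def)
  show "f \<in> Arr C" "k \<in> Arr C" "Cod C k = Dom C f" using k f by (auto simp: Hom_def)
  show "zero_arrow C (f \<cdot> k)" using 0 zero_arrow_iff[OF Comp_in_Hom[OF k f]] by simp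
  fix W h assume h: "h \<in> Hom C W (Dom C f)" and "zero_arrow C (f \<cdot> h)"
  then have "f \<cdot> h = zero W Y" using zero_arrow_iff[OF Comp_in_Hom[OF _ f]] D by simp
  then obtain u where "u \<in> Hom C W K" "k \<cdot> u = h" using factor h D by metis
  then show "\<exists>!u. u \<in> Hom C W (Dom C k) \<and> k \<cdot> u = h"
    unfolding D using monoD[OF mono k] by blast
qed

lemma kernelD:
  assumes "is_kernel C k f" and f: "f \<in> Hom C X Y"
  shows "k \<in> Hom C (Dom C k) X" and "f \<cdot> k = zero (Dom C k) Y" and "is_mono C k"
proof -
  have D: "Dom C f = X" "Cod C f = Y" using f by (auto simp: Hom_def)
  show k: "k \<in> Hom C (Dom C k) X" using assms D by (auto simp: is_kernel_def Hom_def)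
  show fk: "f \<cdot> k = zero (Dom C k) Y"
    using zero_arrow_iff[OF Comp_in_Hom[OF k f]] assms(1) by (simp add: is_kernel_def)
  show "is_mono C k"
  proof (rule monoI[OF k])
    fix W g assume g: "g \<in> Hom C W (Dom C k)" and 0: "k \<cdot> g = zero W X"
    have O: "W \<in> Obj C" "Dom C k \<in> Obj C" "X \<in> Obj C" "Y \<in> Obj C"
      using Hom_Obj[OF g] Hom_Obj[OF f] by auto
    have "zero_arrow C (f \<cdot> zero W X)"
      using zero_arrow_iff[OF Comp_in_Hom[OF zero_Hom f]] Comp_zero[OF f] O by simp
    then have "\<exists>!u. u \<in> Hom C W (Dom C k) \<and> k \<cdot> u = zero W X"
      using assms(1) zero_Hom[of W X] O D unfolding is_kernel_def by simp
    then show "g = zero W (Dom C k)" using g 0 zero_Hom[of W "Dom C k"] O Comp_zero[OF k] by blast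
  qed
qed

lemma cokernelD:
  assumes "is_cokernel C c f" and "f \<in> Hom C X Y"
  shows "c \<in> Hom C Y (Cod C c)" and "c \<cdot> f = zero X (Cod C c)" and "is_epi C c"
  using abelian.kernelD[OF abelian_op, of c f Y X] assms by auto

lemma kernel_factor:
  assumes k: "is_kernel C k f" and f: "f \<in> Hom C X Y" and h: "h \<in> Hom C W X" and "f \<cdot> h = zero W Y"
  obtains u where "u \<in> Hom C W (Dom C k)" and "k \<cdot> u = h"
proof -
  have "Dom C f = X" using f by (auto simp: Hom_def)
  moreover have "zero_arrow C (f \<cdot> h)" using assms(4) zero_arrow_iff[OF Comp_in_Hom[OF h f]] by simp
  ultimately show ?thesis using k h that unfolding is_kernel_def by blast
qed

lemma cokernel_factor:
  assumes "is_cokernel C c f" and "f \<in> Hom C X Y" and "h \<in> Hom C Y Z" and "h \<cdot> f = zero X Z"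
  obtains u where "u \<in> Hom C (Cod C c) Z" and "u \<cdot> c = h"
  using abelian.kernel_factor[OF abelian_op, of c f Y X h Z] assms by auto

lemma kernelE:
  assumes f: "f \<in> Hom C X Y"
  obtains K k where "is_kernel C k f" and "k \<in> Hom C K X" and "f \<cdot> k = zero K Y" and "is_mono C k"
  using kernel_ex[of f] kernelD[OF _ f] f by (auto simp: Hom_def)

lemma cokernelE:
  assumes f: "f \<in> Hom C X Y"
  obtains Q c where "is_cokernel C c f" and "c \<in> Hom C Y Q" and "c \<cdot> f = zero X Q" and "is_epi C c"
  using cokernel_ex[of f] cokernelD[OF _ f] f by (auto simp: Hom_def)

text \<open>Composing with a mono does not change which arrows are annihilated.\<close>

lemma kernel_mono_Comp:
  assumes m: "is_mono C m" "m \<in> Hom C Y Z" and e: "e \<in> Hom C X Y"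
  shows "is_kernel C k (m \<cdot> e) \<longleftrightarrow> is_kernel C k e"
proof -
  note me = Comp_in_Hom[OF e m(2)]
  have 0: "(m \<cdot> e) \<cdot> h = zero W Z \<longleftrightarrow> e \<cdot> h = zero W Y" if h: "h \<in> Hom C W X" for h W
  proof -
    have W: "W \<in> Obj C" using Hom_Obj[OF h] by simp
    show ?thesis
      using mono_zeroD[OF m Comp_in_Hom[OF h e]] Comp_assoc[OF h e m(2)] Comp_zero[OF m(2) W] by auto
  qed
  show ?thesis
  proof
    assume k: "is_kernel C k (m \<cdot> e)"
    note kD = kernelD[OF k me]
    show "is_kernel C k e"
      using 0[OF kD(1)] kD(2) 0 kernel_factor[OF k me]
      by (intro kernelI[OF kD(1) e kD(3)]) metis+
  next
    assume k: "is_kernel C k e"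
    note kD = kernelD[OF k e]
    show "is_kernel C k (m \<cdot> e)"
      using 0[OF kD(1)] kD(2) 0 kernel_factor[OF k e]
      by (intro kernelI[OF kD(1) me kD(3)]) metis+
  qed
qed

lemma cokernel_Comp_epi:
  assumes "is_epi C e" and "e \<in> Hom C X Y" and "m \<in> Hom C Y Z"
  shows "is_cokernel C c (m \<cdot> e) \<longleftrightarrow> is_cokernel C c m"
  using abelian.kernel_mono_Comp[OF abelian_op, of e Y X m Z c] assms by simp

text \<open>The axiom gives \<open>m\<close> as the kernel of some \<open>g\<close>. As
  \<open>g\<close> kills \<open>m\<close> it factors through the cokernel \<open>c\<close>, so
  whatever \<open>c\<close> kills is killed by \<open>g\<close> and factors through
  \<open>m\<close>.\<close>

lemma mono_is_kernel:
  assumes mono: "is_mono C m" and m: "m \<in> Hom C X Y" and c: "is_cokernel C c m"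
  shows "is_kernel C m c"
proof -
  note cD = cokernelD[OF c m]
  obtain g where g: "is_kernel C m g" using mono_kernel[OF mono] by blast
  then have "g \<in> Arr C" "Dom C g = Y" using m by (auto simp: is_kernel_def Hom_def)
  then obtain Z where gZ: "g \<in> Hom C Y Z" by (auto simp: Hom_def)
  have Dm: "Dom C m = X" using m by (simp add: Hom_def)
  have "g \<cdot> m = zero X Z" using kernelD(2)[OF g gZ] Dm by simp
  then obtain u where u: "u \<in> Hom C (Cod C c) Z" "u \<cdot> c = g" using cokernel_factor[OF c m gZ] by metis
  show ?thesis
  proof (rule kernelI[OF m cD(1) mono cD(2)])
    fix W h assume h: "h \<in> Hom C W Y" and ch: "c \<cdot> h = zero W (Cod C c)"
    have "g \<cdot> h = u \<cdot> (c \<cdot> h)" using Comp_assoc[OF h cD(1) u(1)] u(2) by simp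
    also have "\<dots> = zero W Z" using ch Comp_zero[OF u(1)] Hom_Obj[OF h] by simp
    finally show "\<exists>u \<in> Hom C W X. m \<cdot> u = h" using kernel_factor[OF g gZ h] Dm by metis
  qed
qed

lemma epi_is_cokernel:
  assumes "is_epi C e" and "e \<in> Hom C X Y" and "is_kernel C k e"
  shows "is_cokernel C e k"
  using abelian.mono_is_kernel[OF abelian_op, of e Y X k] assms by simp

text \<open>The coimage is the image. If \<open>m \<cdot> x\<close> vanishes, \<open>m\<close>
  factors through the cokernel \<open>p\<close> of \<open>x\<close>. The epi
  \<open>p \<cdot> e\<close> is the cokernel of its kernel \<open>h\<close>, and \<open>h\<close> is
  killed by \<open>f\<close>, hence factors through \<open>k\<close> and is killed by
  \<open>e\<close>. So \<open>e\<close> factors through \<open>p \<cdot> e\<close>, which splits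
  \<open>p\<close> and forces \<open>x\<close> to vanish.\<close>

lemma epi_mono_factorisation:
  assumes f: "f \<in> Hom C X Y" and k: "is_kernel C k f" and e: "is_cokernel C e k"
  obtains m where "m \<in> Hom C (Cod C e) Y" and "is_mono C m" and "m \<cdot> e = f"
proof -
  note kD = kernelD[OF k f]
  note eD = cokernelD[OF e kD(1)]
  define I where "I = Cod C e"
  note eD = eD[folded I_def]
  obtain m where m: "m \<in> Hom C I Y" "m \<cdot> e = f" using cokernel_factor[OF e kD(1) f kD(2)] I_def by metis
  have "is_mono C m"
  proof (rule monoI[OF m(1)])
    fix W x assume x: "x \<in> Hom C W I" and mx: "m \<cdot> x = zero W Y"
    have WO: "W \<in> Obj C" using Hom_Obj[OF x] by simp
    obtain Q p where p: "is_cokernel C p x" "p \<in> Hom C I Q" "p \<cdot> x = zero W Q" "is_epi C p"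
      using cokernelE[OF x] .
    obtain m' where m': "m' \<in> Hom C Q Y" "m' \<cdot> p = m"
      using cokernel_factor[OF p(1) x m(1) mx] p(2) by (auto simp: Hom_def)
    note pe = Comp_in_Hom[OF eD(1) p(2)]
    obtain H h where h: "is_kernel C h (p \<cdot> e)" "h \<in> Hom C H X" "(p \<cdot> e) \<cdot> h = zero H Q"
      using kernelE[OF pe] by metis
    have HO: "H \<in> Obj C" using Hom_Obj[OF h(2)] by simp
    have c: "is_cokernel C (p \<cdot> e) h" using epi_is_cokernel[OF epi_Comp[OF eD(3,1) p(4,2)] pe h(1)] .
    have "f \<cdot> h = m' \<cdot> ((p \<cdot> e) \<cdot> h)"
      using m(2)[symmetric] m'(2)[symmetric] m'(1) p(2) eD(1) h(2) by (simp add: Hom_def)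
    then have "f \<cdot> h = zero H Y" using h(3) Comp_zero[OF m'(1) HO] by simp
    then obtain h' where h': "h' \<in> Hom C H (Dom C k)" "k \<cdot> h' = h" using kernel_factor[OF k f h(2)] by metis
    have "e \<cdot> h = zero (Dom C k) I \<cdot> h'" using h' Comp_assoc[OF h'(1) kD(1) eD(1)] eD(2) by simp
    then have "e \<cdot> h = zero H I" using zero_Comp[OF h'(1)] Hom_Obj[OF x] by simp
    then obtain y where y: "y \<in> Hom C Q I" "y \<cdot> (p \<cdot> e) = e"
      using cokernel_factor[OF c h(2) eD(1)] pe by (auto simp: Hom_def)
    have IO: "I \<in> Obj C" using Hom_Obj[OF x] by simp
    have "y \<cdot> p = Idn C I"
      using epiD[OF eD(3,1) Comp_in_Hom[OF p(2) y(1)] Idn_in_Hom[OF IO]]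
        y Comp_assoc[OF eD(1) p(2) y(1)] Idn_Comp[OF eD(1)] by simp
    then have "x = y \<cdot> (p \<cdot> x)" using Comp_assoc[OF x p(2) y(1)] Idn_Comp[OF x] by simp
    then show "x = zero W I" using p(3) Comp_zero[OF y(1) WO] by simp
  qed
  then show ?thesis using that m by (simp add: I_def)
qed

lemma imageE:
  assumes f: "f \<in> Hom C X Y"
  obtains I e m where "e \<in> Hom C X I" and "is_epi C e" and "m \<in> Hom C I Y" and "is_mono C m"
    and "f = m \<cdot> e"
proof -
  obtain K k where k: "is_kernel C k f" "k \<in> Hom C K X" using kernelE[OF f] by metis
  obtain I e where e: "is_cokernel C e k" "e \<in> Hom C X I" "is_epi C e" using cokernelE[OF k(2)] by metis
  have "Cod C e = I" using e by (simp add: Hom_def)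
  then show ?thesis using epi_mono_factorisation[OF f k(1) e(1)] that e(2,3) by metis
qed



lemma biproductE:
  assumes "X \<in> Obj C" and "Y \<in> Obj C"
  obtains B i j p r where "i \<in> Hom C X B" and "j \<in> Hom C Y B" and "p \<in> Hom C B X" and "r \<in> Hom C B Y"
    and "p \<cdot> i = Idn C X" and "r \<cdot> j = Idn C Y" and "p \<cdot> j = zero Y X" and "r \<cdot> i = zero X Y"
    and "add (i \<cdot> p) (j \<cdot> r) = Idn C B"
  using biproduct_ex[OF assms] unfolding is_biproduct_def by blast

lemma biproduct_Hom_eq:
  assumes i: "i \<in> Hom C X B" and j: "j \<in> Hom C Y B" and p: "p \<in> Hom C B X" and r: "r \<in> Hom C B Y"
    and sum: "add (i \<cdot> p) (j \<cdot> r) = Idn C B"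
    and x: "x \<in> Hom C W B" and y: "y \<in> Hom C W B" and px: "p \<cdot> x = p \<cdot> y" and rx: "r \<cdot> x = r \<cdot> y"
  shows "x = y"
proof -
  have *: "z = add (i \<cdot> (p \<cdot> z)) (j \<cdot> (r \<cdot> z))" if z: "z \<in> Hom C W B" for z
    using add_Comp[OF Comp_in_Hom[OF p i] Comp_in_Hom[OF r j] z] sum Idn_Comp[OF z]
      Comp_assoc[OF z p i] Comp_assoc[OF z r j] by simp
  show ?thesis using *[OF x] *[OF y] px rx by simp
qed

lemma biproduct_pair:
  assumes i: "i \<in> Hom C X B" and j: "j \<in> Hom C Y B" and p: "p \<in> Hom C B X" and r: "r \<in> Hom C B Y"
    and "p \<cdot> i = Idn C X" and "r \<cdot> j = Idn C Y" and "p \<cdot> j = zero Y X" and "r \<cdot> i = zero X Y"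
    and a: "a \<in> Hom C W X" and b: "b \<in> Hom C W Y"
  shows "add (i \<cdot> a) (j \<cdot> b) \<in> Hom C W B" and "p \<cdot> add (i \<cdot> a) (j \<cdot> b) = a"
    and "r \<cdot> add (i \<cdot> a) (j \<cdot> b) = b"
proof -
  note ia = Comp_in_Hom[OF a i] and jb = Comp_in_Hom[OF b j]
  show "add (i \<cdot> a) (j \<cdot> b) \<in> Hom C W B" using add_Hom[OF ia jb] .
  have O: "X \<in> Obj C" "Y \<in> Obj C" using Hom_Obj[OF a] Hom_Obj[OF b] by auto
  have 1: "p \<cdot> (i \<cdot> a) = a" "r \<cdot> (j \<cdot> b) = b"
    using Comp_assoc[OF a i p] Comp_assoc[OF b j r] Idn_Comp a b assms(5,6) by auto
  have 2: "p \<cdot> (j \<cdot> b) = zero W X" "r \<cdot> (i \<cdot> a) = zero W Y"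
    using Comp_assoc[OF b j p] Comp_assoc[OF a i r] zero_Comp a b assms(7,8) O by auto
  show "p \<cdot> add (i \<cdot> a) (j \<cdot> b) = a" "r \<cdot> add (i \<cdot> a) (j \<cdot> b) = b"
    using Comp_add[OF ia jb p] Comp_add[OF ia jb r] add_zero[OF a] add_zero[OF b] 1 2 by auto
qed

end

definition is_pullback :: "('o, 'a) cat \<Rightarrow> 'a \<Rightarrow> 'a \<Rightarrow> 'a \<Rightarrow> 'a \<Rightarrow> bool" where
  "is_pullback C f g u v \<longleftrightarrow> f \<in> Arr C \<and> g \<in> Arr C \<and> Cod C f = Cod C g \<and>
    u \<in> Arr C \<and> v \<in> Hom C (Dom C u) (Dom C g) \<and> Cod C u = Dom C f \<and> f \<cdot>\<^bsub>C\<^esub> u = g \<cdot>\<^bsub>C\<^esub> v \<and>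
    (\<forall>W. \<forall>a \<in> Hom C W (Dom C f). \<forall>b \<in> Hom C W (Dom C g). f \<cdot>\<^bsub>C\<^esub> a = g \<cdot>\<^bsub>C\<^esub> b \<longrightarrow>
      (\<exists>!w. w \<in> Hom C W (Dom C u) \<and> u \<cdot>\<^bsub>C\<^esub> w = a \<and> v \<cdot>\<^bsub>C\<^esub> w = b))"

context category
begin

lemma is_pullbackI:
  assumes "f \<in> Hom C X Y" and "g \<in> Hom C Z Y" and "u \<in> Hom C P X" and "v \<in> Hom C P Z"
    and "f \<cdot> u = g \<cdot> v"
    and "\<And>W a b. a \<in> Hom C W X \<Longrightarrow> b \<in> Hom C W Z \<Longrightarrow> f \<cdot> a = g \<cdot> b \<Longrightarrow>
      \<exists>w \<in> Hom C W P. u \<cdot> w = a \<and> v \<cdot> w = b"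
    and "\<And>W w w'. w \<in> Hom C W P \<Longrightarrow> w' \<in> Hom C W P \<Longrightarrow> u \<cdot> w = u \<cdot> w' \<Longrightarrow>
      v \<cdot> w = v \<cdot> w' \<Longrightarrow> w = w'"
  shows "is_pullback C f g u v"
proof -
  have D: "Dom C f = X" "Dom C g = Z" "Dom C u = P" using assms(1-3) by (auto simp: Hom_def)
  have "\<exists>!w. w \<in> Hom C W P \<and> u \<cdot> w = a \<and> v \<cdot> w = b"
    if "a \<in> Hom C W X" "b \<in> Hom C W Z" "f \<cdot> a = g \<cdot> b" for W a b
    using assms(6)[OF that] assms(7) by metis
  then show ?thesis using assms(1-5) unfolding is_pullback_def D by (auto simp: Hom_def)
qed

lemma is_pullbackD:
  assumes "is_pullback C f g u v" and "f \<in> Hom C X Y" and "g \<in> Hom C Z Y"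
  shows "u \<in> Hom C (Dom C u) X" and "v \<in> Hom C (Dom C u) Z" and "f \<cdot> u = g \<cdot> v"
    and "a \<in> Hom C W X \<Longrightarrow> b \<in> Hom C W Z \<Longrightarrow> f \<cdot> a = g \<cdot> b \<Longrightarrow>
      \<exists>w \<in> Hom C W (Dom C u). u \<cdot> w = a \<and> v \<cdot> w = b"
proof -
  have D: "Dom C f = X" "Dom C g = Z" using assms by (auto simp: Hom_def)
  show "u \<in> Hom C (Dom C u) X" and "v \<in> Hom C (Dom C u) Z" and "f \<cdot> u = g \<cdot> v"
    using assms(1) unfolding is_pullback_def D by (auto simp: Hom_def)
  show "\<exists>w \<in> Hom C W (Dom C u). u \<cdot> w = a \<and> v \<cdot> w = b"
    if "a \<in> Hom C W X" "b \<in> Hom C W Z" "f \<cdot> a = g \<cdot> b"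
    using assms(1) that unfolding is_pullback_def D by blast
qed

lemma pullback_Hom_eq:
  assumes pb: "is_pullback C f g u v" and f: "f \<in> Hom C X Y" and g: "g \<in> Hom C Z Y"
    and w: "w \<in> Hom C W (Dom C u)" and w': "w' \<in> Hom C W (Dom C u)"
    and "u \<cdot> w = u \<cdot> w'" and "v \<cdot> w = v \<cdot> w'"
  shows "w = w'"
proof -
  note P = is_pullbackD[OF pb f g]
  have D: "Dom C f = X" "Dom C g = Z" using f g by (auto simp: Hom_def)
  have "f \<cdot> (u \<cdot> w) = g \<cdot> (v \<cdot> w)"
    using Comp_assoc[OF w P(1) f] Comp_assoc[OF w P(2) g] P(3) by simp
  then have "\<exists>!x. x \<in> Hom C W (Dom C u) \<and> u \<cdot> x = u \<cdot> w \<and> v \<cdot> x = v \<cdot> w"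
    using pb Comp_in_Hom[OF w P(1)] Comp_in_Hom[OF w P(2)] unfolding is_pullback_def D by blast
  then show ?thesis using w w' assms(6,7) by metis
qed

end


section \<open>Arrows inverted by a Serre subcategory\<close>

locale serre = abelian C add zero for C :: "('o, 'a) cat" (structure) and add zero +
  fixes N :: "'o set"
  assumes serre_N: "serre_subcategory C N"
begin

lemma serre_op: "serre (op_cat C) add (\<lambda>X Y. zero Y X) N"
  using abelian_op serre_subcategory_op_cat[OF serre_N] by (simp add: serre_def serre_axioms_def)

section \<open>Objects of the Serre subcategory and composition of inverted arrows\<close>

lemma N_subobject: "is_mono C m \<Longrightarrow> m \<in> Hom C X Y \<Longrightarrow> Y \<in> N \<Longrightarrow> X \<in> N"
  using serre_N unfolding serre_subcategory_def Hom_def by blast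

lemma N_quotient: "is_epi C e \<Longrightarrow> e \<in> Hom C X Y \<Longrightarrow> X \<in> N \<Longrightarrow> Y \<in> N"
  using serre_N unfolding serre_subcategory_def Hom_def by blast

lemma N_extension:
  "short_exact C i p \<Longrightarrow> i \<in> Hom C X Y \<Longrightarrow> p \<in> Hom C Y Z \<Longrightarrow> X \<in> N \<Longrightarrow> Z \<in> N \<Longrightarrow> Y \<in> N"
  using serre_N unfolding serre_subcategory_def Hom_def by blast

lemma zero_object_mono:
  assumes Z: "zero_object C Z" and X: "X \<in> Obj C"
  shows "is_mono C (zero Z X)"
proof (rule monoI[OF zero_Hom[OF _ X]])
  show "Z \<in> Obj C" using Z by (simp add: zero_object_def)
qed (use zero_object_Hom_unique(1)[OF Z] in blast)

lemma N_zero_object: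
  assumes Z: "zero_object C Z"
  shows "Z \<in> N"
proof -
  obtain X where X: "X \<in> N" "X \<in> Obj C" using serre_N unfolding serre_subcategory_def by blast
  have "Z \<in> Obj C" using Z by (simp add: zero_object_def)
  then show ?thesis using N_subobject[OF zero_object_mono[OF Z X(2)] zero_Hom[OF _ X(2)] X(1)] by simp
qed

text \<open>\<open>N_iso\<close> provides one kernel in \<open>N\<close>. Any other kernel maps to
  it by a mono, so closure under subobjects does the work of invariance under isomorphism.\<close>

lemma N_iso_kernel:
  assumes s: "s \<in> N_iso C N" and k: "is_kernel C k s"
  shows "Dom C k \<in> N"
proof -
  obtain X Y where sX: "s \<in> Hom C X Y" using N_iso_Arr[OF s] by (auto simp: Hom_def)
  obtain k' where k': "is_kernel C k' s" "Dom C k' \<in> N" using s by (auto simp: N_iso_def)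
  note kD = kernelD[OF k sX] and kD' = kernelD[OF k'(1) sX]
  obtain u where u: "u \<in> Hom C (Dom C k) (Dom C k')" "k' \<cdot> u = k"
    using kernel_factor[OF k'(1) sX kD(1,2)] .
  have "is_mono C u" using mono_of_Comp[OF _ u(1) kD'(1)] u(2) kD(3) by simp
  then show ?thesis using N_subobject u(1) k'(2) by blast
qed

lemma N_iso_cokernel: "s \<in> N_iso C N \<Longrightarrow> is_cokernel C c s \<Longrightarrow> Cod C c \<in> N"
  using serre.N_iso_kernel[OF serre_op, of s c] by simp

lemma mono_kernel_N:
  assumes m: "is_mono C m" "m \<in> Hom C X Y"
  obtains k where "is_kernel C k m" and "Dom C k \<in> N"
proof -
  obtain Z where Z: "zero_object C Z" using zero_object_ex by blast
  then have ZO: "Z \<in> Obj C" by (simp add: zero_object_def)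
  have XO: "X \<in> Obj C" using Hom_Obj[OF m(2)] by simp
  note z = zero_Hom[OF ZO XO]
  have "is_kernel C (zero Z X) m"
  proof (rule kernelI[OF z m(2) zero_object_mono[OF Z XO] Comp_zero[OF m(2) ZO]])
    fix W h assume h: "h \<in> Hom C W X" and "m \<cdot> h = zero W Y"
    then have "h = zero W X" using mono_zeroD[OF m] by blast
    then show "\<exists>u \<in> Hom C W Z. zero Z X \<cdot> u = h"
      using zero_Hom[of W Z] Comp_zero[OF z, of W] Hom_Obj[OF h] ZO by blast
  qed
  moreover have "Dom C (zero Z X) \<in> N" using ZO XO N_zero_object[OF Z] by simp
  ultimately show ?thesis using that by blast
qed

lemma N_iso_mono:
  assumes "is_mono C m" and m: "m \<in> Hom C X Y" and "is_cokernel C c m" and "Cod C c \<in> N"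
  shows "m \<in> N_iso C N"
  using mono_kernel_N[OF assms(1,2)] assms(3,4) m unfolding N_iso_def Hom_def by blast

lemma N_iso_epi:
  assumes "is_epi C e" and "e \<in> Hom C X Y" and "is_kernel C k e" and "Dom C k \<in> N"
  shows "e \<in> N_iso C N"
  using serre.N_iso_mono[OF serre_op, of e Y X k] assms by simp

text \<open>With \<open>K\<close> the kernel of \<open>t \<cdot> s\<close>, the arrow
  \<open>s\<close> carries \<open>K\<close> into the kernel of \<open>t\<close>. The image
  \<open>I\<close> of this map is in \<open>N\<close>, and so is its kernel \<open>L\<close>, which
  embeds in the kernel of \<open>s\<close>; \<open>K\<close> is an extension of \<open>I\<close> by
  \<open>L\<close>.\<close>

lemma kernel_Comp_N:
  assumes s: "s \<in> Hom C X Y" "is_kernel C ks s" "Dom C ks \<in> N"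
    and t: "t \<in> Hom C Y Z" "is_kernel C kt t" "Dom C kt \<in> N"
  obtains k where "is_kernel C k (t \<cdot> s)" and "Dom C k \<in> N"
proof -
  note ts = Comp_in_Hom[OF s(1) t(1)]
  note ks = kernelD[OF s(2,1)] and kt = kernelD[OF t(2,1)]
  obtain K k where k: "is_kernel C k (t \<cdot> s)" "k \<in> Hom C K X" "(t \<cdot> s) \<cdot> k = zero K Z" "is_mono C k"
    using kernelE[OF ts] .
  have "t \<cdot> (s \<cdot> k) = zero K Z" using k(3) Comp_assoc[OF k(2) s(1) t(1)] by simp
  then obtain j where j: "j \<in> Hom C K (Dom C kt)" "kt \<cdot> j = s \<cdot> k"
    using kernel_factor[OF t(2,1) Comp_in_Hom[OF k(2) s(1)]] by metis
  obtain L l where l: "is_kernel C l j" "l \<in> Hom C L K" "j \<cdot> l = zero L (Dom C kt)" "is_mono C l"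
    using kernelE[OF j(1)] .
  have LO: "L \<in> Obj C" using Hom_Obj[OF l(2)] by simp
  have "s \<cdot> (k \<cdot> l) = kt \<cdot> (j \<cdot> l)"
    using Comp_assoc[OF l(2) k(2) s(1)] Comp_assoc[OF l(2) j(1) kt(1)] j(2) by simp
  also have "\<dots> = zero L Y" using l(3) Comp_zero[OF kt(1) LO] by simp
  finally obtain u where u: "u \<in> Hom C L (Dom C ks)" "ks \<cdot> u = k \<cdot> l"
    using kernel_factor[OF s(2,1) Comp_in_Hom[OF l(2) k(2)]] by metis
  have "is_mono C u" using mono_of_Comp[OF _ u(1) ks(1)] u(2) mono_Comp[OF l(4,2) k(4,2)] by simp
  then have LN: "L \<in> N" using N_subobject u(1) s(3) by blast
  obtain I e where e: "is_cokernel C e l" "e \<in> Hom C K I" using cokernelE[OF l(2)] by metis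
  have CI: "Cod C e = I" using e(2) by (simp add: Hom_def)
  obtain m where m: "m \<in> Hom C I (Dom C kt)" "is_mono C m" "m \<cdot> e = j"
    using epi_mono_factorisation[OF j(1) l(1) e(1)] CI by metis
  have IN: "I \<in> N" using N_subobject[OF m(2,1) t(3)] .
  have "is_kernel C l e" using kernel_mono_Comp[OF m(2,1) e(2)] l(1) m(3) by simp
  then have "K \<in> N" using N_extension[OF _ l(2) e(2) LN IN] e(1) by (simp add: short_exact_def)
  then show ?thesis using that k(1,2) by (simp add: Hom_def)
qed

lemma cokernel_Comp_N:
  assumes "t \<in> Hom C Y Z" "is_cokernel C ct t" "Cod C ct \<in> N"
    and "s \<in> Hom C X Y" "is_cokernel C cs s" "Cod C cs \<in> N"
  obtains c where "is_cokernel C c (t \<cdot> s)" and "Cod C c \<in> N"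
  using serre.kernel_Comp_N[OF serre_op, of t Z Y ct s X cs] assms by auto

lemma Comp_N_iso:
  assumes s: "s \<in> N_iso C N" and t: "t \<in> N_iso C N" and "Cod C s = Dom C t"
  shows "t \<cdot> s \<in> N_iso C N"
proof -
  obtain X Y Z where sX: "s \<in> Hom C X Y" and tX: "t \<in> Hom C Y Z"
    using N_iso_Arr[OF s] N_iso_Arr[OF t] assms(3) by (auto simp: Hom_def)
  obtain ks cs where ks: "is_kernel C ks s" "Dom C ks \<in> N" and cs: "is_cokernel C cs s" "Cod C cs \<in> N"
    using s by (auto simp: N_iso_def)
  obtain kt ct where kt: "is_kernel C kt t" "Dom C kt \<in> N" and ct: "is_cokernel C ct t" "Cod C ct \<in> N"
    using t by (auto simp: N_iso_def)
  have "t \<cdot> s \<in> Arr C" using Comp_in_Hom[OF sX tX] by (simp add: Hom_def)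
  moreover obtain k where "is_kernel C k (t \<cdot> s)" "Dom C k \<in> N" using kernel_Comp_N[OF sX ks tX kt] .
  moreover obtain c where "is_cokernel C c (t \<cdot> s)" "Cod C c \<in> N" using cokernel_Comp_N[OF tX ct sX cs] .
  ultimately show ?thesis unfolding N_iso_def by blast
qed

lemma Idn_N_iso:
  assumes X: "X \<in> Obj C"
  shows "Idn C X \<in> N_iso C N"
proof -
  obtain c where "is_cokernel C c (Idn C X)" "Cod C c \<in> N"
    using serre.mono_kernel_N[OF serre_op, of "Idn C X" X X] abelian.Idn_mono[OF abelian_op, of X]
      Idn_in_Hom[OF X] X by auto
  then show ?thesis using N_iso_mono[OF Idn_mono[OF X] Idn_in_Hom[OF X]] by blast
qed

text \<open>\<open>d\<close> factors through the kernel of \<open>t\<close>, which is in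
  \<open>N\<close>. The cokernel of \<open>e\<close> is the image of \<open>d\<close>, a subobject
  of that kernel.\<close>

lemma kernel_N_iso_right:
  assumes d: "d \<in> Hom C X Y" and t: "t \<in> Hom C Y Z" "t \<in> N_iso C N" and "t \<cdot> d = zero X Z"
    and e: "is_kernel C e d"
  shows "e \<in> N_iso C N"
proof -
  note eD = kernelD[OF e d]
  obtain K k where k: "is_kernel C k t" "k \<in> Hom C K Y" "is_mono C k" using kernelE[OF t(1)] by metis
  have Dk: "Dom C k = K" using k(2) by (simp add: Hom_def)
  then have KN: "K \<in> N" using N_iso_kernel[OF t(2) k(1)] by simp
  obtain w where w: "w \<in> Hom C X K" "k \<cdot> w = d" using kernel_factor[OF k(1) t(1) d assms(4)] Dk by metis
  have ew: "is_kernel C e w" using kernel_mono_Comp[OF k(3,2) w(1)] e w(2) by simp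
  obtain I c where c: "is_cokernel C c e" "c \<in> Hom C X I" using cokernelE[OF eD(1)] by metis
  have CI: "Cod C c = I" using c(2) by (simp add: Hom_def)
  obtain m where m: "m \<in> Hom C I K" "is_mono C m" using epi_mono_factorisation[OF w(1) ew c(1)] CI by metis
  have "Cod C c \<in> N" using N_subobject[OF m(2,1) KN] CI by simp
  then show ?thesis using N_iso_mono[OF eD(3,1) c(1)] by simp
qed

text \<open>The cokernel of \<open>m\<close> is a quotient of the cokernel of
  \<open>m \<cdot> v\<close>.\<close>

lemma mono_N_iso_of_Comp:
  assumes m: "is_mono C m" "m \<in> Hom C X Y" and v: "v \<in> Hom C W X" and u: "m \<cdot> v \<in> N_iso C N"
  shows "m \<in> N_iso C N"
proof -
  note mv = Comp_in_Hom[OF v m(2)]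
  obtain I c where c: "is_cokernel C c m" "c \<in> Hom C Y I" "c \<cdot> m = zero X I" "is_epi C c"
    using cokernelE[OF m(2)] .
  obtain J b where b: "is_cokernel C b (m \<cdot> v)" "b \<in> Hom C Y J" using cokernelE[OF mv] by metis
  have CD: "Cod C c = I" "Cod C b = J" using c(2) b(2) by (auto simp: Hom_def)
  have IO: "I \<in> Obj C" using Hom_Obj[OF c(2)] by simp
  have "c \<cdot> (m \<cdot> v) = zero W I" using Comp_assoc[OF v m(2) c(2)] c(3) zero_Comp[OF v IO] by simp
  then obtain y where y: "y \<in> Hom C J I" "y \<cdot> b = c" using cokernel_factor[OF b(1) mv c(2)] CD by metis
  have "is_epi C y" using epi_of_Comp[OF _ b(2) y(1)] y(2) c(4) by simp
  then have "Cod C c \<in> N" using N_quotient[OF _ y(1)] N_iso_cokernel[OF u b(1)] CD by simp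
  then show ?thesis using N_iso_mono[OF m c(1)] by simp
qed

lemma kernel_N_iso_left:
  assumes d: "d \<in> Hom C X Y" and u: "u \<in> Hom C W X" "u \<in> N_iso C N" and "d \<cdot> u = zero W Y"
    and e: "is_kernel C e d"
  shows "e \<in> N_iso C N"
proof -
  obtain v where "v \<in> Hom C W (Dom C e)" "e \<cdot> v = u" using kernel_factor[OF e d u(1) assms(4)] .
  then show ?thesis using mono_N_iso_of_Comp[OF kernelD(3,1)[OF e d]] u(2) by simp
qed

text \<open>Dual to \<open>kernel_N_iso_right\<close>. It allows an object to be divided by the
  image of an arrow that vanishes in the quotient category.\<close>

lemma cokernel_N_iso_right:
  assumes "d \<in> Hom C X Y" and "u \<in> Hom C W X" "u \<in> N_iso C N" and "d \<cdot> u = zero W Y"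
    and "is_cokernel C c d"
  shows "c \<in> N_iso C N"
  using serre.kernel_N_iso_right[OF serre_op, of d Y X u W c] assms by simp

text \<open>In the image factorisation \<open>e\<close> has the kernel of \<open>t\<close> and
  \<open>m\<close> has its cokernel. Pullbacks along \<open>t\<close> can thus be treated separately
  for monos and for epis.\<close>

lemma N_iso_factorisation:
  assumes t: "t \<in> Hom C X Y" "t \<in> N_iso C N"
  obtains I e m where "e \<in> Hom C X I" and "is_epi C e" and "e \<in> N_iso C N"
    and "m \<in> Hom C I Y" and "is_mono C m" and "m \<in> N_iso C N" and "t = m \<cdot> e"
proof -
  obtain I e m where e: "e \<in> Hom C X I" "is_epi C e" and m: "m \<in> Hom C I Y" "is_mono C m" and tm: "t = m \<cdot> e"
    using imageE[OF t(1)] by metis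
  obtain k where k: "is_kernel C k t" using kernel_ex[OF N_iso_Arr[OF t(2)]] by blast
  obtain c where c: "is_cokernel C c t" using cokernel_ex[OF N_iso_Arr[OF t(2)]] by blast
  have "is_kernel C k e" using kernel_mono_Comp[OF m(2,1) e(1)] k tm by simp
  then have "e \<in> N_iso C N" using N_iso_epi[OF e(2,1)] N_iso_kernel[OF t(2) k] by simp
  moreover have "is_cokernel C c m" using cokernel_Comp_epi[OF e(2,1) m(1)] c tm by simp
  then have "m \<in> N_iso C N" using N_iso_mono[OF m(2,1)] N_iso_cokernel[OF t(2) c] by simp
  ultimately show ?thesis using that e m tm by blast
qed

text \<open>The preimage of the subobject \<open>m\<close> under \<open>f\<close> is the kernel of
  \<open>f\<close> followed by the cokernel \<open>c\<close> of \<open>m\<close>. The cokernel of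
  this preimage embeds in the target of \<open>c\<close>, which is in \<open>N\<close>.\<close>

lemma pullback_mono_N_iso:
  assumes f: "f \<in> Hom C X Y" and m: "m \<in> Hom C I Y" "is_mono C m" "m \<in> N_iso C N"
  obtains u v where "is_pullback C f m u v" and "u \<in> N_iso C N"
proof -
  obtain J c where c: "is_cokernel C c m" "c \<in> Hom C Y J" "c \<cdot> m = zero I J" using cokernelE[OF m(1)] by metis
  have CJ: "Cod C c = J" using c(2) by (simp add: Hom_def)
  have JN: "J \<in> N" using N_iso_cokernel[OF m(3) c(1)] CJ by simp
  have mk: "is_kernel C m c" using mono_is_kernel[OF m(2,1) c(1)] .
  have DI: "Dom C m = I" using m(1) by (simp add: Hom_def)
  note cf = Comp_in_Hom[OF f c(2)]
  obtain P u where u: "is_kernel C u (c \<cdot> f)" "u \<in> Hom C P X" "(c \<cdot> f) \<cdot> u = zero P J" "is_mono C u"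
    using kernelE[OF cf] .
  have Du: "Dom C u = P" using u(2) by (simp add: Hom_def)
  have "c \<cdot> (f \<cdot> u) = zero P J" using u(3) Comp_assoc[OF u(2) f c(2)] by simp
  then obtain v where v: "v \<in> Hom C P I" "m \<cdot> v = f \<cdot> u"
    using kernel_factor[OF mk c(2) Comp_in_Hom[OF u(2) f]] DI by metis
  have "is_pullback C f m u v"
  proof (rule is_pullbackI[OF f m(1) u(2) v(1)])
    fix W a b assume a: "a \<in> Hom C W X" and b: "b \<in> Hom C W I" and fa: "f \<cdot> a = m \<cdot> b"
    have WO: "W \<in> Obj C" "J \<in> Obj C" using Hom_Obj[OF a] Hom_Obj[OF c(2)] by auto
    have "(c \<cdot> f) \<cdot> a = (c \<cdot> m) \<cdot> b"
      using Comp_assoc[OF a f c(2)] Comp_assoc[OF b m(1) c(2)] fa by simp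
    then have "(c \<cdot> f) \<cdot> a = zero W J" using c(3) zero_Comp[OF b WO(2)] by simp
    then obtain w where w: "w \<in> Hom C W P" "u \<cdot> w = a" using kernel_factor[OF u(1) cf a] Du by metis
    have "m \<cdot> (v \<cdot> w) = m \<cdot> b"
      using Comp_assoc[OF w(1) v(1) m(1)] Comp_assoc[OF w(1) u(2) f] v(2) w(2) fa by simp
    then have "v \<cdot> w = b" by (rule monoD[OF m(2,1) Comp_in_Hom[OF w(1) v(1)] b])
    then show "\<exists>w \<in> Hom C W P. u \<cdot> w = a \<and> v \<cdot> w = b" using w by blast
  qed (use v monoD[OF u(4,2)] in auto)
  moreover have "u \<in> N_iso C N"
  proof -
    obtain L e where e: "is_cokernel C e u" "e \<in> Hom C X L" using cokernelE[OF u(2)] by metis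
    have CL: "Cod C e = L" using e(2) by (simp add: Hom_def)
    obtain n where n: "n \<in> Hom C L J" "is_mono C n" using epi_mono_factorisation[OF cf u(1) e(1)] CL by metis
    show ?thesis using N_iso_mono[OF u(4,2) e(1)] N_subobject[OF n(2,1) JN] CL by simp
  qed
  ultimately show ?thesis using that by blast
qed

text \<open>The pullback is the kernel of the difference of \<open>f \<cdot> p\<close> and
  \<open>e \<cdot> r\<close> on the biproduct. The kernel of its leg \<open>p \<cdot> k\<close>
  embeds in the kernel of \<open>e\<close>; the harder half is that this leg is again epi.\<close>

lemma pullback_epi_N_iso:
  assumes f: "f \<in> Hom C X I" and e: "e \<in> Hom C Z I" "is_epi C e" "e \<in> N_iso C N"
  obtains u v where "is_pullback C f e u v" and "u \<in> N_iso C N"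
proof -
  have O: "X \<in> Obj C" "Z \<in> Obj C" "I \<in> Obj C" using Hom_Obj f e(1) by auto
  obtain B i j p r where i: "i \<in> Hom C X B" and j: "j \<in> Hom C Z B" and p: "p \<in> Hom C B X"
    and r: "r \<in> Hom C B Z" and pi: "p \<cdot> i = Idn C X" and rj: "r \<cdot> j = Idn C Z"
    and pj: "p \<cdot> j = zero Z X" and ri: "r \<cdot> i = zero X Z" and sum: "add (i \<cdot> p) (j \<cdot> r) = Idn C B"
    using biproductE[OF O(1,2)] .
  note joint = biproduct_Hom_eq[OF i j p r sum]
  note pair = biproduct_pair[OF i j p r pi rj pj ri]
  note fp = Comp_in_Hom[OF p f] and er = Comp_in_Hom[OF r e(1)]
  obtain d where d: "d \<in> Hom C B I" and dadd: "add d (e \<cdot> r) = f \<cdot> p"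
    and dl: "\<And>h Z. h \<in> Hom C I Z \<Longrightarrow> h \<cdot> d = zero B Z \<longleftrightarrow> h \<cdot> (f \<cdot> p) = h \<cdot> (e \<cdot> r)"
    and dr: "\<And>h W. h \<in> Hom C W B \<Longrightarrow> d \<cdot> h = zero W I \<longleftrightarrow> (f \<cdot> p) \<cdot> h = (e \<cdot> r) \<cdot> h"
    by (rule differenceE[OF fp er]) (rule that; blast)
  obtain P k where k: "is_kernel C k d" "k \<in> Hom C P B" "d \<cdot> k = zero P I" "is_mono C k"
    using kernelE[OF d] .
  have Dk: "Dom C k = P" using k(2) by (simp add: Hom_def)
  have PO: "P \<in> Obj C" using Hom_Obj[OF k(2)] by simp
  have u: "p \<cdot> k \<in> Hom C P X" and v: "r \<cdot> k \<in> Hom C P Z" using Comp_in_Hom k(2) p r by auto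
  have fu: "f \<cdot> (p \<cdot> k) = e \<cdot> (r \<cdot> k)"
    using dr[OF k(2)] k(3) Comp_assoc[OF k(2) p f] Comp_assoc[OF k(2) r e(1)] by simp
  have uniq: "w = w'" if w: "w \<in> Hom C W P" "w' \<in> Hom C W P" and
    eq: "(p \<cdot> k) \<cdot> w = (p \<cdot> k) \<cdot> w'" "(r \<cdot> k) \<cdot> w = (r \<cdot> k) \<cdot> w'" for W w w'
  proof -
    have "k \<cdot> w = k \<cdot> w'"
      using w eq k(2) p r by (intro joint[OF Comp_in_Hom[OF w(1) k(2)] Comp_in_Hom[OF w(2) k(2)]])
        (auto simp: Comp_assoc)
    then show ?thesis by (rule monoD[OF k(4,2) w])
  qed
  have pb: "is_pullback C f e (p \<cdot> k) (r \<cdot> k)"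
  proof (rule is_pullbackI[OF f e(1) u v fu _ uniq])
    fix W a b assume a: "a \<in> Hom C W X" and b: "b \<in> Hom C W Z" and fa: "f \<cdot> a = e \<cdot> b"
    define h where "h = add (i \<cdot> a) (j \<cdot> b)"
    note h = pair[OF a b, folded h_def]
    have "(f \<cdot> p) \<cdot> h = (e \<cdot> r) \<cdot> h"
      using Comp_assoc[OF h(1) p f] Comp_assoc[OF h(1) r e(1)] h(2,3) fa by simp
    then obtain w where w: "w \<in> Hom C W P" "k \<cdot> w = h"
      using kernel_factor[OF k(1) d h(1)] dr[OF h(1)] Dk by metis
    then show "\<exists>w \<in> Hom C W P. (p \<cdot> k) \<cdot> w = a \<and> (r \<cdot> k) \<cdot> w = b"
      using Comp_assoc[OF w(1) k(2) p] Comp_assoc[OF w(1) k(2) r] h by auto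
  qed
  have epi_d: "is_epi C d"
  proof (rule epiI[OF d])
    fix T g assume g: "g \<in> Hom C I T" and "g \<cdot> d = zero B T"
    then have eq: "g \<cdot> (f \<cdot> p) = g \<cdot> (e \<cdot> r)" using dl by simp
    have "g \<cdot> e = (g \<cdot> (e \<cdot> r)) \<cdot> j" using g e(1) r j rj by (simp add: Hom_def)
    also have "\<dots> = (g \<cdot> f) \<cdot> (p \<cdot> j)" unfolding eq[symmetric] using g f p j by (simp add: Hom_def)
    also have "\<dots> = zero Z T" using pj Comp_zero[OF Comp_in_Hom[OF f g] O(2)] by simp
    finally show "g = zero I T" by (rule epi_zeroD[OF e(2,1) g])
  qed
  have dk: "is_cokernel C d k" using epi_is_cokernel[OF epi_d d k(1)] .
  have CI: "Cod C d = I" using d by (simp add: Hom_def)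
  \<comment> \<open>If \<open>h\<close> kills the leg, then \<open>h \<cdot> p\<close> kills
    \<open>k\<close>, so \<open>h \<cdot> p = w \<cdot> d\<close> because the epi \<open>d\<close>
    is the cokernel of its kernel. Restricting to the summand \<open>Z\<close> shows that
    \<open>w \<cdot> e\<close> vanishes, hence \<open>w\<close>, and then \<open>h\<close> by
    restriction to \<open>X\<close>.\<close>
  have epi_u: "is_epi C (p \<cdot> k)"
  proof (rule epiI[OF u])
    fix T h assume h: "h \<in> Hom C X T" and "h \<cdot> (p \<cdot> k) = zero P T"
    then have "(h \<cdot> p) \<cdot> k = zero P T" using Comp_assoc[OF k(2) p h] by simp
    then obtain w where w: "w \<in> Hom C I T" "w \<cdot> d = h \<cdot> p"
      using cokernel_factor[OF dk k(2) Comp_in_Hom[OF p h]] CI by metis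
    have TO: "T \<in> Obj C" using Hom_Obj[OF h] by simp
    note dj = Comp_in_Hom[OF j d]
    have "w \<cdot> (d \<cdot> j) = h \<cdot> (p \<cdot> j)"
      using Comp_assoc[OF j d w(1)] Comp_assoc[OF j p h] w(2) by simp
    also have "\<dots> = zero Z T" using pj Comp_zero[OF h O(2)] by simp
    finally have 1: "w \<cdot> (d \<cdot> j) = zero Z T" .
    \<comment> \<open>On the summand \<open>Z\<close> the arrow \<open>d\<close> is the negative of
      \<open>e\<close>, expressed here without negation.\<close>
    have "add (d \<cdot> j) ((e \<cdot> r) \<cdot> j) = (f \<cdot> p) \<cdot> j" using add_Comp[OF d er j] dadd by simp
    also have "\<dots> = zero Z I" using Comp_assoc[OF j p f] pj Comp_zero[OF f O(2)] by simp
    finally have "add (d \<cdot> j) e = zero Z I"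
      using Comp_assoc[OF j r e(1)] rj Comp_Idn[OF e(1)] by simp
    then have "add (w \<cdot> (d \<cdot> j)) (w \<cdot> e) = zero Z T"
      using Comp_add[OF dj e(1) w(1)] Comp_zero[OF w(1) O(2)] by simp
    then have "w \<cdot> e = zero Z T" using 1 add_zero(2)[OF Comp_in_Hom[OF e(1) w(1)]] by simp
    then have "w = zero I T" by (rule epi_zeroD[OF e(2,1) w(1)])
    then have "h \<cdot> p = zero B T" using w(2) zero_Comp[OF d TO] by simp
    then have "(h \<cdot> p) \<cdot> i = zero X T" using zero_Comp[OF i TO] by simp
    then show "h = zero X T" using Comp_assoc[OF i p h] pi Comp_Idn[OF h] by simp
  qed
  have "p \<cdot> k \<in> N_iso C N"
  proof -
    obtain L l where l: "is_kernel C l (p \<cdot> k)" "l \<in> Hom C L P" "(p \<cdot> k) \<cdot> l = zero L X" "is_mono C l"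
      using kernelE[OF u] .
    obtain K ke where ke: "is_kernel C ke e" "ke \<in> Hom C K Z" using kernelE[OF e(1)] by metis
    have D: "Dom C ke = K" "Dom C l = L" using ke(2) l(2) by (auto simp: Hom_def)
    have LO: "L \<in> Obj C" using Hom_Obj[OF l(2)] by simp
    note vl = Comp_in_Hom[OF l(2) v]
    have "e \<cdot> ((r \<cdot> k) \<cdot> l) = f \<cdot> ((p \<cdot> k) \<cdot> l)"
      using Comp_assoc[OF l(2) v e(1)] Comp_assoc[OF l(2) u f] fu by simp
    then have "e \<cdot> ((r \<cdot> k) \<cdot> l) = zero L I" using l(3) Comp_zero[OF f LO] by simp
    then obtain y where y: "y \<in> Hom C L K" "ke \<cdot> y = (r \<cdot> k) \<cdot> l"
      using kernel_factor[OF ke(1) e(1) vl] D by metis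
    \<comment> \<open>If \<open>y\<close> kills \<open>x\<close>, then \<open>l \<cdot> x\<close>
      vanishes under both legs of the pullback, and these are jointly monic.\<close>
    have "is_mono C y"
    proof (rule monoI[OF y(1)])
      fix W x assume x: "x \<in> Hom C W L" and yx: "y \<cdot> x = zero W K"
      have WO: "W \<in> Obj C" using Hom_Obj[OF x] by simp
      note lx = Comp_in_Hom[OF x l(2)]
      have "(r \<cdot> k) \<cdot> (l \<cdot> x) = ke \<cdot> (y \<cdot> x)"
        using Comp_assoc[OF x l(2) v] Comp_assoc[OF x y(1) ke(2)] y(2) by simp
      then have 1: "(r \<cdot> k) \<cdot> (l \<cdot> x) = (r \<cdot> k) \<cdot> zero W P"
        using yx Comp_zero[OF ke(2) WO] Comp_zero[OF v WO] by simp
      have 2: "(p \<cdot> k) \<cdot> (l \<cdot> x) = (p \<cdot> k) \<cdot> zero W P"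
        using Comp_assoc[OF x l(2) u] l(3) zero_Comp[OF x O(1)] Comp_zero[OF u WO] by simp
      have "l \<cdot> x = zero W P" by (rule uniq[OF lx zero_Hom[OF WO PO] 2 1])
      then show "x = zero W L" by (rule mono_zeroD[OF l(4,2) x])
    qed
    then have "Dom C l \<in> N" using N_subobject[OF _ y(1)] N_iso_kernel[OF e(3) ke(1)] D by simp
    then show ?thesis using N_iso_epi[OF epi_u u l(1)] by simp
  qed
  then show ?thesis using that pb by blast
qed

text \<open>Pasting of the pullback along the mono part \<open>m\<close> of \<open>t\<close> with
  the one along its epi part \<open>e\<close>. That \<open>m\<close> is mono gives the uniqueness of
  factorisations.\<close>

lemma pullback_N_iso:
  assumes f: "f \<in> Hom C X Y" and t: "t \<in> Hom C Z Y" "t \<in> N_iso C N"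
  obtains u v where "is_pullback C f t u v" and "u \<in> N_iso C N"
proof -
  obtain I e m where e: "e \<in> Hom C Z I" "is_epi C e" "e \<in> N_iso C N"
    and m: "m \<in> Hom C I Y" "is_mono C m" "m \<in> N_iso C N" and tm: "t = m \<cdot> e"
    using N_iso_factorisation[OF t] .
  obtain n g where ng: "is_pullback C f m n g" "n \<in> N_iso C N" using pullback_mono_N_iso[OF f m] .
  note n = is_pullbackD[OF ng(1) f m(1)]
  define X' where "X' = Dom C n"
  note n = n[folded X'_def]
  obtain u v where uv: "is_pullback C g e u v" "u \<in> N_iso C N" using pullback_epi_N_iso[OF n(2) e] .
  note u = is_pullbackD[OF uv(1) n(2) e(1)]
  define P where "P = Dom C u"
  note u = u[folded P_def]
  have nu: "n \<cdot> u \<in> Hom C P X" using Comp_in_Hom[OF u(1) n(1)] .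
  have "is_pullback C f t (n \<cdot> u) v"
  proof (rule is_pullbackI[OF f t(1) nu u(2)])
    have "f \<cdot> (n \<cdot> u) = m \<cdot> (g \<cdot> u)" 
      using Comp_assoc[OF u(1) n(1) f] Comp_assoc[OF u(1) n(2) m(1)] n(3) by simp
    then show "f \<cdot> (n \<cdot> u) = t \<cdot> v" using u(3) tm Comp_assoc[OF u(2) e(1) m(1)] by simp
  next
    fix W a b assume a: "a \<in> Hom C W X" and b: "b \<in> Hom C W Z" and fa: "f \<cdot> a = t \<cdot> b"
    then have "f \<cdot> a = m \<cdot> (e \<cdot> b)" using tm Comp_assoc[OF b e(1) m(1)] by simp
    then obtain a' where a': "a' \<in> Hom C W X'" "n \<cdot> a' = a" "g \<cdot> a' = e \<cdot> b"
      using n(4)[OF a Comp_in_Hom[OF b e(1)]] by blast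
    then obtain w where w: "w \<in> Hom C W P" "u \<cdot> w = a'" "v \<cdot> w = b" using u(4)[OF a'(1) b] by blast
    then show "\<exists>w \<in> Hom C W P. (n \<cdot> u) \<cdot> w = a \<and> v \<cdot> w = b"
      using Comp_assoc[OF w(1) u(1) n(1)] a'(2) by auto
  next
    fix W w w' assume w: "w \<in> Hom C W P" "w' \<in> Hom C W P"
      and eq: "(n \<cdot> u) \<cdot> w = (n \<cdot> u) \<cdot> w'" "v \<cdot> w = v \<cdot> w'"
    have "m \<cdot> (g \<cdot> (u \<cdot> w)) = m \<cdot> (g \<cdot> (u \<cdot> w'))"
      using Comp_assoc[OF w(1) u(1) n(2)] Comp_assoc[OF w(2) u(1) n(2)] u(3)
        Comp_assoc[OF w(1) u(2) e(1)] Comp_assoc[OF w(2) u(2) e(1)] eq(2) by simp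
    then have "g \<cdot> (u \<cdot> w) = g \<cdot> (u \<cdot> w')"
      by (rule monoD[OF m(2,1) Comp_in_Hom[OF Comp_in_Hom[OF w(1) u(1)] n(2)]
          Comp_in_Hom[OF Comp_in_Hom[OF w(2) u(1)] n(2)]])
    moreover have "n \<cdot> (u \<cdot> w) = n \<cdot> (u \<cdot> w')"
      using Comp_assoc[OF w(1) u(1) n(1)] Comp_assoc[OF w(2) u(1) n(1)] eq(1) by simp
    ultimately have "u \<cdot> w = u \<cdot> w'"
      using pullback_Hom_eq[OF ng(1) f m(1)] Comp_in_Hom[OF w(1) u(1)] Comp_in_Hom[OF w(2) u(1)] X'_def
      by blast
    then show "w = w'" using pullback_Hom_eq[OF uv(1) n(2) e(1)] w eq(2) P_def by blast
  qed
  moreover have "n \<cdot> u \<in> N_iso C N"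
    using Comp_N_iso[OF uv(2) ng(2)] n(1) u(1) by (simp add: Hom_def)
  ultimately show ?thesis using that by blast
qed

text \<open>For cancellation, \<open>t\<close> kills the difference \<open>d\<close> of
  \<open>f\<close> and \<open>g\<close>; hence the kernel of \<open>d\<close> is inverted, and it
  equalises the two.\<close>

lemma fractions: "fractions C N"
proof
  show "\<exists>W. \<exists>u \<in> Hom C W X. \<exists>v \<in> Hom C W Z. u \<in> N_iso C N \<and> f \<cdot> u = t \<cdot> v"
    if f: "f \<in> Hom C X Y" and t: "t \<in> Hom C Z Y" "t \<in> N_iso C N" for f t X Y Z
  proof -
    obtain u v where uv: "is_pullback C f t u v" "u \<in> N_iso C N" using pullback_N_iso[OF f t] .
    show ?thesis using is_pullbackD[OF uv(1) f t(1)] uv(2) by blast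
  qed
  show "\<exists>W. \<exists>u \<in> Hom C W X. u \<in> N_iso C N \<and> f \<cdot> u = g \<cdot> u"
    if f: "f \<in> Hom C X Y" and g: "g \<in> Hom C X Y" and t: "t \<in> Hom C Y Z" "t \<in> N_iso C N"
      and eq: "t \<cdot> f = t \<cdot> g" for f g t X Y Z
  proof -
    obtain d where d: "d \<in> Hom C X Y" "t \<cdot> d = zero X Z"
      and dr: "\<And>h W. h \<in> Hom C W X \<Longrightarrow> d \<cdot> h = zero W Y \<longleftrightarrow> f \<cdot> h = g \<cdot> h"
      using differenceE[OF f g] t(1) eq by metis
    obtain K k where k: "is_kernel C k d" "k \<in> Hom C K X" "d \<cdot> k = zero K Y" using kernelE[OF d(1)] by metis
    show ?thesis using kernel_N_iso_right[OF d(1) t d(2) k(1)] k(2,3) dr[OF k(2)] by blast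
  qed
qed (use Idn_N_iso Comp_N_iso in auto)

end

sublocale serre \<subseteq> fractions C N by (rule fractions)

context serre
begin

section \<open>Left fractions, epis and coequalisers in the quotient\<close>

lemma fractions_op: "fractions (op_cat C) N"
  using serre.fractions[OF serre_op] .

lemma co_ore:
  assumes "f \<in> Hom C X Y" and "t \<in> Hom C X Z" and "t \<in> S"
  obtains W u v where "u \<in> Hom C Y W" and "u \<in> S" and "v \<in> Hom C Z W" and "u \<cdot> f = v \<cdot> t"
  using fractions.ore[OF fractions_op, of f Y X t Z] assms by auto

lemma co_cancel:
  assumes "f \<in> Hom C X Y" and "g \<in> Hom C X Y" and "t \<in> Hom C W X" and "t \<in> S" and "f \<cdot> t = g \<cdot> t"
  obtains Z u where "u \<in> Hom C Y Z" and "u \<in> S" and "u \<cdot> f = u \<cdot> g"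
  using fractions.cancel[OF fractions_op, of f Y X g t W] assms by auto

text \<open>A right fraction \<open>g s^-1\<close> becomes a left fraction \<open>d^-1 f\<close> by
  completing the span of \<open>g\<close> and \<open>s\<close> to a square.\<close>

lemma Q_co_rep:
  assumes h: "h \<in> Hom Q X Y"
  obtains W d f where "d \<in> Hom C Y W" and "d \<in> S" and "f \<in> Hom C X W" and "q d \<cdot>\<^bsub>Q\<^esub> h = q f"
proof -
  obtain V s g where s: "s \<in> Hom C V X" "s \<in> S" and g: "g \<in> Hom C V Y" and hs: "h \<cdot>\<^bsub>Q\<^esub> q s = q g"
    using Q_rep[OF h] .
  obtain W d f where d: "d \<in> Hom C Y W" "d \<in> S" and f: "f \<in> Hom C X W" and df: "d \<cdot> g = f \<cdot> s"
    using co_ore[OF g s] .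
  have "(q d \<cdot>\<^bsub>Q\<^esub> h) \<cdot>\<^bsub>Q\<^esub> q s = q f \<cdot>\<^bsub>Q\<^esub> q s"
    using Q.Comp_assoc[OF q_Hom[OF s(1)] h q_Hom[OF d(1)]] hs q_Comp[OF g d(1)] q_Comp[OF s(1) f] df
    by simp
  then have "q d \<cdot>\<^bsub>Q\<^esub> h = q f"
    by (rule Q.iso_cancel_right[OF q_iso[OF s(2)] q_Hom[OF s(1)] Q.Comp_in_Hom[OF h q_Hom[OF d(1)]]
        q_Hom[OF f]])
  then show ?thesis using that d f by blast
qed

lemma q_co_eqE:
  assumes f: "f \<in> Hom C X Y" and g: "g \<in> Hom C X Y" and "q f = q g"
  obtains Z d where "d \<in> Hom C Y Z" and "d \<in> S" and "d \<cdot> f = d \<cdot> g"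
  using q_eqE[OF assms] co_cancel[OF f g] by metis

text \<open>A common left denominator for \<open>g\<close> and \<open>h\<close> leaves an equation
  between arrows of \<open>C\<close>, valid there after some inverted \<open>d\<close>, and then
  \<open>e\<close> can be cancelled in \<open>C\<close>. The denominators are taken on the left
  because right ones would stand between the arrows and \<open>e\<close>.\<close>

lemma q_epi:
  assumes epi: "is_epi C e" and e: "e \<in> Hom C X Y"
    and g: "g \<in> Hom Q Y Z" and h: "h \<in> Hom Q Y Z" and eq: "g \<cdot>\<^bsub>Q\<^esub> q e = h \<cdot>\<^bsub>Q\<^esub> q e"
  shows "g = h"
proof -
  obtain V a g' where a: "a \<in> Hom C Z V" "a \<in> S" and g': "g' \<in> Hom C Y V" and ag: "q a \<cdot>\<^bsub>Q\<^esub> g = q g'"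
    using Q_co_rep[OF g] .
  note ah = Q.Comp_in_Hom[OF h q_Hom[OF a(1)]]
  \<comment> \<open>Representing the composite of \<open>q a\<close> and \<open>h\<close>, rather
    than \<open>h\<close>, makes \<open>b \<cdot> a\<close> a left denominator for both
    \<open>g\<close> and \<open>h\<close>.\<close>
  obtain W b h' where b: "b \<in> Hom C V W" "b \<in> S" and h': "h' \<in> Hom C Y W"
    and bh: "q b \<cdot>\<^bsub>Q\<^esub> (q a \<cdot>\<^bsub>Q\<^esub> h) = q h'"
    using Q_co_rep[OF ah] .
  have ba: "b \<cdot> a \<in> Hom C Z W" "b \<cdot> a \<in> S" using a b by (auto simp: Comp_N_iso Hom_def)
  have bg': "b \<cdot> g' \<in> Hom C Y W" using Comp_in_Hom[OF g' b(1)] .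
  note qba = q_Comp[OF a(1) b(1)]
  have bg: "q (b \<cdot> a) \<cdot>\<^bsub>Q\<^esub> g = q (b \<cdot> g')"
    unfolding qba using Q.Comp_assoc[OF g q_Hom[OF a(1)] q_Hom[OF b(1)]] ag q_Comp[OF g' b(1)] by simp
  have bh': "q (b \<cdot> a) \<cdot>\<^bsub>Q\<^esub> h = q h'"
    unfolding qba using Q.Comp_assoc[OF h q_Hom[OF a(1)] q_Hom[OF b(1)]] bh by simp
  have "q ((b \<cdot> g') \<cdot> e) = q (h' \<cdot> e)"
    unfolding q_Comp[OF e bg'] q_Comp[OF e h'] bg[symmetric] bh'[symmetric]
    using Q.Comp_assoc[OF q_Hom[OF e] g q_Hom[OF ba(1)]] Q.Comp_assoc[OF q_Hom[OF e] h q_Hom[OF ba(1)]] eq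
    by simp
  then obtain U d where d: "d \<in> Hom C W U" "d \<in> S" "d \<cdot> ((b \<cdot> g') \<cdot> e) = d \<cdot> (h' \<cdot> e)"
    using q_co_eqE[OF Comp_in_Hom[OF e bg'] Comp_in_Hom[OF e h']] by metis
  have "(d \<cdot> (b \<cdot> g')) \<cdot> e = (d \<cdot> h') \<cdot> e"
    using d(3) Comp_assoc[OF e bg' d(1)] Comp_assoc[OF e h' d(1)] by simp
  then have "d \<cdot> (b \<cdot> g') = d \<cdot> h'"
    by (rule epiD[OF epi e Comp_in_Hom[OF bg' d(1)] Comp_in_Hom[OF h' d(1)]])
  then have "q d \<cdot>\<^bsub>Q\<^esub> q (b \<cdot> g') = q d \<cdot>\<^bsub>Q\<^esub> q h'" using q_Comp[OF bg' d(1)] q_Comp[OF h' d(1)] by simp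
  then have "q (b \<cdot> g') = q h'"
    by (rule Q.iso_cancel_left[OF q_iso[OF d(2)] q_Hom[OF d(1)] q_Hom[OF bg'] q_Hom[OF h']])
  then show ?thesis
    using Q.iso_cancel_left[OF q_iso[OF ba(2)] q_Hom[OF ba(1)] g h] bg bh' by simp
qed

text \<open>\<open>c\<close> is the coequaliser of \<open>f\<close> and \<open>f'\<close> in
  \<open>C\<close>, encoded as the cokernel of their difference \<open>d\<close>. Factorisations
  through it survive in the quotient; their uniqueness is the business of
  \<open>q_epi\<close>.\<close>

lemma q_coequaliser_factor:
  assumes d: "d \<in> Hom C X Y" and f: "f \<in> Hom C X Y" and f': "f' \<in> Hom C X Y"
    and dff': "\<And>h Z. h \<in> Hom C Y Z \<Longrightarrow> h \<cdot> d = zero X Z \<longleftrightarrow> h \<cdot> f = h \<cdot> f'"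
    and c: "is_cokernel C c d" and cQ: "c \<in> Hom C Y Z"
    and g: "g \<in> Hom Q Y T" and gf: "g \<cdot>\<^bsub>Q\<^esub> q f = g \<cdot>\<^bsub>Q\<^esub> q f'"
  obtains h where "h \<in> Hom Q Z T" and "h \<cdot>\<^bsub>Q\<^esub> q c = g"
proof -
  obtain V a g' where a: "a \<in> Hom C T V" "a \<in> S" and g': "g' \<in> Hom C Y V" and ag: "q a \<cdot>\<^bsub>Q\<^esub> g = q g'"
    using Q_co_rep[OF g] .
  have "q (g' \<cdot> f) = q (g' \<cdot> f')"
    using q_Comp[OF f g'] q_Comp[OF f' g'] ag Q.Comp_assoc[OF q_Hom[OF f] g q_Hom[OF a(1)]]
      Q.Comp_assoc[OF q_Hom[OF f'] g q_Hom[OF a(1)]] gf by simp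
  then obtain W b where b: "b \<in> Hom C V W" "b \<in> S" "b \<cdot> (g' \<cdot> f) = b \<cdot> (g' \<cdot> f')"
    using q_co_eqE[OF Comp_in_Hom[OF f g'] Comp_in_Hom[OF f' g']] by metis
  have "(b \<cdot> g') \<cdot> d = zero X W"
    using dff'[OF Comp_in_Hom[OF g' b(1)]] b(3) Comp_assoc[OF f g' b(1)] Comp_assoc[OF f' g' b(1)] by simp
  moreover have "Cod C c = Z" using cQ by (simp add: Hom_def)
  ultimately obtain h' where h': "h' \<in> Hom C Z W" "h' \<cdot> c = b \<cdot> g'"
    using cokernel_factor[OF c d Comp_in_Hom[OF g' b(1)]] by metis
  have ba: "b \<cdot> a \<in> Hom C T W" "b \<cdot> a \<in> S" using a b by (auto simp: Comp_N_iso Hom_def)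
  obtain i where i: "i \<in> Hom Q W T" "i \<cdot>\<^bsub>Q\<^esub> q (b \<cdot> a) = Idn Q T"
    using Q.isoE[OF q_iso[OF ba(2)] q_Hom[OF ba(1)]] by metis
  note ih = Q.Comp_in_Hom[OF q_Hom[OF h'(1)] i(1)]
  have "q (b \<cdot> a) \<cdot>\<^bsub>Q\<^esub> g = q h' \<cdot>\<^bsub>Q\<^esub> q c"
    using q_Comp[OF a(1) b(1)] Q.Comp_assoc[OF g q_Hom[OF a(1)] q_Hom[OF b(1)]] ag
      q_Comp[OF g' b(1)] h'(2) q_Comp[OF cQ h'(1)] by simp
  then have "i \<cdot>\<^bsub>Q\<^esub> (q h' \<cdot>\<^bsub>Q\<^esub> q c) = g"
    using Q.Comp_assoc[OF g q_Hom[OF ba(1)] i(1)] i(2) Q.Idn_Comp[OF g] by simp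
  then have "(i \<cdot>\<^bsub>Q\<^esub> q h') \<cdot>\<^bsub>Q\<^esub> q c = g" 
    using Q.Comp_assoc[OF q_Hom[OF cQ] q_Hom[OF h'(1)] i(1)] by simp
  then show ?thesis using that[OF ih] by simp
qed

end


section \<open>Modules over a monad\<close>

text \<open>Arrows of \<open>module_cat\<close> are triples carrying source and target; this
  predicate on the underlying arrow keeps calculations inside \<open>C\<close>.\<close>

definition module_hom :: "('o, 'a) cat \<Rightarrow> ('o, 'a) monad \<Rightarrow> 'o \<Rightarrow> 'a \<Rightarrow> 'o \<Rightarrow> 'a \<Rightarrow> 'a \<Rightarrow> bool" where
  "module_hom C M X l Y k f \<longleftrightarrow> (X, l) \<in> modules C M \<and> (Y, k) \<in> modules C M \<and>
    f \<in> Hom C X Y \<and> f \<cdot>\<^bsub>C\<^esub> l = k \<cdot>\<^bsub>C\<^esub> AMap (Endo M) f"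

lemma module_homD:
  assumes "module_hom C M X l Y k f"
  shows "(X, l) \<in> modules C M" and "(Y, k) \<in> modules C M" and "f \<in> Hom C X Y"
    and "f \<cdot>\<^bsub>C\<^esub> l = k \<cdot>\<^bsub>C\<^esub> AMap (Endo M) f"
  using assms by (auto simp: module_hom_def)

lemma modulesD:
  assumes "(X, l) \<in> modules C M"
  shows "X \<in> Obj C" and "l \<in> Hom C (OMap (Endo M) X) X"
    and "l \<cdot>\<^bsub>C\<^esub> AMap (Endo M) l = l \<cdot>\<^bsub>C\<^esub> Mu M X" and "l \<cdot>\<^bsub>C\<^esub> Eta M X = Idn C X"
  using assms by (auto simp: modules_def)

lemma Hom_module_cat [simp]:
  "((X, l), (Y, k), f) \<in> Hom (module_cat C M) P P' \<longleftrightarrow>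
    P = (X, l) \<and> P' = (Y, k) \<and> module_hom C M X l Y k f"
  by (auto simp: Hom_def module_cat_def module_hom_def)

lemma Hom_module_catE:
  assumes "h \<in> Hom (module_cat C M) (X, l) (Y, k)"
  obtains f where "h = ((X, l), (Y, k), f)" and "module_hom C M X l Y k f"
proof -
  obtain X' l' Y' k' f where "h = ((X', l'), (Y', k'), f)" by (metis prod.exhaust)
  then show ?thesis using assms that by auto
qed

lemma module_cat_simps [simp]:
  "Obj (module_cat C M) = modules C M"
  "Dom (module_cat C M) (P, P', f) = P"
  "Cod (module_cat C M) (P, P', f) = P'"
  "Idn (module_cat C M) (X, l) = ((X, l), (X, l), Idn C X)"
  "(Q, Q', g) \<cdot>\<^bsub>module_cat C M\<^esub> (P, P', f) = (P, Q', g \<cdot>\<^bsub>C\<^esub> f)"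
  by (simp_all add: module_cat_def)

lemma Arr_module_cat [simp]:
  "((X, l), (Y, k), f) \<in> Arr (module_cat C M) \<longleftrightarrow> module_hom C M X l Y k f"
  using Hom_module_cat[of X l Y k f C M "(X, l)" "(Y, k)"] by (simp add: Hom_def)

lemma Arr_module_catE:
  assumes "h \<in> Arr (module_cat C M)"
  obtains X l Y k f where "h = ((X, l), (Y, k), f)" and "module_hom C M X l Y k f"
proof -
  obtain X l Y k f where "h = ((X, l), (Y, k), f)" by (metis prod.exhaust)
  then show ?thesis using assms that by auto
qed

text \<open>Collects what rests on functoriality of the endofunctor. It is instantiated both for
  \<open>M\<close> on \<open>C\<close> and for the induced monad on the quotient.\<close>

locale endofunctor = category C for C :: "('o, 'a) cat" (structure) +
  fixes M :: "('o, 'a) monad"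
  assumes endo: "is_functor C C (Endo M)"
begin

abbreviation "TO \<equiv> OMap (Endo M)"
abbreviation "TA \<equiv> AMap (Endo M)"
abbreviation "Mod \<equiv> module_cat C M"
abbreviation "mhom \<equiv> module_hom C M"

lemmas TO_Obj = functor_Obj[OF endo]
lemmas TA_Hom = functor_Hom[OF endo]
lemmas TA_Idn = functor_Idn[OF endo]
lemmas TA_Comp = functor_Comp[OF endo]

lemma module_hom_Idn: "(X, l) \<in> modules C M \<Longrightarrow> mhom X l X l (Idn C X)"
  using modulesD(1,2)[of X l C M] by (auto simp: module_hom_def TA_Idn Idn_in_Hom Comp_Idn Idn_Comp)

lemma module_hom_Comp:
  assumes f: "mhom X l Y k f" and g: "mhom Y k Z m g"
  shows "mhom X l Z m (g \<cdot> f)"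
proof -
  note f = module_homD[OF f] and g = module_homD[OF g]
  note l = modulesD(2)[OF f(1)] and k = modulesD(2)[OF f(2)] and m = modulesD(2)[OF g(2)]
  note Tf = TA_Hom[OF f(3)] and Tg = TA_Hom[OF g(3)]
  have "(g \<cdot> f) \<cdot> l = g \<cdot> (k \<cdot> TA f)" using Comp_assoc[OF l f(3) g(3)] f(4) by simp
  also have "\<dots> = (m \<cdot> TA g) \<cdot> TA f" using Comp_assoc[OF Tf k g(3)] g(4) by simp
  also have "\<dots> = m \<cdot> TA (g \<cdot> f)" using Comp_assoc[OF Tf Tg m] TA_Comp[OF f(3) g(3)] by simp
  finally show ?thesis using f g Comp_in_Hom[OF f(3) g(3)] by (simp add: module_hom_def)
qed

lemma category_module_cat: "category Mod"
proof
  show "Dom Mod f \<in> Obj Mod" "Cod Mod f \<in> Obj Mod" if "f \<in> Arr Mod" for f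
    using that by (auto elim!: Arr_module_catE dest: module_homD)
  show "Idn Mod P \<in> Hom Mod P P" if "P \<in> Obj Mod" for P
    using that module_hom_Idn by (cases P) auto
  show "g \<cdot>\<^bsub>Mod\<^esub> f \<in> Hom Mod P R" if "f \<in> Hom Mod P Q" "g \<in> Hom Mod Q R" for f g P Q R
    using that module_hom_Comp by (cases P; cases Q; cases R) (auto elim!: Hom_module_catE)
  show "f \<cdot>\<^bsub>Mod\<^esub> Idn Mod P = f" if "f \<in> Hom Mod P Q" for f P Q
    using that by (cases P; cases Q) (auto elim!: Hom_module_catE dest!: module_homD(3) intro: Comp_Idn)
  show "Idn Mod Q \<cdot>\<^bsub>Mod\<^esub> f = f" if "f \<in> Hom Mod P Q" for f P Q
    using that by (cases P; cases Q) (auto elim!: Hom_module_catE dest!: module_homD(3) intro: Idn_Comp)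
  show "h \<cdot>\<^bsub>Mod\<^esub> (g \<cdot>\<^bsub>Mod\<^esub> f) = h \<cdot>\<^bsub>Mod\<^esub> g \<cdot>\<^bsub>Mod\<^esub> f"
    if "f \<in> Hom Mod P Q" "g \<in> Hom Mod Q R" "h \<in> Hom Mod R U" for f g h P Q R U
    using that Comp_assoc
    by (cases P; cases Q; cases R; cases U) (auto elim!: Hom_module_catE dest!: module_homD(3))
qed

lemma module_hom_iso:
  assumes f: "mhom X l Y k f" and iso: "is_iso C f"
  shows "is_iso Mod ((X, l), (Y, k), f)"
proof -
  interpret Mod: category Mod by (rule category_module_cat)
  note fD = module_homD[OF f]
  note l = modulesD(2)[OF fD(1)] and k = modulesD(2)[OF fD(2)]
  obtain g where g: "g \<in> Hom C Y X" "g \<cdot> f = Idn C X" "f \<cdot> g = Idn C Y" using isoE[OF iso fD(3)] .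
  note Tf = TA_Hom[OF fD(3)] and Tg = TA_Hom[OF g(1)]
  have TfTg: "TA f \<cdot> TA g = Idn C (TO Y)"
    using TA_Comp[OF g(1) fD(3)] g(3) TA_Idn[OF Hom_Obj(1)[OF g(1)]] by simp
  have "f \<cdot> (g \<cdot> k) = k" using Comp_assoc[OF k g(1) fD(3)] g(3) Idn_Comp[OF k] by simp
  also have "\<dots> = k \<cdot> (TA f \<cdot> TA g)" using TfTg Comp_Idn[OF k] by simp
  also have "\<dots> = f \<cdot> (l \<cdot> TA g)" using Comp_assoc[OF Tg Tf k] Comp_assoc[OF Tg l fD(3)] fD(4) by simp
  finally have "g \<cdot> k = l \<cdot> TA g"
    by (rule iso_cancel_left[OF iso fD(3) Comp_in_Hom[OF k g(1)] Comp_in_Hom[OF Tg l]])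
  then have "mhom Y k X l g" using fD(1,2) g(1) by (simp add: module_hom_def)
  then show ?thesis
    using f g(2,3) by (intro Mod.isoI[of _ "(X, l)" "(Y, k)" "((Y, k), (X, l), g)"]) auto
qed

text \<open>Linearity of \<open>m\<close> is an equation between arrows out of \<open>TO I\<close>,
  so it is tested after \<open>TA e\<close>.\<close>

lemma module_hom_lift_epi:
  assumes e: "mhom X l I i e" and a: "mhom X l Y k a"
    and epi: "is_epi C (TA e)" and m: "m \<in> Hom C I Y" "m \<cdot> e = a"
  shows "mhom I i Y k m"
proof -
  note e = module_homD[OF e] and a = module_homD[OF a]
  note i = modulesD(2)[OF e(2)] and k = modulesD(2)[OF a(2)] and l = modulesD(2)[OF e(1)]
  note Te = TA_Hom[OF e(3)] and Tm = TA_Hom[OF m(1)]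
  have "(m \<cdot> i) \<cdot> TA e = a \<cdot> l"
    using Comp_assoc[OF Te i m(1)] e(4) Comp_assoc[OF l e(3) m(1)] m(2) by simp
  also have "\<dots> = (k \<cdot> TA m) \<cdot> TA e"
    using a(4) m(2) TA_Comp[OF e(3) m(1)] Comp_assoc[OF Te Tm k] by simp
  finally have "m \<cdot> i = k \<cdot> TA m"
    by (rule epiD[OF epi Te Comp_in_Hom[OF i m(1)] Comp_in_Hom[OF Tm k]])
  then show ?thesis using e a m by (simp add: module_hom_def)
qed

lemma module_hom_lift_mono:
  assumes k: "mhom K i X l k" and a: "mhom W j X l a"
    and mono: "is_mono C k" and u: "u \<in> Hom C W K" "k \<cdot> u = a"
  shows "mhom W j K i u"
proof -
  note k = module_homD[OF k] and a = module_homD[OF a]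
  note i = modulesD(2)[OF k(1)] and j = modulesD(2)[OF a(1)] and l = modulesD(2)[OF k(2)]
  note Tk = TA_Hom[OF k(3)] and Tu = TA_Hom[OF u(1)]
  have "k \<cdot> (u \<cdot> j) = a \<cdot> j" using Comp_assoc[OF j u(1) k(3)] u(2) by simp
  also have "\<dots> = k \<cdot> (i \<cdot> TA u)"
    using a(4) u(2) TA_Comp[OF u(1) k(3)] Comp_assoc[OF Tu Tk l] Comp_assoc[OF Tu i k(3)] k(4) by simp
  finally have "u \<cdot> j = i \<cdot> TA u"
    by (rule monoD[OF mono k(3) Comp_in_Hom[OF j u(1)] Comp_in_Hom[OF Tu i]])
  then show ?thesis using k a u by (simp add: module_hom_def)
qed

end

locale monad_on = category C for C :: "('o, 'a) cat" (structure) +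
  fixes M :: "('o, 'a) monad"
  assumes monad: "is_monad C M"

sublocale monad_on \<subseteq> endofunctor C M
  using monad by unfold_locales (simp add: is_monad_def nat_trans_def)

context monad_on
begin

abbreviation "\<eta> \<equiv> Eta M"
abbreviation "\<mu> \<equiv> Mu M"

lemma eta_Hom: "X \<in> Obj C \<Longrightarrow> \<eta> X \<in> Hom C X (TO X)"
  and eta_nat: "f \<in> Hom C X Y \<Longrightarrow> TA f \<cdot> \<eta> X = \<eta> Y \<cdot> f"
  using monad unfolding is_monad_def nat_trans_def id_functor_def by auto

lemma mu_Hom: "X \<in> Obj C \<Longrightarrow> \<mu> X \<in> Hom C (TO (TO X)) (TO X)"
  and mu_nat: "f \<in> Hom C X Y \<Longrightarrow> TA f \<cdot> \<mu> X = \<mu> Y \<cdot> TA (TA f)"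
  using monad unfolding is_monad_def nat_trans_def comp_functor_def by auto

lemma mu_assoc: "X \<in> Obj C \<Longrightarrow> \<mu> X \<cdot> TA (\<mu> X) = \<mu> X \<cdot> \<mu> (TO X)"
  and mu_TA_eta: "X \<in> Obj C \<Longrightarrow> \<mu> X \<cdot> TA (\<eta> X) = Idn C (TO X)"
  and mu_eta: "X \<in> Obj C \<Longrightarrow> \<mu> X \<cdot> \<eta> (TO X) = Idn C (TO X)"
  using monad unfolding is_monad_def by auto

lemma free_module: "X \<in> Obj C \<Longrightarrow> (TO X, \<mu> X) \<in> modules C M"
  by (simp add: modules_def TO_Obj mu_Hom mu_assoc mu_eta)

lemma free_module_hom: "f \<in> Hom C X Y \<Longrightarrow> mhom (TO X) (\<mu> X) (TO Y) (\<mu> Y) (TA f)"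
  using Hom_Obj[of f X Y] by (simp add: module_hom_def free_module TA_Hom mu_nat)

lemma action_module_hom: "(X, l) \<in> modules C M \<Longrightarrow> mhom (TO X) (\<mu> X) X l l"
  using modulesD[of X l C M] by (simp add: module_hom_def free_module)

text \<open>The module laws of \<open>p\<close> hold after a linear \<open>u\<close>. They become
  laws of \<open>p\<close> itself when \<open>u\<close> is mono, or when they hold along two jointly
  monic arrows, as for pullbacks.\<close>

lemma module_axioms_along_hom:
  assumes X: "(X, l) \<in> modules C M" and u: "u \<in> Hom C P X" and p: "p \<in> Hom C (TO P) P"
    and up: "u \<cdot> p = l \<cdot> TA u"
  shows "u \<cdot> (p \<cdot> TA p) = u \<cdot> (p \<cdot> \<mu> P)" and "u \<cdot> (p \<cdot> \<eta> P) = u"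
proof -
  note l = modulesD[OF X]
  have P: "P \<in> Obj C" using Hom_Obj[OF u] by simp
  note Tu = TA_Hom[OF u] and Tp = TA_Hom[OF p] and Tl = TA_Hom[OF l(2)]
  note mP = mu_Hom[OF P] and eP = eta_Hom[OF P] and mX = mu_Hom[OF l(1)] and eX = eta_Hom[OF l(1)]
  note TTu = TA_Hom[OF Tu]
  have "u \<cdot> (p \<cdot> TA p) = l \<cdot> (TA u \<cdot> TA p)"
    using Comp_assoc[OF Tp p u] up Comp_assoc[OF Tp Tu l(2)] by simp
  also have "TA u \<cdot> TA p = TA l \<cdot> TA (TA u)"
    using TA_Comp[OF p u] TA_Comp[OF Tu l(2)] up by simp
  also have "l \<cdot> (TA l \<cdot> TA (TA u)) = (l \<cdot> \<mu> X) \<cdot> TA (TA u)"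
    using Comp_assoc[OF TTu Tl l(2)] l(3) by simp
  also have "\<dots> = l \<cdot> (TA u \<cdot> \<mu> P)" using Comp_assoc[OF TTu mX l(2)] mu_nat[OF u] by simp
  also have "\<dots> = u \<cdot> (p \<cdot> \<mu> P)" using Comp_assoc[OF mP Tu l(2)] up Comp_assoc[OF mP p u] by simp
  finally show "u \<cdot> (p \<cdot> TA p) = u \<cdot> (p \<cdot> \<mu> P)" .
  have "u \<cdot> (p \<cdot> \<eta> P) = l \<cdot> (TA u \<cdot> \<eta> P)"
    using Comp_assoc[OF eP p u] up Comp_assoc[OF eP Tu l(2)] by simp
  also have "\<dots> = (l \<cdot> \<eta> X) \<cdot> u" using eta_nat[OF u] Comp_assoc[OF u eX l(2)] by simp
  also have "\<dots> = u" using l(4) Idn_Comp[OF u] by simp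
  finally show "u \<cdot> (p \<cdot> \<eta> P) = u" .
qed

lemma submodule:
  assumes X: "(X, l) \<in> modules C M" and u: "u \<in> Hom C P X" "is_mono C u" and p: "p \<in> Hom C (TO P) P"
    and up: "u \<cdot> p = l \<cdot> TA u"
  shows "mhom P p X l u"
proof -
  note * = module_axioms_along_hom[OF X u(1) p up]
  have P: "P \<in> Obj C" using Hom_Obj[OF u(1)] by simp
  have "p \<cdot> TA p = p \<cdot> \<mu> P"
    using monoD[OF u(2,1) Comp_in_Hom[OF TA_Hom[OF p] p] Comp_in_Hom[OF mu_Hom[OF P] p]] * by simp
  moreover have "p \<cdot> \<eta> P = Idn C P"
    using monoD[OF u(2,1) Comp_in_Hom[OF eta_Hom[OF P] p] Idn_in_Hom[OF P]] * Comp_Idn[OF u(1)] by simp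
  ultimately show ?thesis using X u p up P by (simp add: module_hom_def modules_def)
qed

text \<open>Associativity of the quotient action is an equation out of \<open>TO (TO Y)\<close> and
  is tested after \<open>TA (TA c)\<close>; the unit law is tested after \<open>c\<close>.\<close>

lemma quotient_module:
  assumes X: "(X, l) \<in> modules C M" and c: "c \<in> Hom C X Y" "is_epi C c" "is_epi C (TA (TA c))"
    and p: "p \<in> Hom C (TO Y) Y" and pc: "p \<cdot> TA c = c \<cdot> l"
  shows "mhom X l Y p c"
proof -
  note l = modulesD[OF X]
  have Y: "Y \<in> Obj C" using Hom_Obj[OF c(1)] by simp
  note Tc = TA_Hom[OF c(1)] and Tp = TA_Hom[OF p] and Tl = TA_Hom[OF l(2)]
  note mY = mu_Hom[OF Y] and eY = eta_Hom[OF Y] and mX = mu_Hom[OF l(1)] and eX = eta_Hom[OF l(1)]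
  note TTc = TA_Hom[OF Tc]
  have "(p \<cdot> TA p) \<cdot> TA (TA c) = p \<cdot> (TA c \<cdot> TA l)"
    using Comp_assoc[OF TTc Tp p] TA_Comp[OF Tc p] TA_Comp[OF l(2) c(1)] pc by simp
  also have "\<dots> = c \<cdot> (l \<cdot> \<mu> X)"
    using Comp_assoc[OF Tl Tc p] pc Comp_assoc[OF Tl l(2) c(1)] l(3) by simp
  also have "\<dots> = p \<cdot> (TA c \<cdot> \<mu> X)"
    using Comp_assoc[OF mX l(2) c(1)] pc Comp_assoc[OF mX Tc p] by simp
  also have "\<dots> = (p \<cdot> \<mu> Y) \<cdot> TA (TA c)" using mu_nat[OF c(1)] Comp_assoc[OF TTc mY p] by simp
  finally have 1: "p \<cdot> TA p = p \<cdot> \<mu> Y"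
    by (rule epiD[OF c(3) TTc Comp_in_Hom[OF Tp p] Comp_in_Hom[OF mY p]])
  have "(p \<cdot> \<eta> Y) \<cdot> c = p \<cdot> (TA c \<cdot> \<eta> X)"
    using Comp_assoc[OF c(1) eY p] eta_nat[OF c(1)] by simp
  also have "\<dots> = c \<cdot> (l \<cdot> \<eta> X)" using Comp_assoc[OF eX Tc p] pc Comp_assoc[OF eX l(2) c(1)] by simp
  also have "\<dots> = Idn C Y \<cdot> c" using l(4) Comp_Idn[OF c(1)] Idn_Comp[OF c(1)] by simp
  finally have 2: "p \<cdot> \<eta> Y = Idn C Y"
    by (rule epiD[OF c(2,1) Comp_in_Hom[OF eY p] Idn_in_Hom[OF Y]])
  show ?thesis using X c p pc Y 1 2 by (simp add: module_hom_def modules_def)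
qed

text \<open>The action is the arrow into the pullback with components \<open>l \<cdot> TA u\<close>
  and \<open>m \<cdot> TA v\<close>.\<close>

lemma pullback_module:
  assumes f: "mhom X l Y k f" and t: "mhom Z m Y k t"
    and pb: "is_pullback C f t u v"
  obtains p where "mhom (Dom C u) p X l u" and "mhom (Dom C u) p Z m v"
proof -
  note f = module_homD[OF f] and t = module_homD[OF t]
  define P where "P = Dom C u"
  note u = is_pullbackD[OF pb f(3) t(3), folded P_def]
  note l = modulesD(2)[OF f(1)] and k = modulesD(2)[OF f(2)] and m = modulesD(2)[OF t(1)]
  note Tu = TA_Hom[OF u(1)] and Tv = TA_Hom[OF u(2)] and Tf = TA_Hom[OF f(3)] and Tt = TA_Hom[OF t(3)]
  have P: "P \<in> Obj C" using Hom_Obj[OF u(1)] by simp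
  have "f \<cdot> (l \<cdot> TA u) = k \<cdot> TA (f \<cdot> u)"
    using Comp_assoc[OF Tu l f(3)] f(4) Comp_assoc[OF Tu Tf k] TA_Comp[OF u(1) f(3)] by simp
  also have "\<dots> = t \<cdot> (m \<cdot> TA v)"
    unfolding u(3) using Comp_assoc[OF Tv m t(3)] t(4) Comp_assoc[OF Tv Tt k] TA_Comp[OF u(2) t(3)] by simp
  finally obtain p where p: "p \<in> Hom C (TO P) P" "u \<cdot> p = l \<cdot> TA u" "v \<cdot> p = m \<cdot> TA v"
    using u(4)[OF Comp_in_Hom[OF Tu l] Comp_in_Hom[OF Tv m]] by blast
  note 1 = module_axioms_along_hom[OF f(1) u(1) p(1,2)] and 2 = module_axioms_along_hom[OF t(1) u(2) p(1,3)]
  note eq = pullback_Hom_eq[OF pb f(3) t(3), folded P_def]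
  have "p \<cdot> TA p = p \<cdot> \<mu> P"
    by (rule eq[OF Comp_in_Hom[OF TA_Hom[OF p(1)] p(1)] Comp_in_Hom[OF mu_Hom[OF P] p(1)] 1(1) 2(1)])
  moreover have "p \<cdot> \<eta> P = Idn C P"
    using 1(2) 2(2) Comp_Idn[OF u(1)] Comp_Idn[OF u(2)]
    by (intro eq[OF Comp_in_Hom[OF eta_Hom[OF P] p(1)] Idn_in_Hom[OF P]]) auto
  ultimately have "(P, p) \<in> modules C M" using p(1) P by (simp add: modules_def)
  then show ?thesis using that[of p] f t u p by (simp add: module_hom_def P_def)
qed

end


section \<open>Exact monads preserving a Serre subcategory\<close>

locale exact_monad_serre = serre C add zero N + monad_on C M
  for C :: "('o, 'a) cat" (structure) and add zero N and M :: "('o, 'a) monad" +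
  assumes exact: "exact_functor C C (Endo M)"
    and TO_N: "X \<in> N \<Longrightarrow> OMap (Endo M) X \<in> N"
begin

section \<open>What the exact endofunctor preserves\<close>

lemma TA_short_exact: "short_exact C i p \<Longrightarrow> short_exact C (TA i) (TA p)"
  using exact by (simp add: exact_functor_def)

lemma mono_short_exact:
  assumes "is_mono C m" and "m \<in> Hom C X Y" and "is_cokernel C c m"
  shows "short_exact C m c"
  using mono_is_kernel[OF assms] assms(3) by (simp add: short_exact_def)

lemma epi_short_exact:
  assumes "is_epi C e" and "e \<in> Hom C X Y" and "is_kernel C k e"
  shows "short_exact C k e"
  using epi_is_cokernel[OF assms] assms(3) by (simp add: short_exact_def)

lemma TA_mono:
  assumes m: "is_mono C m" "m \<in> Hom C X Y"
  shows "is_mono C (TA m)"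
proof -
  obtain Z c where c: "is_cokernel C c m" "c \<in> Hom C Y Z" using cokernelE[OF m(2)] by metis
  have "is_kernel C (TA m) (TA c)"
    using TA_short_exact[OF mono_short_exact[OF m c(1)]] by (simp add: short_exact_def)
  then show ?thesis using kernelD(3) TA_Hom[OF c(2)] by blast
qed

lemma TA_epi:
  assumes e: "is_epi C e" "e \<in> Hom C X Y"
  shows "is_epi C (TA e)"
proof -
  obtain K k where k: "is_kernel C k e" "k \<in> Hom C K X" using kernelE[OF e(2)] by metis
  have "is_cokernel C (TA e) (TA k)"
    using TA_short_exact[OF epi_short_exact[OF e k(1)]] by (simp add: short_exact_def)
  then show ?thesis using cokernelD(3) TA_Hom[OF k(2)] by blast
qed

text \<open>Exactness speaks of short exact sequences. Replacing \<open>f\<close> by the mono part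
  of its image factorisation keeps the cokernel, and the epi part stays epi under
  \<open>TA\<close>.\<close>

lemma TA_cokernel:
  assumes f: "f \<in> Hom C X Y" and c: "is_cokernel C c f"
  shows "is_cokernel C (TA c) (TA f)"
proof -
  obtain I e m where e: "e \<in> Hom C X I" "is_epi C e" and m: "m \<in> Hom C I Y" "is_mono C m" and fme: "f = m \<cdot> e"
    using imageE[OF f] by metis
  have "is_cokernel C c m" using c cokernel_Comp_epi[OF e(2,1) m(1)] fme by simp
  then have "is_cokernel C (TA c) (TA m)"
    using TA_short_exact[OF mono_short_exact[OF m(2,1)]] by (simp add: short_exact_def)
  then show ?thesis
    using cokernel_Comp_epi[OF TA_epi[OF e(2,1)] TA_Hom[OF e(1)] TA_Hom[OF m(1)]] TA_Comp[OF e(1) m(1)] fme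
    by simp
qed

text \<open>For a zero object \<open>Z\<close> the identity is its own kernel and cokernel. Applying
  \<open>TA\<close> to this short exact sequence shows the same for \<open>TO Z\<close>, so the
  identity of \<open>TO Z\<close> is zero and every arrow through it vanishes.\<close>

lemma TA_zero:
  assumes X: "X \<in> Obj C" and Y: "Y \<in> Obj C"
  shows "TA (zero X Y) = zero (TO X) (TO Y)"
proof -
  obtain Z where Z: "zero_object C Z" using zero_object_ex by blast
  then have ZO: "Z \<in> Obj C" by (simp add: zero_object_def)
  have id0: "Idn C Z = zero Z Z" using zero_object_Hom_unique(1)[OF Z Idn_in_Hom[OF ZO]] .
  have "is_kernel C (Idn C Z) (Idn C Z)"
  proof (rule kernelI[OF Idn_in_Hom[OF ZO] Idn_in_Hom[OF ZO] Idn_mono[OF ZO]])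
    show "Idn C Z \<cdot> Idn C Z = zero Z Z" using id0 Idn_Comp[OF Idn_in_Hom[OF ZO]] by simp
    show "\<exists>u \<in> Hom C W Z. Idn C Z \<cdot> u = h" if "h \<in> Hom C W Z" for W h using that Idn_Comp by blast
  qed
  then have "short_exact C (Idn C Z) (Idn C Z)" using mono_kernel_N epi_short_exact[OF _ Idn_in_Hom[OF ZO]]
      abelian.Idn_mono[OF abelian_op] ZO by simp
  then have "is_kernel C (Idn C (TO Z)) (Idn C (TO Z))"
    using TA_short_exact TA_Idn[OF ZO] by (fastforce simp: short_exact_def)
  then have id0': "Idn C (TO Z) = zero (TO Z) (TO Z)"
    using kernelD(2)[of "Idn C (TO Z)" "Idn C (TO Z)" "TO Z" "TO Z"] TO_Obj[OF ZO] by (simp add: Idn_in_Hom)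
  have z: "zero X Z \<in> Hom C X Z" "zero Z Y \<in> Hom C Z Y" using zero_Hom X Y ZO by auto
  have "TA (zero X Y) = TA (zero Z Y) \<cdot> TA (zero X Z)"
    using TA_Comp[OF z] Comp_zero[OF z(2) X] by simp
  also have "\<dots> = TA (zero Z Y) \<cdot> (Idn C (TO Z) \<cdot> TA (zero X Z))" using Idn_Comp[OF TA_Hom[OF z(1)]] by simp
  also have "\<dots> = zero (TO X) (TO Y)"
    unfolding id0' using zero_Comp[OF TA_Hom[OF z(1)] TO_Obj[OF ZO]] Comp_zero[OF TA_Hom[OF z(2)] TO_Obj[OF X]]
    by simp
  finally show ?thesis .
qed

text \<open>Additivity is derived from the biproduct presentation of a sum.\<close>

lemma TA_add:
  assumes a: "a \<in> Hom C W X" and b: "b \<in> Hom C W X"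
  shows "TA (add a b) = add (TA a) (TA b)"
proof -
  have X: "X \<in> Obj C" using Hom_Obj[OF a] by simp
  obtain B i j p r where i: "i \<in> Hom C X B" and j: "j \<in> Hom C X B" and p: "p \<in> Hom C B X"
    and r: "r \<in> Hom C B X" and pi: "p \<cdot> i = Idn C X" and rj: "r \<cdot> j = Idn C X"
    and pj: "p \<cdot> j = zero X X" and ri: "r \<cdot> i = zero X X" and sum: "add (i \<cdot> p) (j \<cdot> r) = Idn C B"
    using biproductE[OF X X] .
  have B: "B \<in> Obj C" using Hom_Obj[OF i] by simp
  have mono_i: "is_mono C i" using mono_of_Comp[OF _ i p] pi Idn_mono[OF X] by simp
  have epi_r: "is_epi C r"
    using epi_of_Comp[OF _ j r] rj abelian.Idn_mono[OF abelian_op, of X] X by simp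
  \<comment> \<open>The biproduct seen as a split short exact sequence, the form to which exactness
    applies.\<close>
  have "is_kernel C i r"
  proof (rule kernelI[OF i r mono_i ri])
    fix V h assume h: "h \<in> Hom C V B" and rh: "r \<cdot> h = zero V X"
    note ph = Comp_in_Hom[OF h p]
    have "i \<cdot> (p \<cdot> h) = h"
    proof (rule biproduct_Hom_eq[OF i j p r sum Comp_in_Hom[OF ph i] h])
      show "p \<cdot> (i \<cdot> (p \<cdot> h)) = p \<cdot> h" using Comp_assoc[OF ph i p] pi Idn_Comp[OF ph] by simp
      show "r \<cdot> (i \<cdot> (p \<cdot> h)) = r \<cdot> h" using Comp_assoc[OF ph i r] ri zero_Comp[OF ph X] rh by simp
    qed
    then show "\<exists>u \<in> Hom C V X. i \<cdot> u = h" using ph by blast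
  qed
  then have ir: "is_kernel C (TA i) (TA r)"
    using TA_short_exact[OF epi_short_exact[OF epi_r r]] by (simp add: short_exact_def)
  note Ti = TA_Hom[OF i] and Tj = TA_Hom[OF j] and Tp = TA_Hom[OF p] and Tr = TA_Hom[OF r]
  note Tip = Comp_in_Hom[OF Tp Ti] and Tjr = Comp_in_Hom[OF Tr Tj]
  have TX: "TO X \<in> Obj C" "TO B \<in> Obj C" using TO_Obj X B by auto
  have Tpi: "TA p \<cdot> TA i = Idn C (TO X)" "TA r \<cdot> TA j = Idn C (TO X)"
    "TA p \<cdot> TA j = zero (TO X) (TO X)" "TA r \<cdot> TA i = zero (TO X) (TO X)"
    using TA_Comp[OF i p] TA_Comp[OF j r] TA_Comp[OF j p] TA_Comp[OF i r] pi rj pj ri TA_Idn[OF X]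
      TA_zero[OF X X] by auto
  \<comment> \<open>\<open>TO B\<close> is again a biproduct: the difference \<open>d\<close> of the
    identity and this sum is killed by \<open>TA r\<close>, so it factors through the kernel
    \<open>TA i\<close>, and being killed by \<open>TA p\<close> as well it vanishes.\<close>
  have "add (TA i \<cdot> TA p) (TA j \<cdot> TA r) = Idn C (TO B)"
  proof -
    let ?e = "add (TA i \<cdot> TA p) (TA j \<cdot> TA r)"
    note e = add_Hom[OF Tip Tjr]
    obtain d where d: "d \<in> Hom C (TO B) (TO B)" "add d ?e = Idn C (TO B)"
      and dl: "\<And>h Z. h \<in> Hom C (TO B) Z \<Longrightarrow> h \<cdot> d = zero (TO B) Z \<longleftrightarrow> h \<cdot> Idn C (TO B) = h \<cdot> ?e"
      using differenceE[OF Idn_in_Hom[OF TX(2)] e] by metis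
    have "TA r \<cdot> (TA j \<cdot> TA r) = TA r" "TA r \<cdot> (TA i \<cdot> TA p) = zero (TO B) (TO X)"
      "TA p \<cdot> (TA i \<cdot> TA p) = TA p" "TA p \<cdot> (TA j \<cdot> TA r) = zero (TO B) (TO X)"
      using Comp_assoc[OF Tr Tj Tr] Comp_assoc[OF Tp Ti Tr] Comp_assoc[OF Tp Ti Tp] Comp_assoc[OF Tr Tj Tp]
        Tpi Idn_Comp[OF Tr] Idn_Comp[OF Tp] zero_Comp[OF Tp TX(1)] zero_Comp[OF Tr TX(1)] by auto
    then have "TA r \<cdot> ?e = TA r" "TA p \<cdot> ?e = TA p"
      using Comp_add[OF Tip Tjr Tr] Comp_add[OF Tip Tjr Tp] add_zero[OF Tr] add_zero[OF Tp] by auto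
    then have 0: "TA r \<cdot> d = zero (TO B) (TO X)" "TA p \<cdot> d = zero (TO B) (TO X)"
      using dl[OF Tr] dl[OF Tp] Comp_Idn[OF Tr] Comp_Idn[OF Tp] by auto
    have "Dom C (TA i) = TO X" using Ti by (simp add: Hom_def)
    then obtain u where u: "u \<in> Hom C (TO B) (TO X)" "TA i \<cdot> u = d"
      using kernel_factor[OF ir Tr d(1) 0(1)] by metis
    have "u = TA p \<cdot> d" using u(2) Comp_assoc[OF u(1) Ti Tp] Tpi(1) Idn_Comp[OF u(1)] by simp
    then have "d = zero (TO B) (TO B)" using 0(2) u(2) Comp_zero[OF Ti TX(2)] by simp
    then show ?thesis using d(2) add_zero(2)[OF e] by simp
  qed
  then have TA_eq: "TA h = add (TA (h \<cdot> i) \<cdot> TA p) (TA (h \<cdot> j) \<cdot> TA r)" if h: "h \<in> Hom C B X" for h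
    using Comp_add[OF Tip Tjr TA_Hom[OF h]] Comp_Idn[OF TA_Hom[OF h]] Comp_assoc[OF Tp Ti TA_Hom[OF h]]
      Comp_assoc[OF Tr Tj TA_Hom[OF h]] TA_Comp[OF i h] TA_Comp[OF j h] by simp
  \<comment> \<open>The codiagonal of the biproduct; \<open>add a b\<close> is \<open>s\<close>
    after the pairing of \<open>a\<close> and \<open>b\<close>.\<close>
  define s where "s = add p r"
  have s: "s \<in> Hom C B X" unfolding s_def using add_Hom[OF p r] .
  have si: "s \<cdot> i = Idn C X" "s \<cdot> j = Idn C X"
    unfolding s_def using add_Comp[OF p r i] add_Comp[OF p r j] pi pj ri rj add_zero[OF Idn_in_Hom[OF X]] by auto
  have Ts: "TA s = add (TA p) (TA r)"
    using TA_eq[OF s] si TA_Idn[OF X] Idn_Comp[OF Tp] Idn_Comp[OF Tr] by simp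
  define d where "d = add (i \<cdot> a) (j \<cdot> b)"
  note d = biproduct_pair[OF i j p r pi rj pj ri a b, folded d_def]
  have "add a b = s \<cdot> d" unfolding s_def using add_Comp[OF p r d(1)] d by simp
  then have "TA (add a b) = add (TA p) (TA r) \<cdot> TA d" using TA_Comp[OF d(1) s] Ts by simp
  also have "\<dots> = add (TA a) (TA b)"
    using add_Comp[OF Tp Tr TA_Hom[OF d(1)]] TA_Comp[OF d(1) p] TA_Comp[OF d(1) r] d by simp
  finally show ?thesis .
qed

text \<open>Through the image factorisation the kernel and the cokernel of \<open>s\<close> sit in
  short exact sequences. \<open>TA\<close> preserves these, and \<open>TO\<close> keeps their outer
  objects in \<open>N\<close>.\<close>

lemma TA_N_iso:
  assumes s: "s \<in> S"
  shows "TA s \<in> S"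
proof -
  obtain X Y where sX: "s \<in> Hom C X Y" using N_iso_Arr[OF s] by (auto simp: Hom_def)
  obtain I e m where e: "e \<in> Hom C X I" "is_epi C e" "e \<in> S"
    and m: "m \<in> Hom C I Y" "is_mono C m" "m \<in> S" and sme: "s = m \<cdot> e"
    using N_iso_factorisation[OF sX s] .
  obtain K k where k: "is_kernel C k e" "k \<in> Hom C K X" using kernelE[OF e(1)] by metis
  obtain J c where c: "is_cokernel C c m" "c \<in> Hom C Y J" using cokernelE[OF m(1)] by metis
  have N: "TO K \<in> N" "TO J \<in> N"
    using N_iso_kernel[OF e(3) k(1)] N_iso_cokernel[OF m(3) c(1)] TO_N k(2) c(2) by (auto simp: Hom_def)
  have "is_kernel C (TA k) (TA e)" "is_cokernel C (TA c) (TA m)"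
    using TA_short_exact[OF epi_short_exact[OF e(2,1) k(1)]] TA_short_exact[OF mono_short_exact[OF m(2,1) c(1)]]
    by (auto simp: short_exact_def)
  then have "TA e \<in> S" "TA m \<in> S"
    using N_iso_epi[OF TA_epi[OF e(2,1)] TA_Hom[OF e(1)]] N_iso_mono[OF TA_mono[OF m(2,1)] TA_Hom[OF m(1)]]
      TA_Hom[OF k(2)] TA_Hom[OF c(2)] N by (auto simp: Hom_def)
  then show ?thesis
    using Comp_N_iso TA_Hom[OF e(1)] TA_Hom[OF m(1)] TA_Comp[OF e(1) m(1)] sme by (simp add: Hom_def)
qed

text \<open>The action of \<open>X\<close> restricts to the kernel since \<open>f\<close> kills
  \<open>l \<cdot> TA k\<close>; by linearity this comes down to \<open>TA\<close> preserving zero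
  arrows.\<close>

lemma kernel_module:
  assumes f: "mhom X l Y y f" and k: "is_kernel C k f"
  obtains p where "mhom (Dom C k) p X l k"
proof -
  note f = module_homD[OF f]
  note l = modulesD(2)[OF f(1)] and y = modulesD(2)[OF f(2)]
  define K where "K = Dom C k"
  note kD = kernelD[OF k f(3), folded K_def]
  note Tk = TA_Hom[OF kD(1)] and Tf = TA_Hom[OF f(3)]
  have O: "K \<in> Obj C" "Y \<in> Obj C" using Hom_Obj[OF kD(1)] Hom_Obj[OF f(3)] by auto
  have "f \<cdot> (l \<cdot> TA k) = y \<cdot> TA (f \<cdot> k)"
    using Comp_assoc[OF Tk l f(3)] f(4) Comp_assoc[OF Tk Tf y] TA_Comp[OF kD(1) f(3)] by simp
  also have "\<dots> = zero (TO K) Y"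
    unfolding kD(2) using TA_zero[OF O] Comp_zero[OF y TO_Obj[OF O(1)]] by simp
  finally obtain p where p: "p \<in> Hom C (TO K) K" "k \<cdot> p = l \<cdot> TA k"
    using kernel_factor[OF k f(3) Comp_in_Hom[OF Tk l]] K_def by metis
  show ?thesis using that submodule[OF f(1) kD(1,3) p] by (simp add: K_def)
qed

text \<open>The action descends because \<open>TA c\<close> is again a cokernel of
  \<open>TA f\<close>, and the module laws descend because \<open>TA\<close> preserves epis.\<close>

lemma cokernel_module:
  assumes f: "mhom X l Y y f" and c: "is_cokernel C c f"
  obtains p where "mhom Y y (Cod C c) p c"
proof -
  note f = module_homD[OF f]
  note l = modulesD(2)[OF f(1)] and y = modulesD(2)[OF f(2)]
  define Z where "Z = Cod C c"
  note cD = cokernelD[OF c f(3), folded Z_def]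
  note Tc = TA_Hom[OF cD(1)] and Tf = TA_Hom[OF f(3)]
  have O: "X \<in> Obj C" "Z \<in> Obj C" using Hom_Obj[OF cD(1)] Hom_Obj[OF f(3)] by auto
  have "(c \<cdot> y) \<cdot> TA f = (c \<cdot> f) \<cdot> l"
    using Comp_assoc[OF Tf y cD(1)] f(4) Comp_assoc[OF l f(3) cD(1)] by simp
  also have "\<dots> = zero (TO X) Z" unfolding cD(2) using zero_Comp[OF l O(2)] by simp
  finally obtain p where p: "p \<in> Hom C (TO Z) Z" "p \<cdot> TA c = c \<cdot> y"
    using cokernel_factor[OF TA_cokernel[OF f(3) c] Tf Comp_in_Hom[OF y cD(1)]] Tc by (auto simp: Hom_def)
  show ?thesis
    using that quotient_module[OF f(2) cD(1,3) TA_epi[OF TA_epi[OF cD(3,1)] Tc] p] by (simp add: Z_def)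
qed

text \<open>This is where additivity of \<open>TA\<close> enters; it makes equalisers and
  coequalisers of module arrows into kernels and cokernels of module arrows.\<close>

lemma difference_module_hom:
  assumes f: "mhom X l Y y f" and g: "mhom X l Y y g"
    and d: "d \<in> Hom C X Y" "add d g = f"
  shows "mhom X l Y y d"
proof -
  note f = module_homD[OF f] and g = module_homD[OF g]
  note l = modulesD(2)[OF f(1)] and y = modulesD(2)[OF f(2)]
  note Tg = TA_Hom[OF g(3)] and Td = TA_Hom[OF d(1)]
  note yg = Comp_in_Hom[OF Tg y]
  have "add (d \<cdot> l) (y \<cdot> TA g) = f \<cdot> l" using add_Comp[OF d(1) g(3) l] d(2) g(4) by simp
  also have "\<dots> = add (y \<cdot> TA d) (y \<cdot> TA g)"
    using f(4) d(2) TA_add[OF d(1) g(3)] Comp_add[OF Td Tg y] by simp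
  finally have "d \<cdot> l = y \<cdot> TA d"
    by (rule add_right_cancel[OF Comp_in_Hom[OF l d(1)] Comp_in_Hom[OF Td y] yg])
  then show ?thesis using f d by (simp add: module_hom_def)
qed

section \<open>The category of modules and its inverted arrows\<close>

abbreviation "NMod \<equiv> modules_in C M N"
abbreviation "SMod \<equiv> N_iso Mod NMod"

sublocale Mod: category Mod by (rule category_module_cat)

lemma zero_module_hom:
  assumes "(X, l) \<in> modules C M" and "(Y, k) \<in> modules C M"
  shows "mhom X l Y k (zero X Y)"
  using modulesD(1,2)[OF assms(1)] modulesD(1,2)[OF assms(2)] assms
  by (simp add: module_hom_def zero_Hom TA_zero zero_Comp Comp_zero TO_Obj)

lemma zero_module:
  assumes Z: "zero_object C Z"
  shows "zero_object Mod (Z, zero (TO Z) Z)"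
proof -
  have ZO: "Z \<in> Obj C" using Z by (simp add: zero_object_def)
  define z where "z = zero (TO Z) Z"
  have z: "z \<in> Hom C (TO Z) Z" unfolding z_def using zero_Hom TO_Obj ZO by simp
  have "z \<cdot> TA z = z \<cdot> \<mu> Z"
    using zero_object_Hom_unique(1)[OF Z Comp_in_Hom[OF TA_Hom[OF z] z]]
      zero_object_Hom_unique(1)[OF Z Comp_in_Hom[OF mu_Hom[OF ZO] z]] by simp
  moreover have "z \<cdot> \<eta> Z = Idn C Z"
    using zero_object_Hom_unique(1)[OF Z Comp_in_Hom[OF eta_Hom[OF ZO] z]]
      zero_object_Hom_unique(1)[OF Z Idn_in_Hom[OF ZO]] by simp
  ultimately have zM: "(Z, z) \<in> modules C M" using z ZO by (simp add: modules_def)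
  have "(\<exists>!f. f \<in> Hom Mod P (Z, z)) \<and> (\<exists>!f. f \<in> Hom Mod (Z, z) P)" if P: "P \<in> modules C M" for P
  proof -
    obtain X l where Xl: "P = (X, l)" by fastforce
    have "h = ((X, l), (Z, z), zero X Z)" if "h \<in> Hom Mod (X, l) (Z, z)" for h
      using that zero_object_Hom_unique(1)[OF Z] by (auto elim!: Hom_module_catE dest: module_homD(3))
    moreover have "h = ((Z, z), (X, l), zero Z X)" if "h \<in> Hom Mod (Z, z) (X, l)" for h
      using that zero_object_Hom_unique(2)[OF Z] by (auto elim!: Hom_module_catE dest: module_homD(3))
    moreover have "((X, l), (Z, z), zero X Z) \<in> Hom Mod (X, l) (Z, z)"
      "((Z, z), (X, l), zero Z X) \<in> Hom Mod (Z, z) (X, l)"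
      using zero_module_hom zM P Xl by auto
    ultimately show ?thesis unfolding Xl by blast
  qed
  then show ?thesis using zM by (simp add: zero_object_def z_def)
qed

lemma zero_arrow_Mod:
  assumes f: "mhom X l Y k f"
  shows "zero_arrow Mod ((X, l), (Y, k), f) \<longleftrightarrow> f = zero X Y"
proof
  note fD = module_homD[OF f]
  have XO: "X \<in> Obj C" and YO: "Y \<in> Obj C" using Hom_Obj[OF fD(3)] by auto
  {
    assume "zero_arrow Mod ((X, l), (Y, k), f)"
    then obtain R g h where R: "zero_object Mod R" and gh: "g \<in> Hom Mod (X, l) R" "h \<in> Hom Mod R (Y, k)"
      "((X, l), (Y, k), f) = h \<cdot>\<^bsub>Mod\<^esub> g"
      unfolding zero_arrow_def by auto
    obtain Z z where Zz: "R = (Z, z)" by fastforce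
    obtain g' where g: "g = ((X, l), (Z, z), g')" "mhom X l Z z g'"
      using gh(1) unfolding Zz by (rule Hom_module_catE)
    obtain h' where h: "h = ((Z, z), (Y, k), h')" "mhom Z z Y k h'"
      using gh(2) unfolding Zz by (rule Hom_module_catE)
    note gD = module_homD[OF g(2)] and hD = module_homD[OF h(2)]
    have ZO: "Z \<in> Obj C" using modulesD(1)[OF hD(1)] .
    \<comment> \<open>The identity and the zero arrow are both endomorphisms of the zero module
      \<open>(Z, z)\<close>, so they coincide.\<close>
    have "\<exists>!f. f \<in> Hom Mod (Z, z) (Z, z)" using R hD(1) unfolding Zz zero_object_def by simp
    moreover have "((Z, z), (Z, z), Idn C Z) \<in> Hom Mod (Z, z) (Z, z)"
      "((Z, z), (Z, z), zero Z Z) \<in> Hom Mod (Z, z) (Z, z)"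
      using module_hom_Idn[OF hD(1)] zero_module_hom[OF hD(1) hD(1)] by auto
    ultimately have "Idn C Z = zero Z Z" by blast
    then have "g' = zero X Z" using Idn_Comp[OF gD(3)] zero_Comp[OF gD(3) ZO] by simp
    then show "f = zero X Y" using gh(3) g(1) h(1) Comp_zero[OF hD(3) XO] by simp
  }
  assume f0: "f = zero X Y"
  obtain Z where Z: "zero_object C Z" using zero_object_ex by blast
  then have ZO: "Z \<in> Obj C" by (simp add: zero_object_def)
  note ZM = zero_module[OF Z]
  define z where "z = zero (TO Z) Z"
  have zM: "(Z, z) \<in> modules C M" using ZM by (simp add: zero_object_def z_def)
  have "f = zero Z Y \<cdot> zero X Z" using f0 Comp_zero[OF zero_Hom[OF ZO YO] XO] by simp
  then have "((X, l), (Z, z), zero X Z) \<in> Hom Mod (X, l) (Z, z)"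
    "((Z, z), (Y, k), zero Z Y) \<in> Hom Mod (Z, z) (Y, k)"
    "((X, l), (Y, k), f) = ((Z, z), (Y, k), zero Z Y) \<cdot>\<^bsub>Mod\<^esub> ((X, l), (Z, z), zero X Z)"
    using zero_module_hom fD(1,2) zM by auto
  then show "zero_arrow Mod ((X, l), (Y, k), f)"
    unfolding zero_arrow_def using ZM[folded z_def] by (metis module_cat_simps(2,3))
qed

text \<open>A factorisation found in \<open>C\<close> is automatically linear because
  \<open>k\<close> is mono.\<close>

lemma is_kernel_Mod:
  assumes f: "mhom X l Y y f" and k: "is_kernel C k f" and kM: "mhom K p X l k"
  shows "is_kernel Mod ((K, p), (X, l), k) ((X, l), (Y, y), f)"
proof -
  note fD = module_homD[OF f] and kD = module_homD[OF kM]
  note kk = kernelD[OF k fD(3)]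
  have DK: "Dom C k = K" using kD(3) by (simp add: Hom_def)
  note fk = module_hom_Comp[OF kM f]
  have "\<exists>!u. u \<in> Hom Mod (W, w) (K, p) \<and> ((K, p), (X, l), k) \<cdot>\<^bsub>Mod\<^esub> u = ((W, w), (X, l), h)"
    if h: "mhom W w X l h" and 0: "f \<cdot> h = zero W Y" for W w h
  proof -
    obtain u where u: "u \<in> Hom C W K" "k \<cdot> u = h"
      using kernel_factor[OF k fD(3) module_homD(3)[OF h] 0] DK by metis
    note uM = module_hom_lift_mono[OF kM h kk(3) u]
    have "v = ((W, w), (K, p), u)"
      if v0: "v \<in> Hom Mod (W, w) (K, p)" "((K, p), (X, l), k) \<cdot>\<^bsub>Mod\<^esub> v = ((W, w), (X, l), h)" for v
    proof -
      obtain v' where v: "v = ((W, w), (K, p), v')" "mhom W w K p v'"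
        using Hom_module_catE[OF v0(1)] .
      then have "k \<cdot> v' = k \<cdot> u" using v0(2) u(2) by simp
      then show ?thesis using monoD[OF kk(3) kD(3) module_homD(3)[OF v(2)] u(1)] v(1) by simp
    qed
    moreover have "((W, w), (K, p), u) \<in> Hom Mod (W, w) (K, p)" using uM by simp
    moreover have "((K, p), (X, l), k) \<cdot>\<^bsub>Mod\<^esub> ((W, w), (K, p), u) = ((W, w), (X, l), h)" using u by simp
    ultimately show ?thesis by blast
  qed
  moreover have "f \<cdot> h = zero W Y"
    if "mhom W w X l h" "zero_arrow Mod ((W, w), (Y, y), f \<cdot> h)" for W w h
    using that zero_arrow_Mod[OF module_hom_Comp[OF that(1) f]] by simp
  ultimately have factor: "\<exists>!u. u \<in> Hom Mod (W, w) (K, p) \<and> ((K, p), (X, l), k) \<cdot>\<^bsub>Mod\<^esub> u = ((W, w), (X, l), h)"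
    if "mhom W w X l h" "zero_arrow Mod ((W, w), (Y, y), f \<cdot> h)" for W w h
    using that by blast
  show ?thesis
    unfolding is_kernel_def module_cat_simps
  proof (intro conjI allI ballI impI)
    show "zero_arrow Mod ((K, p), (Y, y), f \<cdot> k)" using zero_arrow_Mod[OF fk] kk(2) DK by simp
    fix R h assume h: "h \<in> Hom Mod R (X, l)" and 0: "zero_arrow Mod (((X, l), (Y, y), f) \<cdot>\<^bsub>Mod\<^esub> h)"
    obtain W w where R: "R = (W, w)" by fastforce
    obtain h' where "h = ((W, w), (X, l), h')" "mhom W w X l h'"
      using h unfolding R by (rule Hom_module_catE)
    then show "\<exists>!u. u \<in> Hom Mod R (K, p) \<and> ((K, p), (X, l), k) \<cdot>\<^bsub>Mod\<^esub> u = h"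
      using factor 0 R by simp
  qed (use f kM in simp_all)
qed

text \<open>Linearity of the factorisation is tested after \<open>TA c\<close>, which is epi.
  Reversing arrows would lead to comodules, so the kernel case is not simply dualised.\<close>

lemma is_cokernel_Mod:
  assumes f: "mhom X l Y y f" and c: "is_cokernel C c f" and cM: "mhom Y y Z p c"
  shows "is_cokernel Mod ((Y, y), (Z, p), c) ((X, l), (Y, y), f)"
proof -
  note fD = module_homD[OF f] and cD = module_homD[OF cM]
  note cc = cokernelD[OF c fD(3)]
  have DZ: "Cod C c = Z" using cD(3) by (simp add: Hom_def)
  note cf = module_hom_Comp[OF f cM]
  have "\<exists>!u. u \<in> Hom Mod (Z, p) (W, w) \<and> u \<cdot>\<^bsub>Mod\<^esub> ((Y, y), (Z, p), c) = ((Y, y), (W, w), h)"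
    if h: "mhom Y y W w h" and 0: "h \<cdot> f = zero X W" for W w h
  proof -
    obtain u where u: "u \<in> Hom C Z W" "u \<cdot> c = h"
      using cokernel_factor[OF c fD(3) module_homD(3)[OF h] 0] DZ by metis
    note uM = module_hom_lift_epi[OF cM h TA_epi[OF cc(3,1)] u]
    have "v = ((Z, p), (W, w), u)"
      if v0: "v \<in> Hom Mod (Z, p) (W, w)" "v \<cdot>\<^bsub>Mod\<^esub> ((Y, y), (Z, p), c) = ((Y, y), (W, w), h)" for v
    proof -
      obtain v' where v: "v = ((Z, p), (W, w), v')" "mhom Z p W w v'"
        using Hom_module_catE[OF v0(1)] .
      then have "v' \<cdot> c = u \<cdot> c" using v0(2) u(2) by simp
      then show ?thesis using epiD[OF cc(3) cD(3) module_homD(3)[OF v(2)] u(1)] v(1) by simp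
    qed
    moreover have "((Z, p), (W, w), u) \<in> Hom Mod (Z, p) (W, w)" using uM by simp
    moreover have "((Z, p), (W, w), u) \<cdot>\<^bsub>Mod\<^esub> ((Y, y), (Z, p), c) = ((Y, y), (W, w), h)" using u by simp
    ultimately show ?thesis by blast
  qed
  moreover have "h \<cdot> f = zero X W"
    if "mhom Y y W w h" "zero_arrow Mod ((X, l), (W, w), h \<cdot> f)" for W w h
    using that zero_arrow_Mod[OF module_hom_Comp[OF f that(1)]] by simp
  ultimately have factor: "\<exists>!u. u \<in> Hom Mod (Z, p) (W, w) \<and> u \<cdot>\<^bsub>Mod\<^esub> ((Y, y), (Z, p), c) = ((Y, y), (W, w), h)"
    if "mhom Y y W w h" "zero_arrow Mod ((X, l), (W, w), h \<cdot> f)" for W w h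
    using that by blast
  show ?thesis
    unfolding is_cokernel_def module_cat_simps
  proof (intro conjI allI ballI impI)
    show "zero_arrow Mod ((X, l), (Z, p), c \<cdot> f)" using zero_arrow_Mod[OF cf] cc(2) DZ by simp
    fix R h assume h: "h \<in> Hom Mod (Y, y) R" and 0: "zero_arrow Mod (h \<cdot>\<^bsub>Mod\<^esub> ((X, l), (Y, y), f))"
    obtain W w where R: "R = (W, w)" by fastforce
    obtain h' where "h = ((Y, y), (W, w), h')" "mhom Y y W w h'"
      using h unfolding R by (rule Hom_module_catE)
    then show "\<exists>!u. u \<in> Hom Mod (Z, p) R \<and> u \<cdot>\<^bsub>Mod\<^esub> ((Y, y), (Z, p), c) = h"
      using factor 0 R by simp
  qed (use f cM in simp_all)
qed

text \<open>Kernels and cokernels of modules may be formed in \<open>C\<close>, which gives one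
  direction. Conversely, a kernel of modules in \<open>N\<close> is known only by its universal
  property among modules; the kernel formed in \<open>C\<close> factors through it by a mono and so
  lies in \<open>N\<close>, and dually for cokernels.\<close>

lemma N_iso_Mod:
  assumes f: "mhom X l Y y f"
  shows "((X, l), (Y, y), f) \<in> SMod \<longleftrightarrow> f \<in> S"
proof -
  note fD = module_homD[OF f]
  obtain K k where k: "is_kernel C k f" "k \<in> Hom C K X" "is_mono C k" using kernelE[OF fD(3)] by metis
  obtain Z c where c: "is_cokernel C c f" "c \<in> Hom C Y Z" "is_epi C c" using cokernelE[OF fD(3)] by metis
  have D: "Dom C k = K" "Cod C c = Z" using k(2) c(2) by (auto simp: Hom_def)
  obtain p where p: "mhom K p X l k" using kernel_module[OF f k(1)] D by metis
  obtain r where r: "mhom Y y Z r c" using cokernel_module[OF f c(1)] D by metis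
  note kM = is_kernel_Mod[OF f k(1) p] and cM = is_cokernel_Mod[OF f c(1) r]
  show ?thesis
  proof
    assume fS: "f \<in> S"
    have "(K, p) \<in> NMod" "(Z, r) \<in> NMod"
      using module_homD(1)[OF p] module_homD(2)[OF r] N_iso_kernel[OF fS k(1)] N_iso_cokernel[OF fS c(1)] D
      by (auto simp: modules_in_def)
    then have "Dom Mod ((K, p), (X, l), k) \<in> NMod" "Cod Mod ((Y, y), (Z, r), c) \<in> NMod" by simp_all
    then show "((X, l), (Y, y), f) \<in> SMod"
      unfolding N_iso_def mem_Collect_eq Arr_module_cat using kM cM f by blast
  next
    assume "((X, l), (Y, y), f) \<in> SMod"
    then obtain \<kappa> \<gamma> where \<kappa>: "is_kernel Mod \<kappa> ((X, l), (Y, y), f)" "Dom Mod \<kappa> \<in> NMod"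
      and \<gamma>: "is_cokernel Mod \<gamma> ((X, l), (Y, y), f)" "Cod Mod \<gamma> \<in> NMod"
      by (auto simp: N_iso_def)
    have "\<kappa> \<in> Arr Mod" "Cod Mod \<kappa> = (X, l)" using \<kappa>(1) by (auto simp: is_kernel_def)
    then obtain K' p' k' where k': "\<kappa> = ((K', p'), (X, l), k')" "mhom K' p' X l k'"
      by (auto elim!: Arr_module_catE)
    have "\<gamma> \<in> Arr Mod" "Dom Mod \<gamma> = (Y, y)" using \<gamma>(1) by (auto simp: is_cokernel_def)
    then obtain Z' r' c' where c': "\<gamma> = ((Y, y), (Z', r'), c')" "mhom Y y Z' r' c'"
      by (auto elim!: Arr_module_catE)
    have N: "K' \<in> N" "Z' \<in> N" using \<kappa>(2) \<gamma>(2) k'(1) c'(1) by (auto simp: modules_in_def)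
    have "zero_arrow Mod (((X, l), (Y, y), f) \<cdot>\<^bsub>Mod\<^esub> ((K, p), (X, l), k))"
      using kM unfolding is_kernel_def by blast
    moreover have "((K, p), (X, l), k) \<in> Hom Mod (K, p) (Dom Mod ((X, l), (Y, y), f))" using p by simp
    ultimately obtain u where "u \<in> Hom Mod (K, p) (Dom Mod \<kappa>)" "\<kappa> \<cdot>\<^bsub>Mod\<^esub> u = ((K, p), (X, l), k)"
      using \<kappa>(1) unfolding is_kernel_def by blast
    then obtain u where u: "u \<in> Hom C K K'" "k' \<cdot> u = k"
      by (auto simp: k'(1) elim!: Hom_module_catE dest: module_homD)
    have "is_mono C u" using mono_of_Comp[OF _ u(1) module_homD(3)[OF k'(2)]] u(2) k(3) by simp
    then have KN: "K \<in> N" using N_subobject u(1) N(1) by blast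
    have "zero_arrow Mod (((Y, y), (Z, r), c) \<cdot>\<^bsub>Mod\<^esub> ((X, l), (Y, y), f))"
      using cM unfolding is_cokernel_def by blast
    moreover have "((Y, y), (Z, r), c) \<in> Hom Mod (Cod Mod ((X, l), (Y, y), f)) (Z, r)" using r by simp
    ultimately obtain v where "v \<in> Hom Mod (Cod Mod \<gamma>) (Z, r)" "v \<cdot>\<^bsub>Mod\<^esub> \<gamma> = ((Y, y), (Z, r), c)"
      using \<gamma>(1) unfolding is_cokernel_def by blast
    then obtain v where v: "v \<in> Hom C Z' Z" "v \<cdot> c' = c"
      by (auto simp: c'(1) elim!: Hom_module_catE dest: module_homD)
    have "is_epi C v" using epi_of_Comp[OF _ module_homD(3)[OF c'(2)] v(1)] v(2) c(3) by simp
    then have ZN: "Z \<in> N" using N_quotient v(1) N(2) by blast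
    show "f \<in> S" unfolding N_iso_def using fD(3) k(1) c(1) D KN ZN by (auto simp: Hom_def)
  qed
qed

lemma N_iso_ModD:
  assumes "h \<in> Hom Mod (X, l) (Y, y)" and "h \<in> SMod"
  obtains f where "h = ((X, l), (Y, y), f)" and "mhom X l Y y f" and "f \<in> S"
  using Hom_module_catE[OF assms(1)] N_iso_Mod assms(2) by metis

text \<open>The equalising arrow \<open>u\<close> starts at an object without an action. It factors
  through the kernel \<open>e\<close> of the difference of \<open>f\<close> and \<open>g\<close>,
  which is a module and is therefore inverted along with \<open>u\<close>.\<close>

lemma equalizer_module:
  assumes f: "mhom X l Y y f" and g: "mhom X l Y y g"
    and u: "u \<in> Hom C W X" "u \<in> S" and fu: "f \<cdot> u = g \<cdot> u"
  obtains E p e where "mhom E p X l e" and "e \<in> S" and "f \<cdot> e = g \<cdot> e"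
proof -
  note fD = module_homD[OF f] and gD = module_homD[OF g]
  obtain d where d: "d \<in> Hom C X Y" "add d g = f"
    and dr: "\<And>h W. h \<in> Hom C W X \<Longrightarrow> d \<cdot> h = zero W Y \<longleftrightarrow> f \<cdot> h = g \<cdot> h"
    using differenceE[OF fD(3) gD(3)] by metis
  obtain E e where e: "is_kernel C e d" "e \<in> Hom C E X" "d \<cdot> e = zero E Y"
    using kernelE[OF d(1)] by metis
  have "Dom C e = E" using e(2) by (simp add: Hom_def)
  then obtain p where p: "mhom E p X l e"
    using kernel_module[OF difference_module_hom[OF f g d] e(1)] by metis
  have "e \<in> S" using kernel_N_iso_left[OF d(1) u _ e(1)] dr[OF u(1)] fu by simp
  moreover have "f \<cdot> e = g \<cdot> e" using dr[OF e(2)] e(3) by simp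
  ultimately show ?thesis using that p by blast
qed

text \<open>The completing squares and equalising arrows of \<open>C\<close> are replaced by
  pullbacks and equalisers, which carry actions; \<open>N_iso_Mod\<close> then transfers
  invertibility from the underlying arrows.\<close>

lemma fractions_Mod: "fractions Mod NMod"
proof
  show "Idn Mod P \<in> SMod" if "P \<in> Obj Mod" for P
  proof -
    obtain X l where P: "P = (X, l)" by fastforce
    then show ?thesis
      using that N_iso_Mod[OF module_hom_Idn] Idn_N_iso modulesD(1)[of X l C M] by simp
  qed
  show "t \<cdot>\<^bsub>Mod\<^esub> s \<in> SMod"
    if s: "s \<in> SMod" and t: "t \<in> SMod" and "Cod Mod s = Dom Mod t" for s t
  proof -
    obtain X l Y y f where f: "s = ((X, l), (Y, y), f)" "mhom X l Y y f"
      using Arr_module_catE[OF N_iso_Arr[OF s]] .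
    obtain Y' y' Z z g where g: "t = ((Y', y'), (Z, z), g)" "mhom Y' y' Z z g"
      using Arr_module_catE[OF N_iso_Arr[OF t]] .
    have YY: "Y' = Y" "y' = y" using that(3) f(1) g(1) by auto
    have "f \<in> S" "g \<in> S" using s t N_iso_Mod f g by auto
    then have "g \<cdot> f \<in> S"
      using Comp_N_iso module_homD(3)[OF f(2)] module_homD(3)[OF g(2)] YY by (simp add: Hom_def)
    then show ?thesis using N_iso_Mod[OF module_hom_Comp[OF f(2)]] f(1) g YY by simp
  qed
  show "\<exists>W. \<exists>u \<in> Hom Mod W P. \<exists>v \<in> Hom Mod W R. u \<in> SMod \<and> f \<cdot>\<^bsub>Mod\<^esub> u = t \<cdot>\<^bsub>Mod\<^esub> v"
    if f: "f \<in> Hom Mod P Q" and t: "t \<in> Hom Mod R Q" "t \<in> SMod" for f t P Q R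
  proof -
    obtain X l Y y Z z where PQR: "P = (X, l)" "Q = (Y, y)" "R = (Z, z)" by (metis prod.exhaust)
    obtain f' where f': "f = ((X, l), (Y, y), f')" "mhom X l Y y f'"
      using f unfolding PQR by (rule Hom_module_catE)
    obtain t' where t': "t = ((Z, z), (Y, y), t')" "mhom Z z Y y t'" "t' \<in> S"
      using t unfolding PQR by (rule N_iso_ModD)
    note fH = module_homD(3)[OF f'(2)] and tH = module_homD(3)[OF t'(2)]
    obtain u v where uv: "is_pullback C f' t' u v" "u \<in> S" using pullback_N_iso[OF fH tH t'(3)] .
    obtain p where p: "mhom (Dom C u) p X l u" "mhom (Dom C u) p Z z v"
      using pullback_module[OF f'(2) t'(2) uv(1)] .
    have "((Dom C u, p), (X, l), u) \<in> SMod" using N_iso_Mod[OF p(1)] uv(2) by simp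
    moreover have "((Dom C u, p), (X, l), u) \<in> Hom Mod (Dom C u, p) P"
      "((Dom C u, p), (Z, z), v) \<in> Hom Mod (Dom C u, p) R" using p PQR by auto
    moreover have "f \<cdot>\<^bsub>Mod\<^esub> ((Dom C u, p), (X, l), u) = t \<cdot>\<^bsub>Mod\<^esub> ((Dom C u, p), (Z, z), v)"
      using is_pullbackD(3)[OF uv(1) fH tH] f'(1) t'(1) by simp
    ultimately show ?thesis by blast
  qed
  show "\<exists>W. \<exists>u \<in> Hom Mod W P. u \<in> SMod \<and> f \<cdot>\<^bsub>Mod\<^esub> u = g \<cdot>\<^bsub>Mod\<^esub> u"
    if f: "f \<in> Hom Mod P Q" and g: "g \<in> Hom Mod P Q" and t: "t \<in> Hom Mod Q R" "t \<in> SMod"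
      and eq: "t \<cdot>\<^bsub>Mod\<^esub> f = t \<cdot>\<^bsub>Mod\<^esub> g" for f g t P Q R
  proof -
    obtain X l Y y Z z where PQR: "P = (X, l)" "Q = (Y, y)" "R = (Z, z)" by (metis prod.exhaust)
    obtain f' where f': "f = ((X, l), (Y, y), f')" "mhom X l Y y f'"
      using f unfolding PQR by (rule Hom_module_catE)
    obtain g' where g': "g = ((X, l), (Y, y), g')" "mhom X l Y y g'"
      using g unfolding PQR by (rule Hom_module_catE)
    obtain t' where t': "t = ((Y, y), (Z, z), t')" "mhom Y y Z z t'" "t' \<in> S"
      using t unfolding PQR by (rule N_iso_ModD)
    note H = module_homD(3)[OF f'(2)] module_homD(3)[OF g'(2)] module_homD(3)[OF t'(2)]
    have "t' \<cdot> f' = t' \<cdot> g'" using eq f'(1) g'(1) t'(1) by simp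
    then obtain W u where u: "u \<in> Hom C W X" "u \<in> S" "f' \<cdot> u = g' \<cdot> u"
      using cancel[OF H t'(3)] by blast
    obtain E p e where e: "mhom E p X l e" "e \<in> S" "f' \<cdot> e = g' \<cdot> e"
      using equalizer_module[OF f'(2) g'(2) u] .
    have "((E, p), (X, l), e) \<in> Hom Mod (E, p) P" "((E, p), (X, l), e) \<in> SMod"
      "f \<cdot>\<^bsub>Mod\<^esub> ((E, p), (X, l), e) = g \<cdot>\<^bsub>Mod\<^esub> ((E, p), (X, l), e)"
      using e N_iso_Mod[OF e(1)] f'(1) g'(1) PQR by auto
    then show ?thesis by blast
  qed
qed

end


section \<open>The comparison functor\<close>

context exact_monad_serre
begin

section \<open>The induced monad and the functor \<open>Phi\<close>\<close>

abbreviation "QM \<equiv> induced_monad C N M"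

lemma q_TA_functor: "is_functor C Q (comp_functor (quotient_functor C N) (Endo M))"
  using comp_is_functor[OF endo q_functor] .

lemma q_TA_iso: "s \<in> S \<Longrightarrow> is_iso Q (AMap (comp_functor (quotient_functor C N) (Endo M)) s)"
  using q_iso[OF TA_N_iso] by (simp add: comp_functor_def)

lemma QM_functor: "is_functor Q Q (Endo QM)"
  using induced_is_functor[OF q_TA_functor q_TA_iso] by (simp add: induced_monad_def)

end

sublocale exact_monad_serre \<subseteq> QM: endofunctor "quotient_cat C N" "induced_monad C N M"
  by unfold_locales (rule QM_functor)

sublocale exact_monad_serre \<subseteq> QMod: fractions "module_cat C M" "modules_in C M N"
  by (rule fractions_Mod)

context exact_monad_serre
begin

lemma QM_TO [simp]: "QM.TO = TO"
  by (simp add: induced_monad_def induced_functor_def comp_functor_def quotient_functor_def)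

lemma QM_TA_q: "f \<in> Hom C X Y \<Longrightarrow> QM.TA (q f) = q (TA f)"
  using induced_functor_q[OF q_TA_functor q_TA_iso] by (simp add: induced_monad_def comp_functor_def)

lemma QM_simps [simp]: "Eta QM X = q (\<eta> X)" "Mu QM X = q (\<mu> X)"
  by (simp_all add: induced_monad_def)

lemma QM_TA_Hom: "h \<in> Hom Q X Y \<Longrightarrow> QM.TA h \<in> Hom Q (TO X) (TO Y)"
  using QM.TA_Hom by simp

abbreviation "PhiA \<equiv> AMap (Phi C N)"

lemma Phi_module:
  assumes X: "(X, l) \<in> modules C M"
  shows "(X, q l) \<in> modules Q QM"
proof -
  note l = modulesD[OF X]
  show ?thesis
    using q_Comp[OF TA_Hom[OF l(2)] l(2)] q_Comp[OF mu_Hom[OF l(1)] l(2)] q_Comp[OF eta_Hom[OF l(1)] l(2)]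
      QM_TA_q[OF l(2)] l q_Hom[OF l(2)] q_Idn[OF l(1)]
    by (simp add: modules_def)
qed

lemma Phi_module_hom:
  assumes f: "mhom X l Y k f"
  shows "module_hom Q QM X (q l) Y (q k) (q f)"
proof -
  note fD = module_homD[OF f]
  note l = modulesD(2)[OF fD(1)] and k = modulesD(2)[OF fD(2)]
  show ?thesis
    using Phi_module[OF fD(1)] Phi_module[OF fD(2)] q_Hom[OF fD(3)] q_Comp[OF l fD(3)]
      q_Comp[OF TA_Hom[OF fD(3)] k] QM_TA_q[OF fD(3)] fD(4)
    by (simp add: module_hom_def)
qed

lemma Phi_simps [simp]:
  "OMap (Phi C N) (X, l) = (X, q l)"
  "PhiA ((X, l), (Y, k), f) = ((X, q l), (Y, q k), q f)"
  by (simp_all add: Phi_def Let_def)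

lemma Phi_functor: "is_functor Mod QM.Mod (Phi C N)"
proof (rule functorI)
  show "category Mod" "category QM.Mod" using category_module_cat QM.category_module_cat by auto
  show "OMap (Phi C N) P \<in> Obj QM.Mod" if "P \<in> Obj Mod" for P
    using that Phi_module by (cases P) auto
  show "PhiA f \<in> Hom QM.Mod (OMap (Phi C N) P) (OMap (Phi C N) P')"
    if "f \<in> Hom Mod P P'" for f P P'
    using that Phi_module_hom by (cases P; cases P') (auto elim!: Hom_module_catE)
  show "PhiA (Idn Mod P) = Idn QM.Mod (OMap (Phi C N) P)" if "P \<in> Obj Mod" for P
    using that q_Idn modulesD(1) by (cases P) fastforce
  show "PhiA (g \<cdot>\<^bsub>Mod\<^esub> f) = PhiA g \<cdot>\<^bsub>QM.Mod\<^esub> PhiA f"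
    if "f \<in> Hom Mod P P'" "g \<in> Hom Mod P' P''" for f g P P' P''
    using that by (cases P; cases P'; cases P'')
      (auto elim!: Hom_module_catE dest!: module_homD(3) intro: q_Comp)
qed

lemma Phi_iso:
  assumes "s \<in> SMod"
  shows "is_iso QM.Mod (PhiA s)"
proof -
  obtain X l Y k f where s: "s = ((X, l), (Y, k), f)" "mhom X l Y k f"
    using Arr_module_catE[OF N_iso_Arr[OF assms]] .
  then have "f \<in> S" using N_iso_Mod assms by simp
  then show ?thesis using QM.module_hom_iso[OF Phi_module_hom[OF s(2)] q_iso] s(1) by simp
qed

section \<open>The functor between quotient and modules: faithful, full and essentially
  surjective\<close>

abbreviation "\<Phi> \<equiv> AMap (Phi_bar C N M)"

lemma Phi_bar_functor: "is_functor QMod.Q QM.Mod (Phi_bar C N M)"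
  unfolding Phi_bar_def by (rule QMod.induced_is_functor[OF Phi_functor Phi_iso])

lemma Phi_bar_OMap [simp]: "OMap (Phi_bar C N M) = OMap (Phi C N)"
  by (simp add: Phi_bar_def induced_functor_def)

lemma Phi_bar_q: "f \<in> Hom Mod P P' \<Longrightarrow> \<Phi> (QMod.q f) = PhiA f"
  unfolding Phi_bar_def by (rule QMod.induced_functor_q[OF Phi_functor Phi_iso])

lemma Phi_bar_faithful:
  assumes g: "g \<in> Hom QMod.Q P P'" and h: "h \<in> Hom QMod.Q P P'" and eq: "\<Phi> g = \<Phi> h"
  shows "g = h"
proof -
  obtain R s a b where s: "s \<in> Hom Mod R P" "s \<in> SMod"
    and a: "a \<in> Hom Mod R P'" and b: "b \<in> Hom Mod R P'"
    and gs: "g \<cdot>\<^bsub>QMod.Q\<^esub> QMod.q s = QMod.q a" and hs: "h \<cdot>\<^bsub>QMod.Q\<^esub> QMod.q s = QMod.q b"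
    using QMod.common_denominator[OF g h] .
  have "PhiA a = PhiA b"
    using functor_Comp[OF Phi_bar_functor QMod.q_Hom[OF s(1)] g]
      functor_Comp[OF Phi_bar_functor QMod.q_Hom[OF s(1)] h] eq gs hs Phi_bar_q[OF a] Phi_bar_q[OF b] by simp
  moreover obtain W w Y y where RP: "R = (W, w)" "P' = (Y, y)" by (metis prod.exhaust)
  moreover obtain a' where a': "a = ((W, w), (Y, y), a')" "mhom W w Y y a'"
    using a unfolding RP by (rule Hom_module_catE)
  moreover obtain b' where b': "b = ((W, w), (Y, y), b')" "mhom W w Y y b'"
    using b unfolding RP by (rule Hom_module_catE)
  ultimately have "q a' = q b'" by simp
  \<comment> \<open>\<open>V\<close> carries no action, so \<open>u\<close> is exchanged for the
    equaliser of \<open>a'\<close> and \<open>b'\<close> in modules, which is still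
    inverted.\<close>
  then obtain V u where u: "u \<in> Hom C V W" "u \<in> S" "a' \<cdot> u = b' \<cdot> u"
    using q_eqE[OF module_homD(3)[OF a'(2)] module_homD(3)[OF b'(2)]] by metis
  obtain E p e where e: "mhom E p W w e" "e \<in> S" "a' \<cdot> e = b' \<cdot> e"
    using equalizer_module[OF a'(2) b'(2) u] .
  have "((E, p), (W, w), e) \<in> Hom Mod (E, p) R" "((E, p), (W, w), e) \<in> SMod"
    using e N_iso_Mod[OF e(1)] RP by auto
  then have "QMod.q a = QMod.q b" by (rule QMod.q_eqI[OF a b]) (simp add: a' b' e(3))
  then show ?thesis
    using QMod.Q.iso_cancel_right[OF QMod.q_iso[OF s(2)] QMod.q_Hom[OF s(1)] g h] gs hs by simp
qed

text \<open>
  Writing \<open>\<phi> = f s\<^sup>-\<^sup>1\<close> with \<open>s : W \<rightarrow> X\<close> and \<open>f : W \<rightarrow> Y\<close>, let \<open>a\<close> and \<open>b\<close> be the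
  extensions of \<open>s\<close> and \<open>f\<close> to the free module on \<open>W\<close>, so that \<open>q b = \<phi> q a\<close>. In general
  \<open>b\<close> does not vanish on the kernel of \<open>a\<close>, but it does after dividing \<open>Y\<close> by a submodule in
  \<open>N\<close>. This gives \<open>b'\<close> on the image of \<open>a\<close>, and hence a zigzag of modules from \<open>X\<close> to \<open>Y\<close>.
\<close>

lemma Phi_bar_full_aux:
  assumes \<phi>: "module_hom Q QM X (q l) Y (q k) \<phi>"
    and X: "(X, l) \<in> modules C M" and Y: "(Y, k) \<in> modules C M"
  obtains I i m Z z d b where "mhom I i X l m" and "m \<in> S"
    and "mhom Y k Z z d" and "d \<in> S" and "mhom I i Z z b"
    and "q d \<cdot>\<^bsub>Q\<^esub> (\<phi> \<cdot>\<^bsub>Q\<^esub> q m) = q b"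
proof -
  note \<phi>D = module_homD[OF \<phi>]
  note l = modulesD[OF X] and k = modulesD[OF Y]
  obtain W s f where s: "s \<in> Hom C W X" "s \<in> S" and f: "f \<in> Hom C W Y" and \<phi>s: "\<phi> \<cdot>\<^bsub>Q\<^esub> q s = q f"
    using Q_rep[OF \<phi>D(3)] .
  have W: "W \<in> Obj C" using Hom_Obj[OF s(1)] by simp
  note Ts = TA_Hom[OF s(1)] and Tf = TA_Hom[OF f]
  define a where "a = l \<cdot> TA s"
  define b where "b = k \<cdot> TA f"
  have aM: "mhom (TO W) (\<mu> W) X l a" and bM: "mhom (TO W) (\<mu> W) Y k b"
    unfolding a_def b_def
    using module_hom_Comp[OF free_module_hom[OF s(1)] action_module_hom[OF X]]
      module_hom_Comp[OF free_module_hom[OF f] action_module_hom[OF Y]] by auto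
  note aH = module_homD(3)[OF aM] and bH = module_homD(3)[OF bM]
  \<comment> \<open>The image of \<open>\<phi>\<close> under the induced endofunctor is reached
    through the fraction: its denominator is \<open>TA s\<close> and its numerator
    \<open>TA f\<close>.\<close>
  have "QM.TA \<phi> \<cdot>\<^bsub>Q\<^esub> q (TA s) = q (TA f)"
    using QM.TA_Comp[OF q_Hom[OF s(1)] \<phi>D(3)] \<phi>s QM_TA_q[OF s(1)] QM_TA_q[OF f] by simp
  then have "q b = (q k \<cdot>\<^bsub>Q\<^esub> QM.TA \<phi>) \<cdot>\<^bsub>Q\<^esub> q (TA s)"
    unfolding b_def using q_Comp[OF Tf k(2)]
      Q.Comp_assoc[OF q_Hom[OF Ts] QM_TA_Hom[OF \<phi>D(3)] q_Hom[OF k(2)]] by simp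
  also have "\<dots> = \<phi> \<cdot>\<^bsub>Q\<^esub> q a"
    unfolding a_def \<phi>D(4)[symmetric] using q_Comp[OF Ts l(2)]
      Q.Comp_assoc[OF q_Hom[OF Ts] q_Hom[OF l(2)] \<phi>D(3)] by simp
  finally have qb: "q b = \<phi> \<cdot>\<^bsub>Q\<^esub> q a" .
  obtain K \<kappa> where \<kappa>: "is_kernel C \<kappa> a" "\<kappa> \<in> Hom C K (TO W)" "a \<cdot> \<kappa> = zero K X" "is_mono C \<kappa>"
    using kernelE[OF aH] .
  have KO: "K \<in> Obj C" using Hom_Obj[OF \<kappa>(2)] by simp
  have D\<kappa>: "Dom C \<kappa> = K" using \<kappa>(2) by (simp add: Hom_def)
  obtain p where \<kappa>M: "mhom K p (TO W) (\<mu> W) \<kappa>" using kernel_module[OF aM \<kappa>(1)] D\<kappa> by metis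
  note b\<kappa> = module_hom_Comp[OF \<kappa>M bM]
  note b\<kappa>H = module_homD(3)[OF b\<kappa>]
  \<comment> \<open>In the quotient \<open>b\<close> is \<open>\<phi>\<close> after
    \<open>a\<close>, so it kills the kernel of \<open>a\<close> there; in \<open>C\<close> this is
    only obtained after an inverted \<open>u\<close>.\<close>
  have "q (b \<cdot> \<kappa>) = \<phi> \<cdot>\<^bsub>Q\<^esub> q (zero K X)"
    using q_Comp[OF \<kappa>(2) bH] qb Q.Comp_assoc[OF q_Hom[OF \<kappa>(2)] q_Hom[OF aH] \<phi>D(3)]
      q_Comp[OF \<kappa>(2) aH] \<kappa>(3) by simp
  also have "\<dots> = q f \<cdot>\<^bsub>Q\<^esub> q (zero K W)"
    unfolding \<phi>s[symmetric]
    using Q.Comp_assoc[OF q_Hom[OF zero_Hom[OF KO W]] q_Hom[OF s(1)] \<phi>D(3)]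
      q_Comp[OF zero_Hom[OF KO W] s(1)] Comp_zero[OF s(1) KO] by simp
  also have "\<dots> = q (zero K Y)" using q_Comp[OF zero_Hom[OF KO W] f] Comp_zero[OF f KO] by simp
  finally obtain V u where u: "u \<in> Hom C V K" "u \<in> S" "(b \<cdot> \<kappa>) \<cdot> u = zero K Y \<cdot> u"
    using q_eqE[OF b\<kappa>H zero_Hom[OF KO k(1)]] by metis
  then have bu: "(b \<cdot> \<kappa>) \<cdot> u = zero V Y" using zero_Comp[OF u(1) k(1)] by simp
  \<comment> \<open>The projection of \<open>Y\<close> modulo the image of
    \<open>b \<cdot> \<kappa>\<close>. Since \<open>b \<cdot> \<kappa>\<close> vanishes after the
    inverted \<open>u\<close>, that image is in \<open>N\<close> and \<open>d\<close> is
    inverted.\<close>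
  obtain Z d where d: "is_cokernel C d (b \<cdot> \<kappa>)" "d \<in> Hom C Y Z" "d \<cdot> (b \<cdot> \<kappa>) = zero K Z"
    using cokernelE[OF b\<kappa>H] by metis
  have dS: "d \<in> S" using cokernel_N_iso_right[OF b\<kappa>H u(1,2) bu d(1)] .
  obtain z where dM: "mhom Y k Z z d" using cokernel_module[OF b\<kappa> d(1)] d(2) by (auto simp: Hom_def)
  obtain I e where e: "is_cokernel C e \<kappa>" "e \<in> Hom C (TO W) I" "is_epi C e" using cokernelE[OF \<kappa>(2)] by metis
  have CI: "Cod C e = I" using e(2) by (simp add: Hom_def)
  obtain i where eM: "mhom (TO W) (\<mu> W) I i e" using cokernel_module[OF \<kappa>M e(1)] CI by metis
  obtain m where m: "m \<in> Hom C I X" "is_mono C m" "m \<cdot> e = a"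
    using epi_mono_factorisation[OF aH \<kappa>(1) e(1)] CI by metis
  have mM: "mhom I i X l m" using module_hom_lift_epi[OF eM aM TA_epi[OF e(3,2)] m(1,3)] .
  note \<eta>W = eta_Hom[OF W]
  \<comment> \<open>The unit recovers \<open>s\<close> from its extension \<open>a\<close>, so
    \<open>s\<close> factors through the mono \<open>m\<close>, which is therefore inverted.\<close>
  have "m \<cdot> (e \<cdot> \<eta> W) = l \<cdot> (TA s \<cdot> \<eta> W)"
    using Comp_assoc[OF \<eta>W e(2) m(1)] m(3) Comp_assoc[OF \<eta>W Ts l(2)] by (simp add: a_def)
  also have "\<dots> = s"
    using eta_nat[OF s(1)] Comp_assoc[OF s(1) eta_Hom[OF l(1)] l(2)] l(4) Idn_Comp[OF s(1)] by simp
  finally have mS: "m \<in> S"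
    using mono_N_iso_of_Comp[OF m(2,1) Comp_in_Hom[OF \<eta>W e(2)]] s(2) by simp
  have "(d \<cdot> b) \<cdot> \<kappa> = zero K Z" using d(3) Comp_assoc[OF \<kappa>(2) bH d(2)] by simp
  then obtain b' where b': "b' \<in> Hom C I Z" "b' \<cdot> e = d \<cdot> b"
    using cokernel_factor[OF e(1) \<kappa>(2) Comp_in_Hom[OF bH d(2)]] CI by metis
  have b'M: "mhom I i Z z b'"
    using module_hom_lift_epi[OF eM module_hom_Comp[OF bM dM] TA_epi[OF e(3,2)] b'] .
  note \<phi>m = Q.Comp_in_Hom[OF q_Hom[OF m(1)] \<phi>D(3)]
  \<comment> \<open>\<open>e\<close> is epi but need not be inverted, so it is cancelled by
    \<open>q_epi\<close>.\<close>
  have "(q d \<cdot>\<^bsub>Q\<^esub> (\<phi> \<cdot>\<^bsub>Q\<^esub> q m)) \<cdot>\<^bsub>Q\<^esub> q e = q d \<cdot>\<^bsub>Q\<^esub> q b"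
    unfolding qb m(3)[symmetric] q_Comp[OF e(2) m(1)]
    using Q.Comp_assoc[OF q_Hom[OF e(2)] \<phi>m q_Hom[OF d(2)]]
      Q.Comp_assoc[OF q_Hom[OF e(2)] q_Hom[OF m(1)] \<phi>D(3)] by simp
  also have "\<dots> = q b' \<cdot>\<^bsub>Q\<^esub> q e" using q_Comp[OF bH d(2)] q_Comp[OF e(2) b'(1)] b'(2) by simp
  finally have "q d \<cdot>\<^bsub>Q\<^esub> (\<phi> \<cdot>\<^bsub>Q\<^esub> q m) = q b'"
    by (rule q_epi[OF e(3,2) Q.Comp_in_Hom[OF \<phi>m q_Hom[OF d(2)]] q_Hom[OF b'(1)]])
  then show ?thesis using that mM mS dM dS b'M by blast
qed

text \<open>The preimage is the zigzag of module arrows read as \<open>dd^-1 bb mm^-1\<close>. Its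
  value under \<open>\<Phi>\<close> agrees with the given arrow once both are placed between
  \<open>q d\<close> and \<open>q m\<close>, and these are invertible.\<close>

lemma Phi_bar_full:
  assumes P: "P \<in> modules C M" "P' \<in> modules C M"
    and h: "h \<in> Hom QM.Mod (OMap (Phi C N) P) (OMap (Phi C N) P')"
  shows "\<exists>g \<in> Hom QMod.Q P P'. \<Phi> g = h"
proof -
  obtain X l Y k where PP: "P = (X, l)" "P' = (Y, k)" by (metis prod.exhaust)
  obtain \<phi> where \<phi>: "h = ((X, q l), (Y, q k), \<phi>)" "module_hom Q QM X (q l) Y (q k) \<phi>"
    using h unfolding PP Phi_simps by (rule Hom_module_catE)
  obtain I i m Z z d b where m: "mhom I i X l m" "m \<in> S"
    and d: "mhom Y k Z z d" "d \<in> S" and b: "mhom I i Z z b"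
    and dm: "q d \<cdot>\<^bsub>Q\<^esub> (\<phi> \<cdot>\<^bsub>Q\<^esub> q m) = q b"
    using Phi_bar_full_aux[OF \<phi>(2) P[unfolded PP]] .
  note \<phi>H = module_homD(3)[OF \<phi>(2)]
  note mH = module_homD(3)[OF m(1)] and dH = module_homD(3)[OF d(1)] and bH = module_homD(3)[OF b]
  define mm where "mm = ((I, i), (X, l), m)"
  define dd where "dd = ((Y, k), (Z, z), d)"
  define bb where "bb = ((I, i), (Z, z), b)"
  have H: "mm \<in> Hom Mod (I, i) P" "dd \<in> Hom Mod P' (Z, z)" "bb \<in> Hom Mod (I, i) (Z, z)"
    and NS: "mm \<in> SMod" "dd \<in> SMod"
    unfolding mm_def dd_def bb_def using m d b PP N_iso_Mod[OF m(1)] N_iso_Mod[OF d(1)] by auto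
  note qm = QMod.q_Hom[OF H(1)] and qd = QMod.q_Hom[OF H(2)] and qb = QMod.q_Hom[OF H(3)]
  obtain m' where m': "m' \<in> Hom QMod.Q P (I, i)" "m' \<cdot>\<^bsub>QMod.Q\<^esub> QMod.q mm = Idn QMod.Q (I, i)"
    using QMod.Q.isoE[OF QMod.q_iso[OF NS(1)] qm] by metis
  obtain d' where d': "d' \<in> Hom QMod.Q (Z, z) P'" "QMod.q dd \<cdot>\<^bsub>QMod.Q\<^esub> d' = Idn QMod.Q (Z, z)"
    using QMod.Q.isoE[OF QMod.q_iso[OF NS(2)] qd] by metis
  define g where "g = d' \<cdot>\<^bsub>QMod.Q\<^esub> (QMod.q bb \<cdot>\<^bsub>QMod.Q\<^esub> m')"
  note bm' = QMod.Q.Comp_in_Hom[OF m'(1) qb]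
  have g: "g \<in> Hom QMod.Q P P'" unfolding g_def using QMod.Q.Comp_in_Hom[OF bm' d'(1)] .
  note gm = QMod.Q.Comp_in_Hom[OF qm g]
  have "g \<cdot>\<^bsub>QMod.Q\<^esub> QMod.q mm = d' \<cdot>\<^bsub>QMod.Q\<^esub> QMod.q bb"
    unfolding g_def using QMod.Q.Comp_assoc[OF qm bm' d'(1)] QMod.Q.Comp_assoc[OF qm m'(1) qb] m'(2)
      QMod.Q.Comp_Idn[OF qb] by simp
  then have "QMod.q dd \<cdot>\<^bsub>QMod.Q\<^esub> (g \<cdot>\<^bsub>QMod.Q\<^esub> QMod.q mm) = QMod.q bb"
    using QMod.Q.Comp_assoc[OF qb d'(1) qd] d'(2) QMod.Q.Idn_Comp[OF qb] by simp
  then have eq: "PhiA dd \<cdot>\<^bsub>QM.Mod\<^esub> (\<Phi> g \<cdot>\<^bsub>QM.Mod\<^esub> PhiA mm) = PhiA bb"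
    using functor_Comp[OF Phi_bar_functor gm qd] functor_Comp[OF Phi_bar_functor qm g]
      Phi_bar_q[OF H(1)] Phi_bar_q[OF H(2)] Phi_bar_q[OF H(3)] by simp
  have "\<Phi> g \<in> Hom QM.Mod (X, q l) (Y, q k)" using functor_Hom[OF Phi_bar_functor g] PP by simp
  then obtain \<psi> where \<psi>: "\<Phi> g = ((X, q l), (Y, q k), \<psi>)" "module_hom Q QM X (q l) Y (q k) \<psi>"
    by (rule Hom_module_catE)
  note \<psi>H = module_homD(3)[OF \<psi>(2)]
  have "q d \<cdot>\<^bsub>Q\<^esub> (\<psi> \<cdot>\<^bsub>Q\<^esub> q m) = q d \<cdot>\<^bsub>Q\<^esub> (\<phi> \<cdot>\<^bsub>Q\<^esub> q m)"
    using eq dm by (simp add: \<psi>(1) mm_def dd_def bb_def)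
  then have "\<psi> \<cdot>\<^bsub>Q\<^esub> q m = \<phi> \<cdot>\<^bsub>Q\<^esub> q m"
    by (rule Q.iso_cancel_left[OF q_iso[OF d(2)] q_Hom[OF dH] Q.Comp_in_Hom[OF q_Hom[OF mH] \<psi>H]
        Q.Comp_in_Hom[OF q_Hom[OF mH] \<phi>H]])
  then have "\<psi> = \<phi>" by (rule Q.iso_cancel_right[OF q_iso[OF m(2)] q_Hom[OF mH] \<psi>H \<phi>H])
  then show ?thesis using g \<psi>(1) \<phi>(1) by blast
qed

text \<open>
  A module \<open>(X, \<rho>)\<close> over the induced monad is the coequaliser of \<open>M \<rho>\<close> and \<open>\<mu>\<^sub>X\<close>. For
  \<open>\<rho> = f s\<^sup>-\<^sup>1\<close> these two arrows become \<open>M f\<close> and \<open>\<mu>\<^sub>X (M s)\<close> after composition with the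
  isomorphism \<open>q (M s)\<close>, and the coequaliser of the latter exists as a module over \<open>M\<close>.
\<close>

lemma Phi_bar_surj:
  assumes X\<rho>: "(X, \<rho>) \<in> modules Q QM"
  obtains Y y \<psi> where "(Y, y) \<in> modules C M" and "module_hom Q QM X \<rho> Y (q y) \<psi>" and "is_iso Q \<psi>"
proof -
  have X: "X \<in> Obj C" and \<rho>: "\<rho> \<in> Hom Q (TO X) X"
    and \<rho>\<rho>: "\<rho> \<cdot>\<^bsub>Q\<^esub> QM.TA \<rho> = \<rho> \<cdot>\<^bsub>Q\<^esub> q (\<mu> X)" and \<rho>\<eta>: "\<rho> \<cdot>\<^bsub>Q\<^esub> q (\<eta> X) = Idn Q X"
    using modulesD[OF X\<rho>] by auto
  note T\<rho> = QM_TA_Hom[OF \<rho>]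
  note TX = TO_Obj[OF X]
  note \<mu>X = mu_Hom[OF X] and \<eta>X = eta_Hom[OF X] and \<eta>TX = eta_Hom[OF TX]
  obtain W s f where s: "s \<in> Hom C W (TO X)" "s \<in> S" and f: "f \<in> Hom C W X" and \<rho>s: "\<rho> \<cdot>\<^bsub>Q\<^esub> q s = q f"
    using Q_rep[OF \<rho>] .
  have W: "W \<in> Obj C" using Hom_Obj[OF s(1)] by simp
  note \<eta>W = eta_Hom[OF W]
  note Ts = TA_Hom[OF s(1)] and Tf = TA_Hom[OF f]
  note TsS = TA_N_iso[OF s(2)]
  have T\<rho>s: "QM.TA \<rho> \<cdot>\<^bsub>Q\<^esub> q (TA s) = q (TA f)"
    using QM.TA_Comp[OF q_Hom[OF s(1)] \<rho>] \<rho>s QM_TA_q[OF s(1)] QM_TA_q[OF f] by simp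
  define g where "g = \<mu> X \<cdot> TA s"
  have fM: "mhom (TO W) (\<mu> W) (TO X) (\<mu> X) (TA f)" using free_module_hom[OF f] .
  have gM: "mhom (TO W) (\<mu> W) (TO X) (\<mu> X) g"
    unfolding g_def
    using module_hom_Comp[OF free_module_hom[OF s(1)] action_module_hom[OF free_module[OF X]]] .
  note gH = module_homD(3)[OF gM]
  have qg: "q g = q (\<mu> X) \<cdot>\<^bsub>Q\<^esub> q (TA s)" unfolding g_def using q_Comp[OF Ts \<mu>X] .
  obtain d where d: "d \<in> Hom C (TO W) (TO X)" "add d g = TA f"
    and dl: "\<And>h Z. h \<in> Hom C (TO X) Z \<Longrightarrow> h \<cdot> d = zero (TO W) Z \<longleftrightarrow> h \<cdot> TA f = h \<cdot> g"
    using differenceE[OF Tf gH] by metis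
  obtain Y c where c: "is_cokernel C c d" "c \<in> Hom C (TO X) Y" "c \<cdot> d = zero (TO W) Y" "is_epi C c"
    using cokernelE[OF d(1)] .
  have "Cod C c = Y" using c(2) by (simp add: Hom_def)
  then obtain y where cM: "mhom (TO X) (\<mu> X) Y y c"
    using cokernel_module[OF difference_module_hom[OF fM gM d] c(1)] by metis
  note yM = module_homD(2)[OF cM]
  note y = modulesD(2)[OF yM]
  note Tc = TA_Hom[OF c(2)] and qc = q_Hom[OF c(2)]
  have "(q c \<cdot>\<^bsub>Q\<^esub> QM.TA \<rho>) \<cdot>\<^bsub>Q\<^esub> q (TA s) = q (c \<cdot> TA f)"
    using Q.Comp_assoc[OF q_Hom[OF Ts] T\<rho> qc] T\<rho>s q_Comp[OF Tf c(2)] by simp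
  also have "\<dots> = (q c \<cdot>\<^bsub>Q\<^esub> q (\<mu> X)) \<cdot>\<^bsub>Q\<^esub> q (TA s)"
    using dl[OF c(2)] c(3) q_Comp[OF gH c(2)] qg Q.Comp_assoc[OF q_Hom[OF Ts] q_Hom[OF \<mu>X] qc] by simp
  finally have c\<rho>: "q c \<cdot>\<^bsub>Q\<^esub> QM.TA \<rho> = q c \<cdot>\<^bsub>Q\<^esub> q (\<mu> X)"
    by (rule Q.iso_cancel_right[OF q_iso[OF TsS] q_Hom[OF Ts] Q.Comp_in_Hom[OF T\<rho> qc]
        Q.Comp_in_Hom[OF q_Hom[OF \<mu>X] qc]])
  \<comment> \<open>Naturality of the unit is available for arrows of \<open>C\<close>; for
    \<open>\<rho>\<close> it is deduced from that of \<open>f\<close> and \<open>s\<close>.\<close>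
  have "(q (\<eta> X) \<cdot>\<^bsub>Q\<^esub> \<rho>) \<cdot>\<^bsub>Q\<^esub> q s = q (TA f \<cdot> \<eta> W)"
    using Q.Comp_assoc[OF q_Hom[OF s(1)] \<rho> q_Hom[OF \<eta>X]] \<rho>s q_Comp[OF f \<eta>X] eta_nat[OF f] by simp
  also have "\<dots> = QM.TA \<rho> \<cdot>\<^bsub>Q\<^esub> q (TA s \<cdot> \<eta> W)"
    using q_Comp[OF \<eta>W Tf] T\<rho>s Q.Comp_assoc[OF q_Hom[OF \<eta>W] q_Hom[OF Ts] T\<rho>] q_Comp[OF \<eta>W Ts] by simp
  also have "\<dots> = (QM.TA \<rho> \<cdot>\<^bsub>Q\<^esub> q (\<eta> (TO X))) \<cdot>\<^bsub>Q\<^esub> q s"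
    using eta_nat[OF s(1)] q_Comp[OF s(1) \<eta>TX] Q.Comp_assoc[OF q_Hom[OF s(1)] q_Hom[OF \<eta>TX] T\<rho>] by simp
  finally have \<eta>\<rho>: "q (\<eta> X) \<cdot>\<^bsub>Q\<^esub> \<rho> = QM.TA \<rho> \<cdot>\<^bsub>Q\<^esub> q (\<eta> (TO X))"
    by (rule Q.iso_cancel_right[OF q_iso[OF s(2)] q_Hom[OF s(1)] Q.Comp_in_Hom[OF \<rho> q_Hom[OF \<eta>X]]
        Q.Comp_in_Hom[OF q_Hom[OF \<eta>TX] T\<rho>]])
  \<comment> \<open>On underlying objects the presentation of \<open>X\<close> by
    \<open>\<rho>\<close> is a split coequaliser with section \<open>q (\<eta> X)\<close>, so the
    comparison with \<open>Y\<close> has to be this section followed by \<open>q c\<close>.\<close>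
  define \<psi> where "\<psi> = q (c \<cdot> \<eta> X)"
  have c\<eta>: "c \<cdot> \<eta> X \<in> Hom C X Y" using Comp_in_Hom[OF \<eta>X c(2)] .
  have \<psi>: "\<psi> \<in> Hom Q X Y" unfolding \<psi>_def using q_Hom[OF c\<eta>] .
  have \<psi>c: "\<psi> = q c \<cdot>\<^bsub>Q\<^esub> q (\<eta> X)" unfolding \<psi>_def using q_Comp[OF \<eta>X c(2)] .
  have "\<psi> \<cdot>\<^bsub>Q\<^esub> \<rho> = (q c \<cdot>\<^bsub>Q\<^esub> QM.TA \<rho>) \<cdot>\<^bsub>Q\<^esub> q (\<eta> (TO X))"
    unfolding \<psi>c using Q.Comp_assoc[OF \<rho> q_Hom[OF \<eta>X] qc] \<eta>\<rho> Q.Comp_assoc[OF q_Hom[OF \<eta>TX] T\<rho> qc] by simp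
  also have "\<dots> = q c"
    unfolding c\<rho> using Q.Comp_assoc[OF q_Hom[OF \<eta>TX] q_Hom[OF \<mu>X] qc] q_Comp[OF \<eta>TX \<mu>X] mu_eta[OF X]
      q_Idn[OF TX] Q.Comp_Idn[OF qc] by simp
  finally have \<psi>\<rho>: "\<psi> \<cdot>\<^bsub>Q\<^esub> \<rho> = q c" .
  \<comment> \<open>Associativity of the action \<open>\<rho>\<close> says that
    \<open>\<rho>\<close> coequalises the same pair; factoring it through \<open>q c\<close> yields
    the inverse \<open>\<chi>\<close>.\<close>
  have "\<rho> \<cdot>\<^bsub>Q\<^esub> q (TA f) = \<rho> \<cdot>\<^bsub>Q\<^esub> q g"
    unfolding T\<rho>s[symmetric] qg
    using Q.Comp_assoc[OF q_Hom[OF Ts] T\<rho> \<rho>] Q.Comp_assoc[OF q_Hom[OF Ts] q_Hom[OF \<mu>X] \<rho>] \<rho>\<rho> by simp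
  then obtain \<chi> where \<chi>: "\<chi> \<in> Hom Q Y X" "\<chi> \<cdot>\<^bsub>Q\<^esub> q c = \<rho>"
    using q_coequaliser_factor[OF d(1) Tf gH dl c(1,2) \<rho>] by blast
  have YO: "Y \<in> Obj Q" using Hom_Obj[OF c(2)] by simp
  have "(\<psi> \<cdot>\<^bsub>Q\<^esub> \<chi>) \<cdot>\<^bsub>Q\<^esub> q c = Idn Q Y \<cdot>\<^bsub>Q\<^esub> q c"
    using Q.Comp_assoc[OF qc \<chi>(1) \<psi>] \<chi>(2) \<psi>\<rho> Q.Idn_Comp[OF qc] by simp
  then have "\<psi> \<cdot>\<^bsub>Q\<^esub> \<chi> = Idn Q Y"
    by (rule q_epi[OF c(4,2) Q.Comp_in_Hom[OF \<chi>(1) \<psi>] Q.Idn_in_Hom[OF YO]])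
  moreover have "\<chi> \<cdot>\<^bsub>Q\<^esub> \<psi> = Idn Q X"
    unfolding \<psi>c using Q.Comp_assoc[OF q_Hom[OF \<eta>X] qc \<chi>(1)] \<chi>(2) \<rho>\<eta> by simp
  ultimately have iso: "is_iso Q \<psi>" by (rule Q.isoI[OF \<psi> \<chi>(1), rotated])
  \<comment> \<open>Towards linearity of \<open>\<psi>\<close>: the composite of
    \<open>\<rho>\<close> with \<open>\<psi>\<close> is \<open>q c\<close>, and so is the composite
    of \<open>QM.TA \<psi>\<close> with \<open>q y\<close>.\<close>
  have "y \<cdot> TA (c \<cdot> \<eta> X) = (y \<cdot> TA c) \<cdot> TA (\<eta> X)"
    using TA_Comp[OF \<eta>X c(2)] Comp_assoc[OF TA_Hom[OF \<eta>X] Tc y] by simp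
  also have "\<dots> = c"
    unfolding module_homD(4)[OF cM, symmetric]
    using Comp_assoc[OF TA_Hom[OF \<eta>X] \<mu>X c(2)] mu_TA_eta[OF X] Comp_Idn[OF c(2)] by simp
  finally have "q y \<cdot>\<^bsub>Q\<^esub> QM.TA \<psi> = q c"
    unfolding \<psi>_def QM_TA_q[OF c\<eta>] using q_Comp[OF TA_Hom[OF c\<eta>] y] by simp
  then have "module_hom Q QM X \<rho> Y (q y) \<psi>"
    using X\<rho> Phi_module[OF yM] \<psi> \<psi>\<rho> by (simp add: module_hom_def)
  then show ?thesis using that yM iso by blast
qed

lemma Phi_bar_equivalence: "is_equivalence QMod.Q QM.Mod (Phi_bar C N M)"
proof (rule equivalenceI[OF Phi_bar_functor])
  show "f = g" if "f \<in> Hom QMod.Q P P'" "g \<in> Hom QMod.Q P P'" "\<Phi> f = \<Phi> g" for f g P P'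
    using Phi_bar_faithful[OF that] .
  show "\<exists>f \<in> Hom QMod.Q P P'. \<Phi> f = h"
    if "P \<in> Obj QMod.Q" "P' \<in> Obj QMod.Q" "h \<in> Hom QM.Mod (OMap (Phi_bar C N M) P) (OMap (Phi_bar C N M) P')"
    for P P' h
    using that Phi_bar_full by simp
  show "\<exists>P \<in> Obj QMod.Q. \<exists>\<psi> \<in> Hom QM.Mod (OMap (Phi_bar C N M) P) R. is_iso QM.Mod \<psi>"
    if R: "R \<in> Obj QM.Mod" for R
  proof -
    interpret QMM: category QM.Mod by (rule QM.category_module_cat)
    obtain X \<rho> where X: "R = (X, \<rho>)" by (cases R)
    then have "(X, \<rho>) \<in> modules Q QM" using R by simp
    then obtain Y y \<psi> where y: "(Y, y) \<in> modules C M" and \<psi>: "module_hom Q QM X \<rho> Y (q y) \<psi>" "is_iso Q \<psi>"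
      by (rule Phi_bar_surj)
    define \<Psi> where "\<Psi> = ((X, \<rho>), (Y, q y), \<psi>)"
    have \<Psi>: "\<Psi> \<in> Hom QM.Mod R (Y, q y)" "is_iso QM.Mod \<Psi>"
      unfolding \<Psi>_def using \<psi>(1) X QM.module_hom_iso[OF \<psi>] by auto
    obtain \<chi> where \<chi>: "\<chi> \<in> Hom QM.Mod (Y, q y) R" "\<chi> \<cdot>\<^bsub>QM.Mod\<^esub> \<Psi> = Idn QM.Mod R"
      "\<Psi> \<cdot>\<^bsub>QM.Mod\<^esub> \<chi> = Idn QM.Mod (Y, q y)" using QMM.isoE[OF \<Psi>(2,1)] .
    \<comment> \<open>The criterion asks for an isomorphism from a value of the functor to
      \<open>R\<close>, so the inverse of \<open>\<Psi>\<close> is handed over.\<close>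
    have "is_iso QM.Mod \<chi>" by (rule QMM.isoI[OF \<chi>(1) \<Psi>(1) \<chi>(3,2)])
    then show ?thesis using \<chi>(1) y by (intro bexI[of _ "(Y, y)"] bexI[of _ \<chi>]) auto
  qed
qed

end

theorem proposition4p3:
  fixes A :: "('o, 'a) cat" and M :: "('o, 'a) monad" and N :: "'o set"
  assumes "abelian_category A"
    and "exact_monad A M"
    and "serre_subcategory A N"
    and "\<forall>X \<in> N. OMap (Endo M) X \<in> N"
  shows "is_equivalence
    (quotient_cat (module_cat A M) (modules_in A M N))
    (module_cat (quotient_cat A N) (induced_monad A N M))
    (Phi_bar A N M)"
proof -
  obtain add zero where "abelian A add zero" using abelian_categoryE[OF assms(1)] .
  then interpret abelian A add zero .
  interpret exact_monad_serre A add zero N M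
    by unfold_locales (use assms in \<open>auto simp: exact_monad_def\<close>)
  show ?thesis by (rule Phi_bar_equivalence)
qed

end
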